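(* Let $1\le d\le k-1$ be fixed integers. If there exists a constant $c^*>0$ such that $f_d(k,n)\sim c^*\binom{n-d}{k-d}$ as $n\to\infty$, then $$m_d(k,n)\sim \max\left\{c^*,\tfrac12\right\}\binom{n-d}{k-d}$$ as $n\to\infty$ (with $n$ divisible by $k$).
   Context: A $k$-graph ($k$-uniform hypergraph) is a pair $H=(V,E)$ with $V$ finite and $E\subseteq\binom{V}{k}$ a set of $k$-element subsets of $V$, called edges. A matching in $H$ is a set of pairwise disjoint edges; $\nu(H)$ is the maximum number of edges in a matching. A fractional matching is a function $w:E\to[0,1]$ with $\sum_{e\ni v}w(e)\le 1$ for every $v\in V$; its size is $\sum_{e\in E}w(e)$, and $\nu^*(H)$ is the maximum size of a fractional matching. For $0\le d\le k-1$ and $S\in\binom{V}{d}$, $\deg_H(S)$ is the number of edges containing $S$, and $\delta_d(H)=\min_{S\in\binom Vd}\deg_H(S)$ (so $\delta_0(H)=|E|$). $m_d(k,n)$, defined for $n$ divisible by $k$, is the minimum $m$ such that every $n$-vertex $k$-graph $H$ with $\delta_d(H)\ge m$ satisfies $\nu(H)\ge n/k$ (i.e. has a perfect matching). $f_d(k,n)$, defined for all $n\ge k$, is the minimum $m$ such that every $n$-vertex $k$-graph $H$ with $\delta_d(H)\ge m$ satisfies $\nu^*(H)\ge n/k$ (i.e. has a perfect fractional matching). $a_n\sim b_n$ means $a_n/b_n\to1$ as $n\to\infty$. *)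

theory Defs
  imports "HOL-Analysis.Analysis" "HOL-Library.Landau_Symbols" "HOL-Library.Ramsey"
begin

definition kgraph :: "nat \<Rightarrow> 'a set \<Rightarrow> 'a set set \<Rightarrow> bool" where
  "kgraph k V E \<longleftrightarrow> finite V \<and> E \<subseteq> nsets V k"

definition matching :: "'a set set \<Rightarrow> 'a set set \<Rightarrow> bool" where
  "matching E M \<longleftrightarrow> M \<subseteq> E \<and> pairwise disjnt M"

definition matching_number :: "'a set set \<Rightarrow> nat" where
  "matching_number E = Max (card ` {M. matching E M})"

text \<open>A weight function is a total function on sets; only its values on \<open>E\<close> matter.\<close>

definition fractional_matching :: "'a set \<Rightarrow> 'a set set \<Rightarrow> ('a set \<Rightarrow> real) \<Rightarrow> bool" where
  "fractional_matching V E w \<longleftrightarrow>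
     (\<forall>e\<in>E. 0 \<le> w e \<and> w e \<le> 1) \<and> (\<forall>v\<in>V. (\<Sum>e | e \<in> E \<and> v \<in> e. w e) \<le> 1)"

text \<open>For a finite hypergraph the set of sizes below is the image of a nonempty compact polytope
  under a linear map, so this supremum is a maximum.\<close>

definition fractional_matching_number :: "'a set \<Rightarrow> 'a set set \<Rightarrow> real" where
  "fractional_matching_number V E = Sup ((\<lambda>w. \<Sum>e\<in>E. w e) ` {w. fractional_matching V E w})"

definition degree :: "'a set set \<Rightarrow> 'a set \<Rightarrow> nat" where
  "degree E S = card {e \<in> E. S \<subseteq> e}"

text \<open>Meaningful only if \<open>d \<le> card V\<close>; otherwise the minimum ranges over the empty set.\<close>

definition min_degree :: "nat \<Rightarrow> 'a set \<Rightarrow> 'a set set \<Rightarrow> nat" where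
  "min_degree d V E = Min (degree E ` nsets V d)"

text \<open>The thresholds quantify over hypergraphs with vertices in \<^typ>\<open>nat\<close>, which represent all
  finite hypergraphs up to isomorphism. The first is meant for \<open>n\<close> divisible by \<open>k\<close>,
  the second for \<open>n \<ge> k\<close>.\<close>

definition matching_threshold :: "nat \<Rightarrow> nat \<Rightarrow> nat \<Rightarrow> nat" where
  "matching_threshold d k n =
     (LEAST m. \<forall>(V :: nat set) E. kgraph k V E \<longrightarrow> card V = n \<longrightarrow> min_degree d V E \<ge> m \<longrightarrow>
        real (matching_number E) \<ge> real n / real k)"

definition fractional_threshold :: "nat \<Rightarrow> nat \<Rightarrow> nat \<Rightarrow> nat" where
  "fractional_threshold d k n =
     (LEAST m. \<forall>(V :: nat set) E. kgraph k V E \<longrightarrow> card V = n \<longrightarrow> min_degree d V E \<ge> m \<longrightarrow>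
        fractional_matching_number V E \<ge> real n / real k)"

end

theory Submission
  imports Defs
begin

text \<open>
  The lower bound holds because a perfect matching is a perfect fractional matching, and because the
  \<open>k\<close>-sets that meet a fixed set of odd size about \<open>n / 2\<close> in an even number of vertices form a
  hypergraph without perfect matching in which every degree is about half of the maximum.

  For the upper bound, degrees above \<open>1 / 2 + \<gamma>\<close> give every \<open>k\<close>-set many absorbers, and a random small
  selection of them is an absorbing family. It remains to find a matching that misses few of the other
  vertices. Complete a maximum matching to a partition into \<open>k\<close>-blocks and suppose that it misses
  a positive proportion of the vertices. Most samples of \<open>t\<close> blocks contain an unmatched one and induce
  hypergraphs whose minimum degree exceeds the fractional threshold for \<open>t\<close> vertices. By Erdos's theorem
  on complete multipartite subhypergraphs, some sample can be blown up: each of its \<open>t\<close> blocks can be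
  replaced independently by any of \<open>L\<close> blocks. Rounding \<open>L\<close> times a perfect fractional matching of the sample
  gives more than \<open>(t - 1) * L\<close> disjoint edges inside these \<open>t * L\<close> blocks, which contain at most
  \<open>(t - 1) * L\<close> edges of the matching, contradicting maximality. All probabilities are proportions
  of finite function spaces.
\<close>

section \<open>Concentration on finite product spaces\<close>

text \<open>The fractional threshold is applied to patterns on a fixed number \<open>t\<close> of
  vertices, never to the whole hypergraph: a pattern has at most \<open>2 ^ t\<close> edges, so
  rounding its weights costs a constant, which a large \<open>L\<close> outweighs. Blocks rather
  than single vertices are exchanged because then every edge of the old matching lies entirely
  inside or entirely outside the changed region. A sample of \<open>t\<close> blocks is encoded by
  one vertex per block; the other vertices are reached by \<open>k\<close> shifts, and each shift
  has its own pattern. One pattern yields about \<open>t * L / k\<close> edges, so only all shifts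
  together can compete with the old matching. The pigeonhole principle makes all these patterns
  constant on the box.

  The density \<open>1 / 2\<close> has two roles: above it any two vertex links overlap, which
  creates absorbers, and below it parity can prevent a perfect matching. The order of the constants
  matters: the size of the absorbing family, then the proportion \<open>\<zeta>\<close> that it can
  absorb, then the tolerated uncovered proportion \<open>\<eta>\<close>, then \<open>t\<close>, then
  \<open>L\<close>, and \<open>n\<close> last.\<close>

lemma sum_PiE_insert:
  fixes h :: "('i \<Rightarrow> 'b) \<Rightarrow> 'c::comm_monoid_add"
  assumes "i \<notin> I"
  shows "(\<Sum>x\<in>PiE (insert i I) (\<lambda>_. B). h x) = (\<Sum>g\<in>PiE I (\<lambda>_. B). \<Sum>y\<in>B. h (g(i := y)))"
proof -
  have "(\<Sum>x\<in>PiE (insert i I) (\<lambda>_. B). h x) = (\<Sum>(y, g)\<in>B \<times> PiE I (\<lambda>_. B). h (g(i := y)))"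
    unfolding PiE_insert_eq
    by (subst sum.reindex[OF inj_combinator[OF assms]]) (auto intro!: sum.cong)
  also have "\<dots> = (\<Sum>y\<in>B. \<Sum>g\<in>PiE I (\<lambda>_. B). h (g(i := y)))"
    by (simp add: sum.cartesian_product)
  also have "\<dots> = (\<Sum>g\<in>PiE I (\<lambda>_. B). \<Sum>y\<in>B. h (g(i := y)))"
    by (rule sum.swap)
  finally show ?thesis .
qed

lemma sum_PiE_Un:
  fixes h :: "('i \<Rightarrow> 'b) \<Rightarrow> 'c::comm_monoid_add"
  assumes "P \<inter> Q = {}"
  shows "(\<Sum>v\<in>PiE (P \<union> Q) (\<lambda>_. B). h v) =
    (\<Sum>y\<in>PiE P (\<lambda>_. B). \<Sum>z\<in>PiE Q (\<lambda>_. B). h (\<lambda>i. if i \<in> P then y i else z i))"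
proof -
  have "(\<Sum>v\<in>PiE (P \<union> Q) (\<lambda>_. B). h v) =
     (\<Sum>(y, z)\<in>PiE P (\<lambda>_. B) \<times> PiE Q (\<lambda>_. B). h (\<lambda>i. if i \<in> P then y i else z i))"
  proof (rule sum.reindex_bij_witness[where i = "\<lambda>(y, z) i. if i \<in> P then y i else z i"
        and j = "\<lambda>v. (restrict v P, restrict v Q)"])
    fix v assume v: "v \<in> PiE (P \<union> Q) (\<lambda>_. B)"
    show "(case (restrict v P, restrict v Q) of (y, z) \<Rightarrow> \<lambda>i. if i \<in> P then y i else z i) = v"
      using v by (auto simp: fun_eq_iff PiE_def extensional_def)
    then show "(case (restrict v P, restrict v Q) of (y, z) \<Rightarrow> h (\<lambda>i. if i \<in> P then y i else z i)) = h v"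
      by auto
    show "(restrict v P, restrict v Q) \<in> PiE P (\<lambda>_. B) \<times> PiE Q (\<lambda>_. B)"
      using v by auto
  next
    fix p assume p: "p \<in> PiE P (\<lambda>_. B) \<times> PiE Q (\<lambda>_. B)"
    then obtain y z where yz: "p = (y, z)" "y \<in> PiE P (\<lambda>_. B)" "z \<in> PiE Q (\<lambda>_. B)" by auto
    have "restrict (\<lambda>i. if i \<in> P then y i else z i) P = y"
      using yz by (auto simp: fun_eq_iff PiE_def extensional_def)
    moreover have "restrict (\<lambda>i. if i \<in> P then y i else z i) Q = z"
      using yz assms by (auto simp: fun_eq_iff PiE_def extensional_def)
    ultimately show "(restrict (case p of (y, z) \<Rightarrow> \<lambda>i. if i \<in> P then y i else z i) P,
      restrict (case p of (y, z) \<Rightarrow> \<lambda>i. if i \<in> P then y i else z i) Q) = p"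
      using yz by auto
    show "(case p of (y, z) \<Rightarrow> \<lambda>i. if i \<in> P then y i else z i) \<in> PiE (P \<union> Q) (\<lambda>_. B)"
      using yz by (auto simp: PiE_def extensional_def Pi_def)
  qed
  then show ?thesis by (simp add: sum.cartesian_product)
qed

lemma card_PiE_Un:
  assumes "finite P" "finite Q" "finite B" "P \<inter> Q = {}"
  shows "card {v \<in> PiE (P \<union> Q) (\<lambda>_. B). Z v} =
    (\<Sum>y\<in>PiE P (\<lambda>_. B). card {z \<in> PiE Q (\<lambda>_. B). Z (\<lambda>i. if i \<in> P then y i else z i)})"
proof -
  have *: "card {x \<in> X. W x} = (\<Sum>x\<in>X. if W x then 1 else 0)" if "finite X" for X :: "('a \<Rightarrow> 'b) set" and W
    using that by (simp add: sum.If_cases Int_def)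
  show ?thesis
    using assms by (simp add: * finite_PiE sum_PiE_Un)
qed

text \<open>The coordinates outside \<open>P\<close> are free, so every admissible choice on
  \<open>P\<close> extends in the same number of ways. This turns conditions on few vertices into
  densities in the whole sample space.\<close>

lemma card_PiE_cylinder:
  assumes "finite I" "finite B" "P \<subseteq> I" and Z: "\<And>v w. (\<And>i. i \<in> P \<Longrightarrow> v i = w i) \<Longrightarrow> Z v \<longleftrightarrow> Z w"
  shows "card {v \<in> PiE I (\<lambda>_. B). Z v} = card {y \<in> PiE P (\<lambda>_. B). Z y} * card B ^ (card I - card P)"
proof -
  have I: "P \<union> (I - P) = I" using assms by auto
  have fin: "finite P" using assms(1,3) by (simp add: finite_subset)
  have "card {v \<in> PiE I (\<lambda>_. B). Z v} =
    (\<Sum>y\<in>PiE P (\<lambda>_. B). card {z \<in> PiE (I - P) (\<lambda>_. B). Z (\<lambda>i. if i \<in> P then y i else z i)})"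
    using card_PiE_Un[of P "I - P" B Z] fin assms(1,2) unfolding I by simp
  also have "\<dots> = (\<Sum>y\<in>PiE P (\<lambda>_. B). if Z y then card B ^ (card I - card P) else 0)"
  proof (rule sum.cong[OF refl])
    fix y
    have "Z (\<lambda>i. if i \<in> P then y i else z i) = Z y" for z by (rule Z) auto
    then show "card {z \<in> PiE (I - P) (\<lambda>_. B). Z (\<lambda>i. if i \<in> P then y i else z i)} = (if Z y then card B ^ (card I - card P) else 0)"
      using assms(1-3) by (simp add: card_funcsetE card_Diff_subset fin)
  qed
  also have "\<dots> = card {y \<in> PiE P (\<lambda>_. B). Z y} * card B ^ (card I - card P)"
    using fin assms(2) by (simp add: sum.If_cases finite_PiE Int_def)
  finally show ?thesis .
qed

text \<open>An elementary substitute for Hoeffding's lemma. The range of \<open>z\<close> is the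
  reason for the assumption \<open>c \<le> 1\<close> in the moment bounds that follow.\<close>

lemma exp_le_quadratic:
  fixes z :: real
  assumes "\<bar>z\<bar> \<le> 1"
  shows "exp z \<le> 1 + z + z\<^sup>2"
proof (cases "z \<ge> 0")
  case True then show ?thesis using exp_bound assms by auto
next
  case False
  define u where "u = - z"
  have u: "0 \<le> u" "u \<le> 1" "z = - u" using False assms by (auto simp: u_def)
  \<comment> \<open>The linear terms cancel, so the quadratic times the second Taylor polynomial of
    \<open>exp u\<close> is at least 1; hence the quadratic is at least
    \<open>exp (- u)\<close>.\<close>
  have "(1 - u + u\<^sup>2) * (2 + 2 * u + u\<^sup>2) = 2 + u\<^sup>2 + u^3 + u^4"
    by (simp add: algebra_simps power2_eq_square power3_eq_cube power4_eq_xxxx)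
  then have "2 \<le> (1 - u + u\<^sup>2) * (2 + 2 * u + u\<^sup>2)"
    using u by simp
  also have "\<dots> = 2 * ((1 - u + u\<^sup>2) * (1 + u + u\<^sup>2 / 2))"
    by (simp add: distrib_left)
  finally have "1 \<le> (1 - u + u\<^sup>2) * (1 + u + u\<^sup>2 / 2)" by simp
  also have "\<dots> \<le> (1 - u + u\<^sup>2) * exp u"
    by (rule mult_left_mono[OF exp_lower_Taylor_quadratic]) (use u in auto)
  finally have "inverse (exp u) \<le> 1 - u + u\<^sup>2"
    by (simp add: field_simps)
  then show ?thesis using u by (simp add: exp_minus)
qed

text \<open>Subtracting the mean makes the linear term of \<open>exp_le_quadratic\<close> sum to
  zero; only the quadratic term survives, at most \<open>c\<^sup>2\<close> per point.\<close>

lemma sum_exp_deviation_le: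
  fixes g :: "'b \<Rightarrow> real" and c :: real
  assumes "finite B" "B \<noteq> {}" "c \<le> 1" and d: "\<And>x y. x \<in> B \<Longrightarrow> y \<in> B \<Longrightarrow> \<bar>g x - g y\<bar> \<le> c"
  shows "(\<Sum>x\<in>B. exp ((\<Sum>y\<in>B. g y) / card B - g x)) \<le> card B * exp (c\<^sup>2)"
proof -
  define m where "m = (\<Sum>y\<in>B. g y) / card B"
  have N: "real (card B) > 0" using assms by (simp add: card_gt_0_iff)
  have mc: "\<bar>m - g x\<bar> \<le> c" if "x \<in> B" for x
  proof -
    have "(m - g x) * card B = (\<Sum>y\<in>B. g y - g x)"
      using N by (simp add: m_def sum_subtractf field_simps)
    also have "\<bar>\<dots>\<bar> \<le> (\<Sum>y\<in>B. \<bar>g y - g x\<bar>)" by (rule sum_abs)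
    also have "\<dots> \<le> (\<Sum>y\<in>B. c)" by (rule sum_mono) (use d that in auto)
    finally have "\<bar>m - g x\<bar> * card B \<le> c * card B" by (simp add: abs_mult mult.commute)
    then show ?thesis using N by simp
  qed
  have "(\<Sum>x\<in>B. exp (m - g x)) \<le> (\<Sum>x\<in>B. 1 + (m - g x) + c\<^sup>2)"
  proof (rule sum_mono)
    fix x assume x: "x \<in> B"
    have "exp (m - g x) \<le> 1 + (m - g x) + (m - g x)\<^sup>2"
      using mc[OF x] \<open>c \<le> 1\<close> by (intro exp_le_quadratic) auto
    moreover have "(m - g x)\<^sup>2 \<le> c\<^sup>2" using mc[OF x] by (simp add: abs_le_square_iff[symmetric])
    ultimately show "exp (m - g x) \<le> 1 + (m - g x) + c\<^sup>2" by simp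
  qed
  also have "\<dots> = card B * (1 + c\<^sup>2)"
    using N by (simp add: sum.distrib sum_subtractf m_def algebra_simps)
  also have "\<dots> \<le> card B * exp (c\<^sup>2)"
    by (intro mult_left_mono) auto
  finally show ?thesis by (simp add: m_def)
qed

text \<open>McDiarmid's inequality for the uniform measure on \<open>I \<rightarrow>\<^sub>E B\<close>, averaging out one coordinate at a time.\<close>

lemma sum_exp_bounded_difference:
  fixes f :: "('i \<Rightarrow> 'b) \<Rightarrow> real" and c :: real
  assumes "finite I" "finite B" "B \<noteq> {}" "c \<le> 1"
    and "\<And>x i b. x \<in> PiE I (\<lambda>_. B) \<Longrightarrow> i \<in> I \<Longrightarrow> b \<in> B \<Longrightarrow> \<bar>f (x(i := b)) - f x\<bar> \<le> c"
  shows "(\<Sum>x\<in>PiE I (\<lambda>_. B). exp ((\<Sum>y\<in>PiE I (\<lambda>_. B). f y) / card B ^ card I - f x))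
    \<le> card B ^ card I * exp (card I * c\<^sup>2)"
  using assms(1,5)
proof (induction I arbitrary: f rule: finite_induct)
  case empty
  then show ?case by simp
next
  case (insert i I)
  let ?X = "PiE I (\<lambda>_. B)"
  have N: "real (card B) > 0" using assms by (simp add: card_gt_0_iff)
  define f' where "f' g = (\<Sum>y\<in>B. f (g(i := y))) / card B" for g
  have mem: "g(i := y) \<in> PiE (insert i I) (\<lambda>_. B)" if "g \<in> ?X" "y \<in> B" for g y
    using that by (intro PiE_fun_upd)
  have f': "\<bar>f' (x(j := b)) - f' x\<bar> \<le> c" if "x \<in> ?X" "j \<in> I" "b \<in> B" for x j b
  proof -
    have ji: "j \<noteq> i" using that insert by auto
    have "\<bar>(f' (x(j := b)) - f' x) * card B\<bar> = \<bar>\<Sum>y\<in>B. f ((x(i := y))(j := b)) - f (x(i := y))\<bar>"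
      using N by (simp add: f'_def sum_subtractf left_diff_distrib fun_upd_twist[OF ji])
    also have "\<dots> \<le> (\<Sum>y\<in>B. \<bar>f ((x(i := y))(j := b)) - f (x(i := y))\<bar>)" by (rule sum_abs)
    also have "\<dots> \<le> (\<Sum>y\<in>B. c)"
      by (intro sum_mono insert.prems mem that(1,3)) (simp_all add: that(2))
    finally show ?thesis using N by (simp add: abs_mult mult.commute)
  qed
  define m where "m = (\<Sum>y\<in>PiE (insert i I) (\<lambda>_. B). f y) / card B ^ card (insert i I)"
  have m: "m = (\<Sum>g\<in>?X. f' g) / card B ^ card I"
    using insert.hyps N by (simp add: m_def sum_PiE_insert f'_def sum_divide_distrib[symmetric])
  \<comment> \<open>The exponent splits into the deviation of the average \<open>f'\<close>, to
    which the induction hypothesis applies, and the deviation in the single coordinate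
    \<open>i\<close> with \<open>g\<close> fixed.\<close>
  have "(\<Sum>x\<in>PiE (insert i I) (\<lambda>_. B). exp (m - f x)) =
      (\<Sum>g\<in>?X. exp (m - f' g) * (\<Sum>y\<in>B. exp (f' g - f (g(i := y)))))"
    using insert.hyps by (simp add: sum_PiE_insert sum_distrib_left exp_add[symmetric])
  also have "\<dots> \<le> (\<Sum>g\<in>?X. exp (m - f' g) * (card B * exp (c\<^sup>2)))"
  proof (intro sum_mono mult_left_mono)
    fix g assume g: "g \<in> ?X"
    have "\<bar>f (g(i := x)) - f (g(i := y))\<bar> \<le> c" if "x \<in> B" "y \<in> B" for x y
      using insert.prems[OF mem[OF g \<open>y \<in> B\<close>], of i x] that by (simp only: fun_upd_upd insertI1)
    then show "(\<Sum>y\<in>B. exp (f' g - f (g(i := y)))) \<le> card B * exp (c\<^sup>2)"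
      unfolding f'_def by (intro sum_exp_deviation_le assms) auto
  qed auto
  also have "\<dots> = (\<Sum>g\<in>?X. exp (m - f' g)) * (card B * exp (c\<^sup>2))"
    by (simp add: sum_distrib_right)
  also have "\<dots> \<le> (card B ^ card I * exp (card I * c\<^sup>2)) * (card B * exp (c\<^sup>2))"
    using insert.IH[OF f'] m by (intro mult_right_mono) auto
  also have "\<dots> = card B ^ card (insert i I) * exp (card (insert i I) * c\<^sup>2)"
    using insert.hyps by (simp add: distrib_right exp_add mult_ac)
  finally show ?case by (simp add: m_def)
qed

text \<open>Exponential Markov inequality for the lower tail, applied to the function
  \<open>l * f\<close>, whose increments are at most \<open>l * c\<close>.\<close>

lemma bounded_difference_tail:
  fixes f :: "('i \<Rightarrow> 'b) \<Rightarrow> real" and \<epsilon> \<mu> c :: real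
  assumes "finite I" "I \<noteq> {}" "finite B" "B \<noteq> {}" "0 < c" "0 < \<epsilon>" "\<epsilon> \<le> 2 * c * card I"
    and diff: "\<And>x i b. x \<in> PiE I (\<lambda>_. B) \<Longrightarrow> i \<in> I \<Longrightarrow> b \<in> B \<Longrightarrow> \<bar>f (x(i := b)) - f x\<bar> \<le> c"
    and mean: "\<mu> * card B ^ card I \<le> (\<Sum>x\<in>PiE I (\<lambda>_. B). f x)"
  shows "card {x \<in> PiE I (\<lambda>_. B). f x \<le> \<mu> - \<epsilon>} \<le> card B ^ card I * exp (- (\<epsilon>\<^sup>2 / (4 * card I * c\<^sup>2)))"
proof -
  let ?X = "PiE I (\<lambda>_. B)"
  have t: "real (card I) > 0" using assms by (simp add: card_gt_0_iff)
  have N: "real (card B) > 0" using assms by (simp add: card_gt_0_iff)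
  have fin: "finite ?X" using assms by (simp add: finite_PiE)
  \<comment> \<open>This \<open>l\<close> minimises
    \<open>card I * (l * c)\<^sup>2 - l * \<epsilon>\<close>; the assumption
    \<open>\<epsilon> \<le> 2 * c * card I\<close> says exactly that
    \<open>l * c \<le> 1\<close>.\<close>
  define l where "l = \<epsilon> / (2 * card I * c\<^sup>2)"
  have l: "l > 0" using assms(5,6) t by (simp add: l_def)
  have lc: "l * c \<le> 1" using assms(5,7) t by (simp add: l_def field_simps power2_eq_square)
  define m where "m = (\<Sum>y\<in>?X. l * f y) / card B ^ card I"
  have "l * (\<mu> * card B ^ card I) \<le> l * (\<Sum>x\<in>?X. f x)"
    using mean l by (intro mult_left_mono) auto
  then have m: "m \<ge> l * \<mu>"
    using N by (simp add: m_def sum_distrib_left[symmetric] pos_le_divide_eq mult.assoc)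
  have "\<bar>l * f (x(i := b)) - l * f x\<bar> \<le> l * c" if "x \<in> ?X" "i \<in> I" "b \<in> B" for x i b
    using diff[OF that] l by (simp add: right_diff_distrib[symmetric] abs_mult)
  from sum_exp_bounded_difference[OF assms(1,3,4) lc this]
  have 1: "(\<Sum>x\<in>?X. exp (m - l * f x)) \<le> card B ^ card I * exp (card I * (l * c)\<^sup>2)"
    unfolding m_def .
  have "card {x \<in> ?X. f x \<le> \<mu> - \<epsilon>} * exp (l * \<epsilon>) = (\<Sum>x\<in>{x \<in> ?X. f x \<le> \<mu> - \<epsilon>}. exp (l * \<epsilon>))" by simp
  also have "\<dots> \<le> (\<Sum>x\<in>{x \<in> ?X. f x \<le> \<mu> - \<epsilon>}. exp (m - l * f x))"
  proof (rule sum_mono)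
    fix x assume "x \<in> {x \<in> ?X. f x \<le> \<mu> - \<epsilon>}"
    then have "l * f x \<le> l * (\<mu> - \<epsilon>)" using l by auto
    then show "exp (l * \<epsilon>) \<le> exp (m - l * f x)" using m by (simp add: algebra_simps)
  qed
  also have "\<dots> \<le> (\<Sum>x\<in>?X. exp (m - l * f x))"
    by (rule sum_mono2) (use fin in auto)
  finally have "card {x \<in> ?X. f x \<le> \<mu> - \<epsilon>} * exp (l * \<epsilon>) \<le> card B ^ card I * exp (card I * (l * c)\<^sup>2)"
    using 1 by linarith
  then have "card {x \<in> ?X. f x \<le> \<mu> - \<epsilon>} \<le> card B ^ card I * (exp (card I * (l * c)\<^sup>2) / exp (l * \<epsilon>))"
    by (simp add: pos_le_divide_eq)
  also have "exp (card I * (l * c)\<^sup>2) / exp (l * \<epsilon>) = exp (card I * (l * c)\<^sup>2 - l * \<epsilon>)"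
    by (simp add: exp_diff)
  also have "card I * (l * c)\<^sup>2 - l * \<epsilon> = - (\<epsilon>\<^sup>2 / (4 * card I * c\<^sup>2))"
  proof -
    have "l * (card I * c\<^sup>2) = \<epsilon> / 2" using t assms(5) by (simp add: l_def)
    then have "card I * (l * c)\<^sup>2 = l * (\<epsilon> / 2)"
      by (metis (no_types, opaque_lifting) mult.assoc mult.left_commute power2_eq_square)
    moreover have "\<epsilon>\<^sup>2 / (4 * card I * c\<^sup>2) = l * \<epsilon> / 2" by (simp add: l_def power2_eq_square)
    ultimately show ?thesis by simp
  qed
  finally show ?thesis .
qed

lemma power_times_exp_tendsto_0:
  fixes \<kappa> :: real
  assumes "0 < \<kappa>"
  shows "(\<lambda>n. real n ^ k * exp (- (\<kappa> * real n))) \<longlonglongrightarrow> 0"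
proof -
  have "((\<lambda>x. x ^ k / exp x) \<longlongrightarrow> (0::real)) at_top" by (rule tendsto_power_div_exp_0)
  moreover have "filterlim (\<lambda>t. \<kappa> * real t) at_top sequentially"
    using assms by (intro filterlim_tendsto_pos_mult_at_top[OF tendsto_const] filterlim_real_sequentially)
  ultimately have "(\<lambda>t. (\<kappa> * real t) ^ k / exp (\<kappa> * real t)) \<longlonglongrightarrow> 0"
    by (rule filterlim_compose)
  then have "(\<lambda>t. 1 / \<kappa> ^ k * ((\<kappa> * real t) ^ k / exp (\<kappa> * real t))) \<longlonglongrightarrow> 1 / \<kappa> ^ k * 0"
    by (intro tendsto_intros)
  moreover have "1 / \<kappa> ^ k * ((\<kappa> * real t) ^ k / exp (\<kappa> * real t)) = real t ^ k * exp (- (\<kappa> * real t))" for t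
    using assms by (simp add: power_mult_distrib exp_minus field_simps)
  ultimately show ?thesis by simp
qed

lemma sum_card_swap:
  assumes "finite A" "finite B"
  shows "(\<Sum>a\<in>A. card {b \<in> B. P a b}) = (\<Sum>b\<in>B. card {a \<in> A. P a b})"
proof -
  have "(\<Sum>a\<in>A. card {b \<in> B. P a b}) = (\<Sum>a\<in>A. \<Sum>b\<in>B. of_bool (P a b))"
    using assms by (simp add: of_bool_def sum.If_cases Int_def)
  also have "\<dots> = (\<Sum>b\<in>B. \<Sum>a\<in>A. of_bool (P a b))" by (rule sum.swap)
  also have "\<dots> = (\<Sum>b\<in>B. card {a \<in> A. P a b})"
    using assms by (simp add: of_bool_def sum.If_cases Int_def)
  finally show ?thesis .
qed

lemma sum_real_card_swap:
  assumes "finite A" "finite B"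
  shows "(\<Sum>a\<in>A. real (card {b \<in> B. P a b})) = (\<Sum>b\<in>B. real (card {a \<in> A. P a b}))"
  unfolding of_nat_sum[symmetric] sum_card_swap[OF assms] ..

section \<open>Boxes in dense sets of tuples\<close>

text \<open>Induction on the arity. A dense \<open>F\<close> has a positive proportion of prefixes
  with linearly many last entries. Averaging over all \<open>L\<close>-sets gives one
  \<open>Y\<close> contained in the extension sets of a positive proportion of prefixes, and the
  induction hypothesis finds the other sides among these. The sides may overlap; where they must be
  separated, this is derived from the properties of the tuples in \<open>F\<close>.\<close>

lemma complete_partite_box:
  fixes \<delta> :: real and L t :: nat
  assumes "\<delta> > 0" "L > 0"
  shows "\<exists>N. \<forall>(B :: 'b set) F. finite B \<longrightarrow> N \<le> card B \<longrightarrow> F \<subseteq> PiE {..<t} (\<lambda>_. B) \<longrightarrow>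
    \<delta> * real (card B) ^ t \<le> real (card F) \<longrightarrow>
    (\<exists>A. (\<forall>i<t. A i \<subseteq> B \<and> card (A i) = L) \<and> PiE {..<t} A \<subseteq> F)"
  using assms(1)
proof (induction t arbitrary: \<delta>)
  case 0
  show ?case
  proof (intro exI[of _ 0] allI impI exI[of _ "\<lambda>_. {}"] conjI)
    fix B :: "'b set" and F :: "(nat \<Rightarrow> 'b) set"
    assume F: "F \<subseteq> PiE {..<0} (\<lambda>_. B)" "\<delta> * real (card B) ^ 0 \<le> real (card F)"
    then have "F \<noteq> {}" using 0 by auto
    then show "PiE {..<0::nat} (\<lambda>_. {}) \<subseteq> F" using F by auto
  qed auto
next
  case (Suc t)
  \<comment> \<open>Product of two losses: \<open>\<delta> / 2\<close> for the prefixes in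
    \<open>G\<close>, and \<open>(\<delta> / (2 * L)) ^ L\<close> for the \<open>L\<close>-sets
    inside one \<open>D g\<close>, counted against \<open>N ^ L\<close>.\<close>
  define \<delta>' where "\<delta>' = \<delta> / 2 * (\<delta> / (2 * L)) ^ L"
  have "\<delta>' > 0" using Suc.prems assms by (simp add: \<delta>'_def)
  from Suc.IH[OF this] obtain N0 where N0:
    "\<And>(B :: 'b set) F. finite B \<Longrightarrow> N0 \<le> card B \<Longrightarrow> F \<subseteq> PiE {..<t} (\<lambda>_. B) \<Longrightarrow>
      \<delta>' * real (card B) ^ t \<le> real (card F) \<Longrightarrow>
      (\<exists>A. (\<forall>i<t. A i \<subseteq> B \<and> card (A i) = L) \<and> PiE {..<t} A \<subseteq> F)"
    by metis
  \<comment> \<open>The bound \<open>2 * L / \<delta>\<close> makes \<open>\<delta> / 2 * N\<close>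
    at least \<open>L\<close>, so every \<open>D g\<close> with \<open>g\<close> in \<open>G\<close>
    is large enough for the lower bound on its number of \<open>L\<close>-sets.\<close>
  define N1 where "N1 = max (max N0 1) (nat \<lceil>2 * L / \<delta>\<rceil>)"
  show ?case
  proof (intro exI[of _ N1] allI impI)
    fix B :: "'b set" and F :: "(nat \<Rightarrow> 'b) set"
    assume B: "finite B" "N1 \<le> card B" and F: "F \<subseteq> PiE {..<Suc t} (\<lambda>_. B)"
      "\<delta> * real (card B) ^ Suc t \<le> real (card F)"
    define N where "N = real (card B)"
    have N: "N > 0" "real N0 \<le> N" "N \<ge> 2 * L / \<delta>"
      using B by (auto simp: N_def N1_def)
    have \<delta>N: "0 \<le> \<delta> * N" using N(1) Suc.prems by simp
    have NL: "real L \<le> \<delta> / 2 * N"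
      using N(3) Suc.prems by (simp add: field_simps)
    let ?X = "PiE {..<t} (\<lambda>_. B)"
    define D where "D g = {y \<in> B. g(t := y) \<in> F}" for g
    define G where "G = {g \<in> ?X. \<delta> / 2 * N \<le> card (D g)}"
    have finX: "finite ?X" using B(1) by (simp add: finite_PiE)
    have cX: "real (card ?X) = N ^ t" by (simp add: card_funcsetE N_def)
    have finD: "finite (D g)" and DB: "card (D g) \<le> card B" for g
      using B by (auto simp: D_def intro: card_mono)
    have finG: "finite G" "G \<subseteq> ?X" using finX by (auto simp: G_def)
    have "card F = (\<Sum>x\<in>PiE (insert t {..<t}) (\<lambda>_. B). of_bool (x \<in> F))"
      using F(1) B by (simp add: of_bool_def sum.If_cases finite_PiE lessThan_Suc Int_absorb1)
    also have "\<dots> = (\<Sum>g\<in>?X. card (D g))"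
      using B by (subst sum_PiE_insert) (auto simp: D_def of_bool_def sum.If_cases Int_def)
    finally have "real (card F) = (\<Sum>g\<in>?X. real (card (D g)))" by simp
    also have "\<dots> \<le> (\<Sum>g\<in>?X. (if g \<in> G then N else 0) + \<delta> / 2 * N)"
    proof (rule sum_mono)
      fix g assume "g \<in> ?X"
      moreover have "real (card (D g)) \<le> N" using DB by (simp add: N_def)
      ultimately show "real (card (D g)) \<le> (if g \<in> G then N else 0) + \<delta> / 2 * N"
        using \<delta>N by (cases "g \<in> G") (auto simp: G_def)
    qed
    also have "\<dots> = card G * N + N ^ t * (\<delta> / 2 * N)"
      using finX finG by (simp add: sum.distrib sum.If_cases cX Int_absorb1)
    finally have "\<delta> * N ^ Suc t \<le> (card G + N ^ t * (\<delta> / 2)) * N"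
      using F(2) by (simp add: N_def algebra_simps)
    then have "(\<delta> / 2 * N ^ t) * N \<le> card G * N" by (simp add: algebra_simps)
    then have cG: "\<delta> / 2 * N ^ t \<le> card G" using N by simp
    moreover have "0 < \<delta> / 2 * N ^ t" using N(1) Suc.prems by simp
    ultimately have Gne: "G \<noteq> {}" by auto
    have large: "(\<delta> / (2 * L) * N) ^ L \<le> card {Y \<in> nsets B L. Y \<subseteq> D g}" if "g \<in> G" for g
    proof -
      have g: "\<delta> / 2 * N \<le> card (D g)" using that by (simp add: G_def)
      have "{Y \<in> nsets B L. Y \<subseteq> D g} = nsets (D g) L"
        by (auto simp: nsets_def D_def)
      then have c: "card {Y \<in> nsets B L. Y \<subseteq> D g} = card (D g) choose L" by (simp add: card_nsets)
      have "(\<delta> / (2 * L) * N) ^ L \<le> (card (D g) / L) ^ L"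
        using divide_right_mono[OF g, of "real L"] Suc.prems N(1) by (intro power_mono) simp_all
      also have "\<dots> \<le> real (card (D g) choose L)"
        using g NL by (intro binomial_ge_n_over_k_pow_k) linarith
      finally show ?thesis by (simp add: c)
    qed
    have "\<exists>Y \<in> nsets B L. \<delta>' * N ^ t \<le> card {g \<in> G. Y \<subseteq> D g}"
    proof (rule ccontr)
      assume neg: "\<not> ?thesis"
      have "\<delta>' * N ^ t * N ^ L = \<delta> / 2 * N ^ t * (\<delta> / (2 * L) * N) ^ L"
        unfolding \<delta>'_def power_mult_distrib by (simp only: mult_ac)
      also have "\<dots> \<le> (\<Sum>g\<in>G. (\<delta> / (2 * L) * N) ^ L)"
        unfolding sum_constant of_nat_id by (rule mult_right_mono[OF cG]) (use Suc.prems N in simp)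
      also have "\<dots> \<le> (\<Sum>g\<in>G. real (card {Y \<in> nsets B L. Y \<subseteq> D g}))"
        by (rule sum_mono) (rule large)
      also have "\<dots> = (\<Sum>Y\<in>nsets B L. real (card {g \<in> G. Y \<subseteq> D g}))"
        using B(1) by (intro sum_real_card_swap finG) (simp add: finite_imp_finite_nsets)
      also have "\<dots> < (\<Sum>Y\<in>nsets B L. \<delta>' * N ^ t)"
      proof (rule sum_strict_mono)
        obtain g where g: "g \<in> G" using Gne by auto
        have "0 < (\<delta> / (2 * L) * N) ^ L" using Suc.prems N assms by simp
        then have "card {Y \<in> nsets B L. Y \<subseteq> D g} \<noteq> 0" using large[OF g] by linarith
        then show "nsets B L \<noteq> {}" by (metis (no_types, lifting) Collect_empty_eq card.empty empty_iff)
      qed (use neg B in \<open>auto simp: not_le finite_imp_finite_nsets\<close>)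
      also have "\<dots> = \<delta>' * N ^ t * (card B choose L)" by (simp add: card_nsets)
      also have "\<dots> \<le> \<delta>' * N ^ t * N ^ L"
      proof (rule mult_left_mono)
        show "real (card B choose L) \<le> N ^ L"
          using le_trans[OF _ binomial_fact_pow, of "card B choose L" "card B" L]
          unfolding N_def by (simp flip: of_nat_power)
      qed (use \<open>\<delta>' > 0\<close> N in auto)
      finally show False by simp
    qed
    then obtain Y where Y: "Y \<in> nsets B L" "\<delta>' * N ^ t \<le> card {g \<in> G. Y \<subseteq> D g}" by blast
    have "{g \<in> G. Y \<subseteq> D g} \<subseteq> ?X" using finG by auto
    from N0[OF B(1) _ this] Y N obtain A where A: "\<forall>i<t. A i \<subseteq> B \<and> card (A i) = L"
      "PiE {..<t} A \<subseteq> {g \<in> G. Y \<subseteq> D g}" by (auto simp: N_def)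
    show "\<exists>A. (\<forall>i<Suc t. A i \<subseteq> B \<and> card (A i) = L) \<and> PiE {..<Suc t} A \<subseteq> F"
    proof (intro exI[of _ "A(t := Y)"] conjI allI impI)
      show "(A(t := Y)) i \<subseteq> B" "card ((A(t := Y)) i) = L" if "i < Suc t" for i
        using that A(1) Y(1) by (auto simp: nsets_def less_Suc_eq)
      show "PiE {..<Suc t} (A(t := Y)) \<subseteq> F"
      proof
        fix x assume "x \<in> PiE {..<Suc t} (A(t := Y))"
        then obtain y g where x: "x = g(t := y)" "y \<in> Y" "g \<in> PiE {..<t} (A(t := Y))"
          by (auto simp: lessThan_Suc PiE_insert_eq)
        have "PiE {..<t} (A(t := Y)) = PiE {..<t} A" by (rule PiE_cong) auto
        then have "Y \<subseteq> D g" using x A by auto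
        then show "x \<in> F" using x by (auto simp: D_def)
      qed
    qed
  qed
qed

section \<open>Degrees in random samples\<close>

text \<open>Each edge above \<open>S\<close> arises from the \<open>fact (k - d)\<close> bijections
  of \<open>R\<close> onto the rest of the edge. This is why degree conditions compare
  \<open>fact r * degree\<close> with \<open>card V ^ r\<close>, the number of all
  functions.\<close>

lemma link_functions_card_ge:
  assumes E: "kgraph k V E" and S: "S \<in> nsets V d" and R: "finite R" "card R = k - d"
  shows "fact (k - d) * degree E S \<le> card {y \<in> PiE R (\<lambda>_. V). S \<union> y ` R \<in> E}"
proof -
  define EE where "EE = {e \<in> E. S \<subseteq> e}"
  define Y where "Y e = {f \<in> PiE R (\<lambda>_. e - S). inj_on f R}" for e
  have fV: "finite V" and EV: "E \<subseteq> nsets V k" using E by (auto simp: kgraph_def)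
  then have fE: "finite E" using finite_imp_finite_nsets finite_subset by blast
  have e: "finite e" "card (e - S) = k - d" "e \<subseteq> V" if "e \<in> EE" for e
    using that S EV by (auto simp: EE_def nsets_def card_Diff_subset)
  have img: "f ` R = e - S" if "e \<in> EE" "f \<in> Y e" for e f
  proof (rule card_subset_eq)
    show "card (f ` R) = card (e - S)" using that e(2) R by (simp add: Y_def card_image)
  qed (use that e in \<open>auto simp: Y_def\<close>)
  have "card (\<Union>e\<in>EE. Y e) = (\<Sum>e\<in>EE. card (Y e))"
  proof (rule card_UN_disjoint)
    show "finite EE" using fE by (simp add: EE_def)
    show "\<forall>e\<in>EE. finite (Y e)" using R e by (auto simp: Y_def finite_PiE)
    show "\<forall>e\<in>EE. \<forall>e'\<in>EE. e \<noteq> e' \<longrightarrow> Y e \<inter> Y e' = {}"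
    proof (intro ballI impI, rule ccontr)
      fix e e' assume h: "e \<in> EE" "e' \<in> EE" "e \<noteq> e'" "Y e \<inter> Y e' \<noteq> {}"
      then obtain f where "f \<in> Y e" "f \<in> Y e'" by auto
      then have "e - S = e' - S" using img h by metis
      then show False using h by (auto simp: EE_def)
    qed
  qed
  also have "\<dots> = (\<Sum>e\<in>EE. fact (k - d))"
  proof (rule sum.cong[OF refl])
    fix e assume "e \<in> EE"
    then show "card (Y e) = fact (k - d)"
      using card_inj_on_subset_funcset[of R "e - S" R] R e
      by (simp add: Y_def fact_prod_rev)
  qed
  also have "\<dots> = fact (k - d) * degree E S" by (simp add: EE_def degree_def)
  finally have "fact (k - d) * degree E S = card (\<Union>e\<in>EE. Y e)" ..
  also have "\<dots> \<le> card {y \<in> PiE R (\<lambda>_. V). S \<union> y ` R \<in> E}"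
  proof (rule card_mono)
    show "finite {y \<in> PiE R (\<lambda>_. V). S \<union> y ` R \<in> E}" using fV R by (simp add: finite_PiE)
    show "(\<Union>e\<in>EE. Y e) \<subseteq> {y \<in> PiE R (\<lambda>_. V). S \<union> y ` R \<in> E}"
    proof
      fix f assume "f \<in> (\<Union>e\<in>EE. Y e)"
      then obtain e' where h: "e' \<in> EE" "f \<in> Y e'" by auto
      have "S \<union> f ` R = e'" using img[OF h] h by (auto simp: EE_def)
      moreover have "f \<in> PiE R (\<lambda>_. V)" using h e(3)[OF h(1)] by (auto simp: Y_def PiE_def)
      ultimately show "f \<in> {y \<in> PiE R (\<lambda>_. V). S \<union> y ` R \<in> E}" using h by (simp add: EE_def)
    qed
  qed
  finally show ?thesis .
qed

lemma card_nsets_containing: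
  assumes "finite Q" "i \<in> Q" "r > 0"
  shows "card {R \<in> nsets Q r. i \<in> R} = (card Q - 1) choose (r - 1)"
proof -
  have eq: "nsets Q r = {R \<in> nsets Q r. i \<in> R} \<union> nsets (Q - {i}) r"
    by (auto simp: nsets_def)
  have "card (nsets Q r) = card {R \<in> nsets Q r. i \<in> R} + card (nsets (Q - {i}) r)"
    by (subst eq, rule card_Un_disjoint) (use assms(1) in \<open>auto simp: finite_imp_finite_nsets nsets_def\<close>)
  then have "card Q choose r = card {R \<in> nsets Q r. i \<in> R} + ((card Q - 1) choose r)"
    using assms by (simp add: card_nsets)
  moreover have "0 < card Q" using assms by (auto simp: card_gt_0_iff)
  ultimately show ?thesis using choose_reduce_nat[of "card Q" r] assms(3) by simp
qed

text \<open>With \<open>S\<close> fixed, moving one sampled vertex affects only the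
  \<open>r\<close>-sets through its index, a proportion \<open>r / card Q\<close> of all. The
  bounded difference inequality with this increment gives an exponent linear in
  \<open>card Q\<close>.\<close>

lemma sampled_link_tail:
  fixes a \<epsilon> :: real
  assumes E: "kgraph k V E" and V: "V \<noteq> {}" and S: "S \<in> nsets V d" and r: "r = k - d" "0 < r"
    and Q: "finite Q" "r \<le> card Q" and deg: "a * real (card V) ^ r \<le> fact r * degree E S"
    and \<epsilon>: "0 < \<epsilon>" "\<epsilon> \<le> 1"
  shows "real (card {z \<in> PiE Q (\<lambda>_. V). card {R \<in> nsets Q r. S \<union> z ` R \<in> E} \<le> (a - \<epsilon>) * (card Q choose r)})
    \<le> real (card V) ^ card Q * exp (- (\<epsilon>\<^sup>2 * card Q / (4 * real r ^ 2)))"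
proof -
  define q where "q = card Q"
  define n where "n = card V"
  define C where "C = real (q choose r)"
  define f where "f z = card {R \<in> nsets Q r. S \<union> z ` R \<in> E} / C" for z
  have fV: "finite V" using E by (auto simp: kgraph_def)
  have q: "0 < q" "r \<le> q" using Q r by (auto simp: q_def)
  have C: "C > 0" using q by (simp add: C_def)
  have fR: "finite {R \<in> nsets Q r. P R}" for P using Q by (simp add: finite_imp_finite_nsets)
  have Cr: "real ((q - 1) choose (r - 1)) = C * (r / q)"
  proof -
    have "r * (q choose r) = q * ((q - 1) choose (r - 1))" using times_binomial_minus1_eq r by blast
    then have "real r * C = real q * real ((q - 1) choose (r - 1))"
      unfolding C_def by (metis of_nat_mult)
    then show ?thesis using q by (simp add: field_simps)
  qed
  have le: "card {R \<in> nsets Q r. S \<union> x ` R \<in> E} \<le> card {R \<in> nsets Q r. S \<union> y ` R \<in> E} + C * (r / q)"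
    if "i \<in> Q" and xy: "\<And>j. j \<noteq> i \<Longrightarrow> x j = y j" for x y i
  proof -
    have "S \<union> y ` R \<in> E" if "S \<union> x ` R \<in> E" "i \<notin> R" for R
    proof -
      have "x j = y j" if "j \<in> R" for j using that \<open>i \<notin> R\<close> xy by metis
      then have "x ` R = y ` R" by (intro image_cong) auto
      then show ?thesis using that by simp
    qed
    then have "{R \<in> nsets Q r. S \<union> x ` R \<in> E} \<subseteq> {R \<in> nsets Q r. S \<union> y ` R \<in> E} \<union> {R \<in> nsets Q r. i \<in> R}"
      by auto
    then have "card {R \<in> nsets Q r. S \<union> x ` R \<in> E} \<le> card ({R \<in> nsets Q r. S \<union> y ` R \<in> E} \<union> {R \<in> nsets Q r. i \<in> R})"
      by (intro card_mono) (auto simp: fR)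
    also have "\<dots> \<le> card {R \<in> nsets Q r. S \<union> y ` R \<in> E} + card {R \<in> nsets Q r. i \<in> R}"
      by (rule card_Un_le)
    also have "\<dots> \<le> card {R \<in> nsets Q r. S \<union> y ` R \<in> E} + ((q - 1) choose (r - 1))"
      using card_nsets_containing[OF Q(1) that(1) r(2)] by (simp add: q_def)
    finally have "real (card {R \<in> nsets Q r. S \<union> x ` R \<in> E}) \<le>
      real (card {R \<in> nsets Q r. S \<union> y ` R \<in> E}) + real ((q - 1) choose (r - 1))" by linarith
    then show ?thesis unfolding Cr[symmetric] .
  qed
  have fle: "f x \<le> f y + r / q" if "i \<in> Q" "\<And>j. j \<noteq> i \<Longrightarrow> x j = y j" for x y i
    using divide_right_mono[OF le[OF that], where c = C] C by (simp add: f_def add_divide_distrib)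
  have diff: "\<bar>f (x(i := b)) - f x\<bar> \<le> r / q" if "i \<in> Q" for x i b
    using fle[OF that, of "x(i := b)" x] fle[OF that, of x "x(i := b)"] by auto
  \<comment> \<open>The mean is at least \<open>a\<close> by double counting: each
    \<open>r\<close>-set \<open>R\<close> taken alone spans an edge with \<open>S\<close> in a
    proportion at least \<open>a\<close> of the samples.\<close>
  have "a * real n ^ q * C = (\<Sum>R\<in>nsets Q r. a * real n ^ r * real n ^ (q - r))"
    using q Q by (simp add: C_def card_nsets q_def mult.assoc power_add[symmetric])
  also have "\<dots> \<le> (\<Sum>R\<in>nsets Q r. real (card {z \<in> PiE Q (\<lambda>_. V). S \<union> z ` R \<in> E}))"
  proof (rule sum_mono)
    fix R assume "R \<in> nsets Q r"
    then have R: "R \<subseteq> Q" "finite R" "card R = k - d" by (auto simp: nsets_def r)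
    have "card {z \<in> PiE Q (\<lambda>_. V). S \<union> z ` R \<in> E} =
        card {y \<in> PiE R (\<lambda>_. V). S \<union> y ` R \<in> E} * card V ^ (card Q - card R)"
    proof (rule card_PiE_cylinder[OF Q(1) fV R(1)])
      fix v w :: "'b \<Rightarrow> 'a" assume "\<And>i. i \<in> R \<Longrightarrow> v i = w i"
      then have "v ` R = w ` R" by (intro image_cong) auto
      then show "(S \<union> v ` R \<in> E) = (S \<union> w ` R \<in> E)" by simp
    qed
    moreover have "a * real n ^ r \<le> real (card {y \<in> PiE R (\<lambda>_. V). S \<union> y ` R \<in> E})"
    proof -
      have "real (fact r * degree E S) \<le> real (card {y \<in> PiE R (\<lambda>_. V). S \<union> y ` R \<in> E})"
        using link_functions_card_ge[OF E S R(2,3)] unfolding r(1) of_nat_le_iff .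
      then show ?thesis using deg by (simp add: n_def)
    qed
    ultimately show "a * real n ^ r * real n ^ (q - r) \<le> real (card {z \<in> PiE Q (\<lambda>_. V). S \<union> z ` R \<in> E})"
      using R r by (simp add: n_def q_def mult_right_mono)
  qed
  also have "\<dots> = (\<Sum>z\<in>PiE Q (\<lambda>_. V). real (card {R \<in> nsets Q r. S \<union> z ` R \<in> E}))"
    using Q fV by (intro sum_real_card_swap) (auto simp: finite_imp_finite_nsets finite_PiE)
  also have "\<dots> = (\<Sum>z\<in>PiE Q (\<lambda>_. V). f z) * C"
    using C by (simp add: f_def sum_divide_distrib[symmetric])
  finally have mean: "a * real (card V ^ card Q) \<le> (\<Sum>z\<in>PiE Q (\<lambda>_. V). f z)"
    using C by (simp add: n_def q_def)
  have "real (card {z \<in> PiE Q (\<lambda>_. V). f z \<le> a - \<epsilon>}) \<le> real (card V ^ card Q) * exp (- (\<epsilon>\<^sup>2 / (4 * card Q * (r / q)\<^sup>2)))"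
  proof (rule bounded_difference_tail)
    show "\<epsilon> \<le> 2 * (real r / real q) * real (card Q)" using q r \<epsilon> by (simp add: q_def)
  qed (use Q fV V q r \<epsilon> diff mean in \<open>auto simp: q_def\<close>)
  also have "\<epsilon>\<^sup>2 / (4 * card Q * (r / q)\<^sup>2) = \<epsilon>\<^sup>2 * card Q / (4 * real r ^ 2)"
    using q by (simp add: q_def[symmetric] power_divide power2_eq_square)
  also have "{z \<in> PiE Q (\<lambda>_. V). f z \<le> a - \<epsilon>} = {z \<in> PiE Q (\<lambda>_. V). card {R \<in> nsets Q r. S \<union> z ` R \<in> E} \<le> (a - \<epsilon>) * (card Q choose r)}"
    using C by (simp add: f_def C_def q_def pos_divide_le_eq)
  finally show ?thesis by simp
qed

text \<open>Union bound over the \<open>d\<close>-sets \<open>S\<close> of indices. The values on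
  \<open>S\<close> are held fixed and the other \<open>t - d\<close> coordinates are random, so
  \<open>sampled_link_tail\<close> applies to the image of \<open>S\<close>; injectivity makes this
  image a \<open>d\<close>-set.\<close>

lemma sampled_min_degree:
  fixes a \<epsilon> :: real
  assumes E: "kgraph k V E" and V: "V \<noteq> {}" and r: "r = k - d" "0 < r" and t: "k \<le> t"
    and deg: "\<And>S. S \<in> nsets V d \<Longrightarrow> a * real (card V) ^ r \<le> fact r * degree E S"
    and \<epsilon>: "0 < \<epsilon>" "\<epsilon> \<le> 1"
  shows "real (card {v \<in> PiE {..<t} (\<lambda>_. V). inj_on v {..<t} \<and>
      (\<exists>S\<in>nsets {..<t} d. degree {e \<in> nsets {..<t} k. v ` e \<in> E} S \<le> (a - \<epsilon>) * ((t - d) choose r))})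
    \<le> (t choose d) * (real (card V) ^ t * exp (- (\<epsilon>\<^sup>2 * real (t - d) / (4 * real r ^ 2))))"
proof -
  define D where "D v S = real (degree {e \<in> nsets {..<t} k. v ` e \<in> E} S)" for v :: "nat \<Rightarrow> 'a" and S
  define x where "x = (a - \<epsilon>) * ((t - d) choose r)"
  define p where "p = exp (- (\<epsilon>\<^sup>2 * real (t - d) / (4 * real r ^ 2)))"
  define Bad where "Bad S = {v \<in> PiE {..<t} (\<lambda>_. V). inj_on v {..<t} \<and> D v S \<le> x}" for S
  have fV: "finite V" using E by (auto simp: kgraph_def)
  have rt: "r \<le> t - d" using r t by simp
  have one: "real (card (Bad S)) \<le> real (card V) ^ t * p" if S: "S \<in> nsets {..<t} d" for S
  proof -
    define Q where "Q = {..<t} - S"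
    have SQ: "S \<union> Q = {..<t}" "S \<inter> Q = {}" "finite S" "finite Q" "card S = d" "card Q = t - d"
      using S by (auto simp: Q_def nsets_def card_Diff_subset)
    have rQ: "r \<le> card Q" using SQ rt by simp
    have "real (card (Bad S)) = (\<Sum>y\<in>PiE S (\<lambda>_. V). real (card {z \<in> PiE Q (\<lambda>_. V).
        inj_on (\<lambda>i. if i \<in> S then y i else z i) {..<t} \<and> D (\<lambda>i. if i \<in> S then y i else z i) S \<le> x}))"
      using card_PiE_Un[OF SQ(3,4) fV SQ(2), of "\<lambda>v. inj_on v {..<t} \<and> D v S \<le> x"]
      unfolding Bad_def SQ(1) by simp
    also have "\<dots> \<le> (\<Sum>y\<in>PiE S (\<lambda>_. V). real (card V) ^ (t - d) * p)"
    proof (rule sum_mono)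
      fix y assume y: "y \<in> PiE S (\<lambda>_. V)"
      let ?m = "\<lambda>z i. if i \<in> S then y i else z i"
      let ?Z = "{z \<in> PiE Q (\<lambda>_. V). inj_on (?m z) {..<t} \<and> D (?m z) S \<le> x}"
      show "real (card ?Z) \<le> real (card V) ^ (t - d) * p"
      \<comment> \<open>If no injective sample extends \<open>y\<close>, there is nothing to count;
        otherwise \<open>y\<close> itself is injective on \<open>S\<close>.\<close>
      proof (cases "?Z = {}")
        case True
        then show ?thesis by (simp only: card.empty) (simp add: p_def)
      next
        case False
        then obtain z where "inj_on (?m z) {..<t}" by auto
        then have "inj_on (?m z) S" using SQ(1) by (auto intro: inj_on_subset)
        then have "inj_on y S" by (simp add: inj_on_def)
        then have S': "y ` S \<in> nsets V d" using y SQ by (auto simp: nsets_def card_image)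
        have "?Z \<subseteq> {z \<in> PiE Q (\<lambda>_. V). card {R \<in> nsets Q r. y ` S \<union> z ` R \<in> E} \<le> (a - \<epsilon>) * (card Q choose r)}"
        proof safe
          fix z assume z: "D (?m z) S \<le> x"
          have "card {R \<in> nsets Q r. y ` S \<union> z ` R \<in> E} \<le> degree {e \<in> nsets {..<t} k. ?m z ` e \<in> E} S"
            unfolding degree_def
          proof (rule card_inj_on_le[where f = "\<lambda>R. S \<union> R"])
            show "inj_on ((\<union>) S) {R \<in> nsets Q r. y ` S \<union> z ` R \<in> E}"
              using SQ(2) by (auto simp: inj_on_def nsets_def)
            show "(\<union>) S ` {R \<in> nsets Q r. y ` S \<union> z ` R \<in> E} \<subseteq> {e \<in> {e \<in> nsets {..<t} k. ?m z ` e \<in> E}. S \<subseteq> e}"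
            proof safe
              fix R assume R: "R \<in> nsets Q r" "y ` S \<union> z ` R \<in> E"
              have RQ: "R \<inter> S = {}" "finite R" "card R = r" "R \<subseteq> Q" using R SQ(2) by (auto simp: nsets_def)
              have "?m z ` (S \<union> R) = y ` S \<union> z ` R" using RQ by (auto simp: image_iff)
              then show "?m z ` (S \<union> R) \<in> E" using R by simp
              have "card (S \<union> R) = k" using SQ(3,5) RQ r by (simp add: card_Un_disjoint Int_commute)
              moreover have "S \<union> R \<subseteq> {..<t}" using SQ(1) RQ(4) by blast
              ultimately show "S \<union> R \<in> nsets {..<t} k" using SQ(3) RQ(2) by (simp add: nsets_def)
            qed
            show "finite {e \<in> {e \<in> nsets {..<t} k. ?m z ` e \<in> E}. S \<subseteq> e}"
              by (simp add: finite_imp_finite_nsets)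
          qed
          then show "card {R \<in> nsets Q r. y ` S \<union> z ` R \<in> E} \<le> (a - \<epsilon>) * (card Q choose r)"
            using z by (simp add: D_def x_def SQ)
        qed
        then have "card ?Z \<le> card {z \<in> PiE Q (\<lambda>_. V). card {R \<in> nsets Q r. y ` S \<union> z ` R \<in> E} \<le> (a - \<epsilon>) * (card Q choose r)}"
          using SQ fV by (intro card_mono) (auto simp: finite_PiE)
        then show ?thesis
          using sampled_link_tail[OF E V S' r SQ(4) rQ deg[OF S'] \<epsilon>] unfolding p_def SQ(6) by linarith
      qed
    qed
    also have "\<dots> = real (card V) ^ t * p"
    proof -
      have "d \<le> t" using r t by simp
      then show ?thesis using SQ by (simp add: card_funcsetE mult.assoc[symmetric] power_add[symmetric])
    qed
    finally show ?thesis .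
  qed
  have "card {v \<in> PiE {..<t} (\<lambda>_. V). inj_on v {..<t} \<and> (\<exists>S\<in>nsets {..<t} d. D v S \<le> x)} = card (\<Union>S\<in>nsets {..<t} d. Bad S)"
    by (rule arg_cong[where f = card]) (auto simp: Bad_def)
  also have "\<dots> \<le> (\<Sum>S\<in>nsets {..<t} d. card (Bad S))"
    by (rule card_UN_le) (simp add: finite_imp_finite_nsets)
  finally have "real (card {v \<in> PiE {..<t} (\<lambda>_. V). inj_on v {..<t} \<and> (\<exists>S\<in>nsets {..<t} d. D v S \<le> x)})
     \<le> (\<Sum>S\<in>nsets {..<t} d. real (card (Bad S)))" unfolding of_nat_sum[symmetric] of_nat_le_iff .
  also have "\<dots> \<le> (\<Sum>S\<in>nsets {..<t} d. real (card V) ^ t * p)" by (rule sum_mono) (rule one)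
  also have "\<dots> = (t choose d) * (real (card V) ^ t * p)" by (simp add: card_nsets)
  finally show ?thesis unfolding D_def x_def p_def .
qed

section \<open>Almost perfect matchings\<close>

lemma kgraph_finite_edges: "kgraph k V E \<Longrightarrow> finite E"
  unfolding kgraph_def by (meson finite_imp_finite_nsets finite_subset)

lemma finite_matchings: "finite E \<Longrightarrow> finite {M. matching E M}"
  by (rule finite_subset[of _ "Pow E"]) (auto simp: matching_def)

lemma card_le_matching_number:
  assumes "finite E" "matching E M"
  shows "card M \<le> matching_number E"
  unfolding matching_number_def using assms finite_matchings by (intro Max_ge) auto

lemma exists_maximum_matching:
  assumes "finite E"
  shows "\<exists>M. matching E M \<and> card M = matching_number E"
proof -
  have "matching E {}" by (simp add: matching_def)
  then have "matching_number E \<in> card ` {M. matching E M}"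
    unfolding matching_number_def using finite_matchings[OF assms] by (intro Max_in) auto
  then show ?thesis by auto
qed

lemma min_degree_ge_iff:
  assumes "finite V" "d \<le> card V"
  shows "m \<le> min_degree d V E \<longleftrightarrow> (\<forall>S\<in>nsets V d. m \<le> degree E S)"
proof -
  have "nsets V d \<noteq> {}" using assms by (simp add: nsets_eq_empty_iff)
  then show ?thesis
    using assms by (simp add: min_degree_def finite_imp_finite_nsets)
qed

lemma min_degree_le:
  assumes "kgraph k V E" "d \<le> card V"
  shows "min_degree d V E \<le> 2 ^ card V"
proof -
  have V: "finite V" "E \<subseteq> Pow V" using assms by (auto simp: kgraph_def nsets_def)
  obtain S where S: "S \<in> nsets V d" using assms V(1) by (metis ex_in_conv nsets_eq_empty_iff not_less)
  have "min_degree d V E \<le> degree E S"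
    using min_degree_ge_iff[OF V(1) assms(2)] S by blast
  also have "\<dots> \<le> card (Pow V)"
    unfolding degree_def using V by (intro card_mono) auto
  finally show ?thesis using V by (simp add: card_Pow)
qed

text \<open>The \<open>LEAST\<close> is attained: \<open>2 ^ card V + 1\<close> exceeds every
  minimum degree, so the defining property holds there vacuously.\<close>

lemma fractional_threshold_spec:
  fixes V :: "nat set"
  assumes "kgraph k V E" "d \<le> card V" "fractional_threshold d k (card V) \<le> min_degree d V E"
  shows "real (card V) / real k \<le> fractional_matching_number V E"
proof -
  let ?P = "\<lambda>m. \<forall>(W :: nat set) F. kgraph k W F \<longrightarrow> card W = card V \<longrightarrow> min_degree d W F \<ge> m \<longrightarrow>
        fractional_matching_number W F \<ge> real (card V) / real k"
  have "?P (2 ^ card V + 1)"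
    using min_degree_le assms(2) by (metis Suc_eq_plus1 not_less_eq_eq)
  then have "?P (fractional_threshold d k (card V))"
    unfolding fractional_threshold_def by (rule LeastI)
  then show ?thesis using assms by blast
qed

text \<open>The weight of \<open>e\<close> becomes \<open>m e\<close> copies of \<open>e\<close>,
  where \<open>m e\<close> is \<open>w e * L\<close> rounded down. The constraint at
  \<open>i\<close> says that at most \<open>L\<close> copies contain \<open>i\<close>, so these can
  be given distinct representatives in \<open>A i\<close>, and the representatives of one copy form
  an edge. Rounding costs at most one copy per edge of \<open>G\<close>.\<close>

lemma blowup_matching:
  fixes w :: "nat set \<Rightarrow> real" and A :: "nat \<Rightarrow> 'v set"
  assumes G: "G \<subseteq> nsets {..<t} k" "0 < k" and w: "fractional_matching {..<t} G w" and L: "0 < L"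
    and A: "\<And>i. i < t \<Longrightarrow> card (A i) = L"
    and disj: "\<And>i j. i < t \<Longrightarrow> j < t \<Longrightarrow> i \<noteq> j \<Longrightarrow> A i \<inter> A j = {}"
    and GE: "\<And>e v. e \<in> G \<Longrightarrow> v \<in> PiE {..<t} A \<Longrightarrow> v ` e \<in> E"
  shows "\<exists>M. matching E M \<and> finite M \<and> \<Union>M \<subseteq> (\<Union>i<t. A i) \<and> L * (\<Sum>e\<in>G. w e) - card G \<le> card M"
proof -
  define m where "m e = nat \<lfloor>w e * L\<rfloor>" for e
  define T where "T = (SIGMA e:G. {..<m e})"
  define Ti where "Ti i = (SIGMA e:{e \<in> G. i \<in> e}. {..<m e})" for i
  have fG: "finite G" using G by (meson finite_imp_finite_nsets finite_lessThan finite_subset)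
  have w0: "0 \<le> w e" if "e \<in> G" for e using w that by (auto simp: fractional_matching_def)
  have mle: "real (m e) \<le> w e * L" and mge: "w e * L - 1 \<le> real (m e)" if "e \<in> G" for e
  proof -
    have "0 \<le> w e * L" using w0[OF that] by simp
    then show "real (m e) \<le> w e * L" "w e * L - 1 \<le> real (m e)" by (simp_all add: m_def)
  qed
  have fT: "finite T" "\<And>i. finite (Ti i)" using fG by (auto simp: T_def Ti_def)
  have "\<exists>f. f ` Ti i \<subseteq> A i \<and> inj_on f (Ti i)" if i: "i < t" for i
  proof (rule card_le_inj)
    show "finite (A i)" using A[OF i] L by (metis card.infinite less_irrefl)
    have "real (card (Ti i)) = (\<Sum>e\<in>{e \<in> G. i \<in> e}. real (m e))" using fG by (simp add: Ti_def)
    also have "\<dots> \<le> (\<Sum>e\<in>{e \<in> G. i \<in> e}. w e * L)" using mle by (intro sum_mono) simp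
    also have "\<dots> = (\<Sum>e\<in>{e \<in> G. i \<in> e}. w e) * L" by (simp add: sum_distrib_right)
    also have "\<dots> \<le> 1 * real L" using w i by (intro mult_right_mono) (auto simp: fractional_matching_def)
    finally show "card (Ti i) \<le> card (A i)" using A[OF i] by simp
  qed (rule fT)
  then obtain \<psi> where \<psi>: "\<And>i. i < t \<Longrightarrow> \<psi> i ` Ti i \<subseteq> A i" "\<And>i. i < t \<Longrightarrow> inj_on (\<psi> i) (Ti i)" by metis
  define \<mu> where "\<mu> p = (\<lambda>i. \<psi> i p) ` fst p" for p
  have TiT: "p \<in> Ti i \<longleftrightarrow> p \<in> T \<and> i \<in> fst p" for p i by (auto simp: T_def Ti_def)
  have it: "i < t" if "p \<in> T" "i \<in> fst p" for p i 
  proof -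
    have "fst p \<in> nsets {..<t} k" using that G by (auto simp: T_def)
    then show ?thesis using that by (auto simp: nsets_def)
  qed
  have \<psi>A: "\<psi> i p \<in> A i" if "p \<in> T" "i \<in> fst p" for p i
    using \<psi>(1)[OF it[OF that]] that TiT by blast
  have eq: "p = q" if pq: "p \<in> T" "q \<in> T" "x \<in> \<mu> p" "x \<in> \<mu> q" for p q x
  proof -
    obtain i j where ij: "i \<in> fst p" "x = \<psi> i p" "j \<in> fst q" "x = \<psi> j q"
      using pq by (auto simp: \<mu>_def)
    have "x \<in> A i" "x \<in> A j" using \<psi>A[OF pq(1) ij(1)] \<psi>A[OF pq(2) ij(3)] ij by simp_all
    then have "i = j" using disj[of i j] it pq(1,2) ij by blast
    then show ?thesis using \<psi>(2)[of i] ij pq(1,2) TiT it by (metis inj_onD)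
  qed
  have ne: "\<mu> p \<noteq> {}" if "p \<in> T" for p
    using that G by (auto simp: \<mu>_def T_def nsets_def)
  have "inj_on \<mu> T"
  proof (rule inj_onI)
    fix p q assume pq: "p \<in> T" "q \<in> T" "\<mu> p = \<mu> q"
    then obtain x where x: "x \<in> \<mu> p" using ne[of p] by auto
    then show "p = q" using eq[OF pq(1,2), of x] pq(3) by simp
  qed
  have \<mu>E: "\<mu> p \<in> E" if p: "p \<in> T" for p
  proof -
    \<comment> \<open>\<open>GE\<close> speaks of full transversals, so the indices outside the edge
      receive arbitrary elements of \<open>A i\<close>.\<close>
    define v where "v = (\<lambda>i\<in>{..<t}. if i \<in> fst p then \<psi> i p else (SOME a. a \<in> A i))"
    have "A i \<noteq> {}" if "i < t" for i using A[OF that] L by auto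
    then have "v \<in> PiE {..<t} A" using \<psi>A[OF p] by (auto simp: v_def some_in_eq)
    moreover have "fst p \<in> G" using p by (auto simp: T_def)
    moreover have "v ` fst p = \<mu> p" using it[OF p] by (auto simp: v_def \<mu>_def)
    ultimately show ?thesis using GE by metis
  qed
  have "matching E (\<mu> ` T)"
    unfolding matching_def pairwise_def disjnt_def using \<mu>E eq by blast
  moreover have "\<Union>(\<mu> ` T) \<subseteq> (\<Union>i<t. A i)" using \<psi>A it unfolding \<mu>_def by blast
  moreover have "L * (\<Sum>e\<in>G. w e) - card G \<le> card (\<mu> ` T)"
  proof -
    have "L * (\<Sum>e\<in>G. w e) - card G = (\<Sum>e\<in>G. w e * L - 1)"
      by (simp add: sum_subtractf sum_distrib_left mult.commute)
    also have "\<dots> \<le> (\<Sum>e\<in>G. real (m e))" using mge by (intro sum_mono) simp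
    also have "\<dots> = card T" using fG by (simp add: T_def)
    also have "\<dots> = card (\<mu> ` T)" using \<open>inj_on \<mu> T\<close> by (simp add: card_image)
    finally show ?thesis .
  qed
  ultimately show ?thesis using fT by blast
qed

section \<open>Partitions into blocks of equal size and their cyclic shifts\<close>

lemma partition_on_Un:
  assumes "partition_on A P" "partition_on B Q" "A \<inter> B = {}"
  shows "partition_on (A \<union> B) (P \<union> Q)"
proof (rule partition_onI)
  fix p q assume pq: "p \<in> P \<union> Q" "q \<in> P \<union> Q" "p \<noteq> q"
  have sub: "r \<subseteq> A" if "r \<in> P" for r using that assms(1) by (auto simp: partition_on_def)
  have sub': "r \<subseteq> B" if "r \<in> Q" for r using that assms(2) by (auto simp: partition_on_def)
  show "disjnt p q"
  proof (cases "p \<in> P \<longleftrightarrow> q \<in> P")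
    case True
    then have "p \<in> P \<and> q \<in> P \<or> p \<in> Q \<and> q \<in> Q" using pq by blast
    then show ?thesis using assms(1,2) pq(3) by (auto simp: partition_on_def pairwise_def)
  next
    case False
    then have "p \<in> P \<and> q \<in> Q \<or> p \<in> Q \<and> q \<in> P" using pq by blast
    then show ?thesis using sub sub' assms(3) unfolding disjnt_def by blast
  qed
qed (use assms in \<open>auto simp: partition_on_def\<close>)

lemma exists_uniform_partition:
  assumes "finite A" "0 < k" "k dvd card A"
  shows "\<exists>P. partition_on A P \<and> (\<forall>p\<in>P. card p = k)"
  using assms
proof (induction "card A" arbitrary: A rule: less_induct)
  case less
  show ?case
  proof (cases "A = {}")
    case True
    then show ?thesis by (intro exI[of _ "{}"]) (simp add: partition_on_empty)
  next
    case False
    then have "k \<le> card A" using less.prems by (meson card_gt_0_iff dvd_imp_le)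
    then obtain p where p: "p \<subseteq> A" "card p = k" "finite p" using obtain_subset_with_card_n by metis
    have c: "card (A - p) = card A - k" using p by (simp add: card_Diff_subset)
    then obtain P where P: "partition_on (A - p) P" "\<forall>p\<in>P. card p = k"
      using less.hyps[of "A - p"] less.prems \<open>k \<le> card A\<close> by fastforce
    have "partition_on p {p}" using p less.prems by (intro partition_on_space) auto
    then have "partition_on ((A - p) \<union> p) (P \<union> {p})" using P by (intro partition_on_Un) auto
    moreover have "(A - p) \<union> p = A" using p by auto
    ultimately show ?thesis using P p by (intro exI[of _ "P \<union> {p}"]) auto
  qed
qed

lemma card_partition_on:
  assumes "finite A" "partition_on A P" "\<forall>p\<in>P. card p = k"
  shows "card A = k * card P"
proof -
  have "card (\<Union>P) = sum card P"
    using assms by (intro card_Union_disjoint) (auto simp: partition_on_def disjoint_def pairwise_def disjnt_def intro: finite_subset)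
  then show ?thesis using assms by (simp add: partition_on_def)
qed

text \<open>The blocks of \<open>P\<close> are ordered cyclically, and \<open>s l\<close> moves every vertex \<open>l\<close> steps forward in its
  block. As every \<open>s l\<close> is a bijection of \<open>V\<close>, a uniformly random \<open>v\<close> makes each \<open>s l v\<close> uniform, while
  \<open>s 0 v, \<dots>, s (k - 1) v\<close> together exhaust the block of \<open>v\<close>: sampling vertices samples whole blocks.\<close>

locale shifted_partition =
  fixes V :: "'v set" and P :: "'v set set" and k :: nat
    and blk :: "'v \<Rightarrow> 'v set" and lab :: "'v \<Rightarrow> nat" and s :: "nat \<Rightarrow> 'v \<Rightarrow> 'v"
  assumes fin: "finite V" and part: "partition_on V P" and cardP: "\<And>p. p \<in> P \<Longrightarrow> card p = k" and k: "0 < k"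
    and blk: "\<And>v. v \<in> V \<Longrightarrow> blk v \<in> P" "\<And>v. v \<in> V \<Longrightarrow> v \<in> blk v"
    and lab: "\<And>v. v \<in> V \<Longrightarrow> lab v < k"
    and blk_lab: "\<And>v v'. v \<in> V \<Longrightarrow> v' \<in> V \<Longrightarrow> blk v = blk v' \<Longrightarrow> lab v = lab v' \<Longrightarrow> v = v'"
    and s_blk: "\<And>v l. v \<in> V \<Longrightarrow> s l v \<in> blk v"
    and s_inj: "\<And>l. inj_on (s l) V"
    and s_lab: "\<And>v l l'. v \<in> V \<Longrightarrow> l < k \<Longrightarrow> l' < k \<Longrightarrow> s l v = s l' v \<Longrightarrow> l = l'"

lemma (in shifted_partition) blocks_disjoint: "p \<in> P \<Longrightarrow> q \<in> P \<Longrightarrow> x \<in> p \<Longrightarrow> x \<in> q \<Longrightarrow> p = q"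
  using part unfolding partition_on_def pairwise_def disjnt_def by blast

lemma (in shifted_partition) s_in: "v \<in> V \<Longrightarrow> s l v \<in> V"
  using s_blk blk(1) part unfolding partition_on_def by blast

lemma (in shifted_partition) s_same_block: "u \<in> V \<Longrightarrow> v \<in> V \<Longrightarrow> s l u = s l' v \<Longrightarrow> blk u = blk v"
  using s_blk blk(1) blocks_disjoint by metis

lemma exists_shifted_partition:
  assumes fin: "finite V" and part: "partition_on V P" and cardP: "\<And>p. p \<in> P \<Longrightarrow> card p = k" and k: "0 < k"
  shows "\<exists>blk lab s. shifted_partition V P k blk lab s"
proof -
  have "\<exists>f. bij_betw f {..<k} p" if "p \<in> P" for p
  proof -
    have "finite p" using cardP[OF that] k by (metis card.infinite less_irrefl)
    then show ?thesis using cardP[OF that] by (metis bij_betw_from_nat_into_finite ex_bij_betw_nat_finite lessThan_atLeast0)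
  qed
  then obtain en where en: "\<And>p. p \<in> P \<Longrightarrow> bij_betw (en p) {..<k} p" by metis
  have "\<exists>p. p \<in> P \<and> v \<in> p" if "v \<in> V" for v using that part by (auto simp: partition_on_def)
  then obtain blk where blk: "\<And>v. v \<in> V \<Longrightarrow> blk v \<in> P" "\<And>v. v \<in> V \<Longrightarrow> v \<in> blk v" by metis
  have disj: "p = q" if "p \<in> P" "q \<in> P" "x \<in> p" "x \<in> q" for p q x
    using part that unfolding partition_on_def pairwise_def disjnt_def by blast
  have "\<exists>l. l < k \<and> en (blk v) l = v" if "v \<in> V" for v
    using en[OF blk(1)[OF that]] blk(2)[OF that] unfolding bij_betw_def by (metis imageE lessThan_iff)
  then obtain lab where lab: "\<And>v. v \<in> V \<Longrightarrow> lab v < k" "\<And>v. v \<in> V \<Longrightarrow> en (blk v) (lab v) = v" by metis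
  \<comment> \<open>Addition modulo \<open>k\<close> is injective in each argument: in
    \<open>lab v\<close> for fixed \<open>l\<close>, which gives \<open>s_inj\<close> since blocks
    are disjoint, and in \<open>l < k\<close> for fixed \<open>v\<close>, which gives
    \<open>s_lab\<close>.\<close>
  define s where "s l v = en (blk v) ((lab v + l) mod k)" for l v
  have en_inj: "i = j" if "p \<in> P" "i < k" "j < k" "en p i = en p j" for p i j
    using en[OF that(1)] that unfolding bij_betw_def inj_on_def by simp
  have s_blk: "s l v \<in> blk v" if "v \<in> V" for v l
    using en[OF blk(1)[OF that]] k unfolding bij_betw_def s_def by auto
  have mod_le: "l = l'" if "l < k" "l \<le> l'" "l' < k" "(a + l) mod k = (a + l') mod k" for a l l' :: nat
  proof -
    have "k dvd (a + l') - (a + l)" using that by (subst mod_eq_dvd_iff_nat[symmetric]) auto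
    then have "k dvd l' - l" by simp
    then show ?thesis using that by (metis diff_is_0_eq dvd_imp_le le_antisym less_imp_diff_less not_le zero_less_iff_neq_zero)
  qed
  have mod: "l = l'" if "l < k" "l' < k" "(a + l) mod k = (a + l') mod k" for a l l' :: nat
    using mod_le[of l l' a] mod_le[of l' l a] that by (cases "l \<le> l'") auto
  have "shifted_partition V P k blk lab s"
  proof
    show "v = v'" if "v \<in> V" "v' \<in> V" "blk v = blk v'" "lab v = lab v'" for v v'
      using lab(2) that by metis
    show "inj_on (s l) V" for l
    proof (rule inj_onI)
      fix u v assume uv: "u \<in> V" "v \<in> V" "s l u = s l v"
      then have b: "blk u = blk v" using s_blk blk disj by metis
      then have "(lab u + l) mod k = (lab v + l) mod k"
        using uv en_inj[OF blk(1)[OF uv(1)]] k by (simp add: s_def)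
      then have "lab u = lab v" using mod[of "lab u" "lab v" l] lab(1) uv by (simp add: add.commute)
      then show "u = v" using lab(2) uv b by metis
    qed
    show "l = l'" if "v \<in> V" "l < k" "l' < k" "s l v = s l' v" for v l l'
    proof -
      have "(lab v + l) mod k = (lab v + l') mod k"
        using that en_inj[OF blk(1)[OF that(1)]] k by (simp add: s_def)
      then show ?thesis using mod that by blast
    qed
  qed (use fin part cardP k blk lab s_blk in auto)
  then show ?thesis by blast
qed


lemma fractional_matching_near_max:
  assumes "finite G" "x < fractional_matching_number W G"
  shows "\<exists>w. fractional_matching W G w \<and> x < (\<Sum>e\<in>G. w e)"
proof -
  have "fractional_matching W G (\<lambda>_. 0)" by (simp add: fractional_matching_def)
  then have "(\<lambda>w. \<Sum>e\<in>G. w e) ` {w. fractional_matching W G w} \<noteq> {}" by blast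
  from less_cSupD[OF this assms(2)[unfolded fractional_matching_number_def]] show ?thesis by auto
qed

text \<open>The \<open>t * L\<close> blocks met by the box contain at most \<open>(t - 1) * L\<close> edges of \<open>M\<close>. Blowing up near-optimal
  fractional matchings of the \<open>k\<close> patterns yields at least \<open>L * t - L / 2 - k * 2 ^ t\<close> disjoint edges inside these
  blocks, where \<open>L / 2\<close> accounts for near-optimality and \<open>k * 2 ^ t\<close> for rounding down the weights.\<close>

lemma (in shifted_partition) augment_in_box:
  fixes A :: "nat \<Rightarrow> 'v set" and Es :: "nat \<Rightarrow> nat set set"
  assumes E: "E \<subseteq> nsets V k" and M: "matching E M" "M \<subseteq> P"
    and L: "L = 2 * k * 2 ^ t + 1"
    and A: "\<And>i. i < t \<Longrightarrow> A i \<subseteq> V" "\<And>i. i < t \<Longrightarrow> card (A i) = L"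
    and labA: "\<And>i a b. i < t \<Longrightarrow> a \<in> A i \<Longrightarrow> b \<in> A i \<Longrightarrow> lab a = lab b"
    and blkA: "\<And>i j a b. i < t \<Longrightarrow> j < t \<Longrightarrow> i \<noteq> j \<Longrightarrow> a \<in> A i \<Longrightarrow> b \<in> A j \<Longrightarrow> blk a \<noteq> blk b"
    and i0: "i0 < t" "A i0 \<inter> \<Union>M = {}"
    and Es: "\<And>l. l < k \<Longrightarrow> Es l \<subseteq> nsets {..<t} k"
    and frac: "\<And>l. l < k \<Longrightarrow> real t / real k \<le> fractional_matching_number {..<t} (Es l)"
    and EsE: "\<And>l e v. l < k \<Longrightarrow> e \<in> Es l \<Longrightarrow> v \<in> PiE {..<t} A \<Longrightarrow> s l ` v ` e \<in> E"
  shows "\<exists>M'. matching E M' \<and> card M < card M'"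
proof -
  have L0: "0 < L" using L by simp
  have fE: "finite E" using E fin by (meson finite_imp_finite_nsets finite_subset)
  have fP: "finite P" using fin part by (rule finite_elements)
  have fM: "finite M" using M fP by (meson finite_subset)
  have eE: "e \<noteq> {}" if "e \<in> E" for e using that E k by (auto simp: nsets_def)
  \<comment> \<open>Shifts stay inside blocks, and by \<open>blkA\<close> a block determines the
    column. Inside a column all labels agree, and block and label determine the vertex.\<close>
  have same: "i = j \<and> a = b"
    if "i < t" "j < t" "a \<in> A i" "b \<in> A j" "s l a = s l' b" for i j a b l l'
  proof -
    have ab: "a \<in> V" "b \<in> V" using that A by blast+
    then have b: "blk a = blk b" using s_same_block that by blast
    then have "i = j" using blkA that by metis
    moreover have "a = b" using blk_lab[OF ab b] labA[OF that(1,3)] that(4) \<open>i = j\<close> by simp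
    ultimately show ?thesis by simp
  qed
  have "\<exists>N. matching E N \<and> finite N \<and> \<Union>N \<subseteq> (\<Union>i<t. s l ` A i) \<and> L * (real t / k - 1 / (2 * k)) - 2 ^ t \<le> card N"
    if l: "l < k" for l
  proof -
    have fEs: "finite (Es l)" "card (Es l) \<le> 2 ^ t"
    proof -
      have "Es l \<subseteq> Pow {..<t}" using Es[OF l] by (auto simp: nsets_def)
      then show "finite (Es l)" "card (Es l) \<le> 2 ^ t"
        using finite_subset card_mono[of "Pow {..<t}" "Es l"] by (auto simp: card_Pow)
    qed
    have "real t / k - 1 / (2 * k) < real t / k" using k by simp
    then have "real t / k - 1 / (2 * k) < fractional_matching_number {..<t} (Es l)"
      using frac[OF l] by linarith
    then obtain w where w: "fractional_matching {..<t} (Es l) w" "real t / k - 1 / (2 * k) < (\<Sum>e\<in>Es l. w e)"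
      using fractional_matching_near_max fEs by blast
    have "\<exists>N. matching E N \<and> finite N \<and> \<Union>N \<subseteq> (\<Union>i<t. s l ` A i) \<and> L * (\<Sum>e\<in>Es l. w e) - card (Es l) \<le> card N"
    proof (rule blowup_matching[OF Es[OF l] k w(1) L0])
      show "card (s l ` A i) = L" if "i < t" for i
        using A[OF that] s_inj[of l] by (metis card_image inj_on_subset)
      show "s l ` A i \<inter> s l ` A j = {}" if "i < t" "j < t" "i \<noteq> j" for i j
        using same[of i j _ _ l l] that by blast
      fix e v assume e: "e \<in> Es l" and v: "v \<in> PiE {..<t} (\<lambda>i. s l ` A i)"
      \<comment> \<open>A transversal of the shifted columns is pulled back to a transversal of
        \<open>A\<close>, where \<open>EsE\<close> applies.\<close>
      have "\<forall>i\<in>{..<t}. \<exists>a. a \<in> A i \<and> s l a = v i"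
      proof
        fix i assume "i \<in> {..<t}"
        then have "v i \<in> s l ` A i" using v by (rule PiE_mem[rotated])
        then show "\<exists>a. a \<in> A i \<and> s l a = v i" by auto
      qed
      then obtain u where u: "\<And>i. i \<in> {..<t} \<Longrightarrow> u i \<in> A i \<and> s l (u i) = v i" by metis
      have "restrict u {..<t} \<in> PiE {..<t} A" using u by auto
      moreover have "s l ` restrict u {..<t} ` e = v ` e"
      proof -
        have "e \<subseteq> {..<t}" using e Es[OF l] by (auto simp: nsets_def)
        then have "s l (restrict u {..<t} i) = v i" if "i \<in> e" for i using u that by auto
        then have "(\<lambda>i. s l (restrict u {..<t} i)) ` e = v ` e" by (intro image_cong) auto
        then show ?thesis by (simp only: image_image)
      qed
      ultimately show "v ` e \<in> E" using EsE[OF l e] by metis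
    qed
    then obtain N where N: "matching E N" "finite N" "\<Union>N \<subseteq> (\<Union>i<t. s l ` A i)"
      "L * (\<Sum>e\<in>Es l. w e) - card (Es l) \<le> card N" by (elim exE conjE)
    have "L * (real t / k - 1 / (2 * k)) \<le> L * (\<Sum>e\<in>Es l. w e)"
      using w(2) by (intro mult_left_mono) auto
    moreover have "real (card (Es l)) \<le> 2 ^ t" using of_nat_mono[OF fEs(2), where 'a = real] by simp
    ultimately have "L * (real t / k - 1 / (2 * k)) - 2 ^ t \<le> card N" using N(4) by linarith
    then show ?thesis using N by blast
  qed
  then obtain N where N: "\<And>l. l < k \<Longrightarrow> matching E (N l)" "\<And>l. l < k \<Longrightarrow> finite (N l)"
    "\<And>l. l < k \<Longrightarrow> \<Union>(N l) \<subseteq> (\<Union>i<t. s l ` A i)"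
    "\<And>l. l < k \<Longrightarrow> L * (real t / k - 1 / (2 * k)) - 2 ^ t \<le> card (N l)" by metis
  define New where "New = (\<Union>l<k. N l)"
  \<comment> \<open>Edges found for different shifts cannot meet: a common vertex would be
    \<open>s l a = s l' a\<close> for one vertex \<open>a\<close>, which forces
    \<open>l = l'\<close>.\<close>
  have cross: "l = l' \<and> e = e'"
    if c: "l < k" "l' < k" "e \<in> N l" "e' \<in> N l'" "x \<in> e" "x \<in> e'" for l l' e e' x
  proof -
    obtain i a where i: "i < t" "a \<in> A i" "x = s l a" using N(3)[OF c(1)] c by blast
    obtain j b where j: "j < t" "b \<in> A j" "x = s l' b" using N(3)[OF c(2)] c by blast
    have "a = b" using same[of i j a b l l'] i j by simp
    moreover have "a \<in> V" using A(1)[OF i(1)] i(2) by blast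
    moreover have "s l a = s l' b" using i(3) j(3) by metis
    ultimately have l: "l = l'" using s_lab[of a l l'] c(1,2) by blast
    have "pairwise disjnt (N l)" using N(1)[OF c(1)] by (simp add: matching_def)
    then have "e = e'" using c l by (auto simp: pairwise_def disjnt_def)
    then show ?thesis using l by simp
  qed
  have NE: "New \<subseteq> E" using N(1) by (auto simp: New_def matching_def)
  have cNew: "real L * (real t - 1) < card New"
  proof -
    have "card New = (\<Sum>l<k. card (N l))"
      unfolding New_def
    proof (rule card_UN_disjoint)
      show "\<forall>l\<in>{..<k}. \<forall>l'\<in>{..<k}. l \<noteq> l' \<longrightarrow> N l \<inter> N l' = {}"
      proof (intro ballI impI, rule ccontr)
        fix l l' assume l: "l \<in> {..<k}" "l' \<in> {..<k}" "l \<noteq> l'" "N l \<inter> N l' \<noteq> {}"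
        then obtain e where e: "e \<in> N l" "e \<in> N l'" by blast
        then have "e \<in> E" using N(1) l unfolding matching_def by blast
        then obtain x where "x \<in> e" using eE by blast
        then show False using cross[of l l' e e x] e l by simp
      qed
    qed (use N(2) in auto)
    then have "real (card New) = (\<Sum>l<k. real (card (N l)))" by simp
    also have "\<dots> \<ge> (\<Sum>l<k. L * (real t / k - 1 / (2 * k)) - 2 ^ t)" using N(4) by (intro sum_mono) simp
    finally have "k * (L * (real t / k - 1 / (2 * k)) - 2 ^ t) \<le> real (card New)" by simp
    moreover have "k * (L * (real t / k - 1 / (2 * k)) - 2 ^ t) = L * real t - L / 2 - k * 2 ^ t"
      using k by (simp add: field_simps)
    \<comment> \<open>Thus \<open>k * 2 ^ t\<close> is below \<open>L / 2\<close>, and the total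
      loss stays strictly below \<open>L\<close>.\<close>
    moreover have "real L = 2 * (k * 2 ^ t) + 1" using L by simp
    moreover have "real L * (real t - 1) = L * real t - L" by (simp add: right_diff_distrib)
    ultimately show ?thesis by linarith
  qed
  define D where "D = (\<Union>i<t. blk ` A i)"
  have DP: "D \<subseteq> P" using A blk(1) unfolding D_def by blast
  have NewD: "\<Union>New \<subseteq> \<Union>D"
  proof
    fix x assume "x \<in> \<Union>New"
    then obtain l e where "l < k" "e \<in> N l" "x \<in> e" by (auto simp: New_def)
    then obtain i a where i: "i < t" "a \<in> A i" "x = s l a" using N(3) by blast
    then have "x \<in> blk a" using s_blk A by blast
    then show "x \<in> \<Union>D" using i by (auto simp: D_def)
  qed
  have cOld: "card (M \<inter> D) \<le> (t - 1) * L"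
  proof -
    have "M \<inter> D \<subseteq> (\<Union>i\<in>{..<t} - {i0}. blk ` A i)"
    proof
      fix p assume p: "p \<in> M \<inter> D"
      then obtain i a where i: "i < t" "a \<in> A i" "p = blk a" by (auto simp: D_def)
      have "a \<in> p" using i blk(2) A by blast
      \<comment> \<open>Blocks of column \<open>i0\<close> contain a vertex outside
        \<open>\<Union>M\<close>, so none of them is an edge of \<open>M\<close>.\<close>
      then have "i \<noteq> i0" using i0 i p by blast
      then show "p \<in> (\<Union>i\<in>{..<t} - {i0}. blk ` A i)" using i by blast
    qed
    moreover have fA: "finite (A i)" if "i < t" for i using A(1)[OF that] fin finite_subset by blast
    ultimately have "card (M \<inter> D) \<le> card (\<Union>i\<in>{..<t} - {i0}. blk ` A i)" by (intro card_mono) auto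
    also have "\<dots> \<le> (\<Sum>i\<in>{..<t} - {i0}. card (blk ` A i))" by (rule card_UN_le) simp
    also have "\<dots> \<le> (\<Sum>i\<in>{..<t} - {i0}. L)"
    proof (rule sum_mono)
      fix i assume "i \<in> {..<t} - {i0}"
      then show "card (blk ` A i) \<le> L" using card_image_le[OF fA, of i blk] A(2)[of i] by simp
    qed
    also have "\<dots> = (t - 1) * L" using i0 by simp
    finally show ?thesis .
  qed
  \<comment> \<open>A surviving old edge is itself a block, hence disjoint from the blocks in
    \<open>D\<close>, which contain all new edges.\<close>
  have MD: "e \<inter> e' = {}" if ee: "e \<in> M - D" "e' \<in> New" for e e'
  proof (rule ccontr)
    assume "e \<inter> e' \<noteq> {}"
    then obtain x where x: "x \<in> e" "x \<in> e'" by blast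
    then obtain p where p: "p \<in> D" "x \<in> p" using ee(2) NewD by blast
    have "e \<in> P" "p \<in> P" using ee(1) p(1) DP M(2) by auto
    then have "p = e" using blocks_disjoint[of p e x] x p by blast
    then show False using p ee by blast
  qed
  have "matching E ((M - D) \<union> New)"
    unfolding matching_def
  proof
    show "M - D \<union> New \<subseteq> E" using NE M by (auto simp: matching_def)
    show "pairwise disjnt (M - D \<union> New)"
    proof (rule pairwiseI)
      fix e e' assume ee: "e \<in> M - D \<union> New" "e' \<in> M - D \<union> New" "e \<noteq> e'"
      consider "e \<in> M - D" "e' \<in> M - D" | "e \<in> M - D" "e' \<in> New" | "e' \<in> M - D" "e \<in> New" | "e \<in> New" "e' \<in> New"
        using ee by blast
      then show "disjnt e e'"
      proof cases
        case 1 then show ?thesis using M ee by (auto simp: matching_def pairwise_def)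
      next
        case 2 then show ?thesis using MD by (simp add: disjnt_def)
      next
        case 3 then show ?thesis using MD by (simp add: disjnt_def Int_commute)
      next
        case 4
        then obtain l l' where "l < k" "e \<in> N l" "l' < k" "e' \<in> N l'" by (auto simp: New_def)
        then show ?thesis using cross[of l l' e e'] ee(3) by (auto simp: disjnt_def)
      qed
    qed
  qed
  moreover have "card M < card ((M - D) \<union> New)"
  proof -
    have fNew: "finite New" using NE fE by (meson finite_subset)
    have "(M - D) \<inter> New = {}"
    proof (rule ccontr)
      assume "(M - D) \<inter> New \<noteq> {}"
      then obtain e where e: "e \<in> M - D" "e \<in> New" by auto
      then show False using MD[OF e] eE[of e] NE by auto
    qed
    then have "card ((M - D) \<union> New) = card (M - D) + card New" using fM fNew by (intro card_Un_disjoint) auto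
    moreover have "card M = card (M - D) + card (M \<inter> D)"
      using fM card_Diff_subset_Int[of M D] card_mono[of M "M \<inter> D"] by simp
    moreover have "real (card (M \<inter> D)) < card New"
    proof -
      have "real (card (M \<inter> D)) \<le> real ((t - 1) * L)" using cOld by (simp only: of_nat_le_iff)
      also have "\<dots> = real L * (real t - 1)" using i0 by (simp add: of_nat_diff)
      finally show ?thesis using cNew by linarith
    qed
    ultimately show ?thesis by simp
  qed
  ultimately show ?thesis by blast
qed


section \<open>Collisions in samples, choice of the sample size, and the almost perfect
  matching\<close>

lemma card_PiE_pair_le:
  assumes "finite I" "i \<in> I" "j \<in> I" "i \<noteq> j" "finite B"
    and R: "\<And>u. u \<in> B \<Longrightarrow> card {w \<in> B. R u w} \<le> m"
  shows "card {v \<in> PiE I (\<lambda>_. B). R (v i) (v j)} \<le> m * card B ^ (card I - 1)"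
proof -
  have c: "card {v \<in> PiE I (\<lambda>_. B). R (v i) (v j)} =
    card {y \<in> PiE {i, j} (\<lambda>_. B). R (y i) (y j)} * card B ^ (card I - card {i, j})"
    using assms(1-5) by (intro card_PiE_cylinder) auto
  have fin: "finite (SIGMA u:B. {w \<in> B. R u w})" using assms(5) by auto
  have "card {y \<in> PiE {i, j} (\<lambda>_. B). R (y i) (y j)} \<le> card (SIGMA u:B. {w \<in> B. R u w})"
  proof (rule card_inj_on_le[where f = "\<lambda>y. (y i, y j)"])
    show "inj_on (\<lambda>y. (y i, y j)) {y \<in> PiE {i, j} (\<lambda>_. B). R (y i) (y j)}"
    proof (rule inj_onI)
      fix y z assume yz: "y \<in> {y \<in> PiE {i, j} (\<lambda>_. B). R (y i) (y j)}"
        "z \<in> {y \<in> PiE {i, j} (\<lambda>_. B). R (y i) (y j)}" "(y i, y j) = (z i, z j)"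
      show "y = z"
        by (rule PiE_ext[of y "{i, j}" "\<lambda>_. B"]) (use yz in auto)
    qed
  qed (use fin in auto)
  also have "\<dots> = (\<Sum>u\<in>B. card {w \<in> B. R u w})" using assms(5) by simp
  also have "\<dots> \<le> (\<Sum>u\<in>B. m)" by (rule sum_mono) (rule R)
  finally have "card {v \<in> PiE I (\<lambda>_. B). R (v i) (v j)} \<le> card B * m * card B ^ (card I - card {i, j})"
    unfolding c by (intro mult_right_mono) simp_all
  also have "\<dots> = m * card B ^ Suc (card I - 2)" using assms(4) by (simp add: numeral_2_eq_2)
  also have "Suc (card I - 2) = card I - 1"
    using card_mono[OF assms(1), of "{i, j}"] assms(2-4) by simp
  finally show ?thesis .
qed

lemma card_PiE_collision_le:
  assumes "finite I" "finite B" and R: "\<And>u. u \<in> B \<Longrightarrow> card {w \<in> B. R u w} \<le> m"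
  shows "card {v \<in> PiE I (\<lambda>_. B). \<exists>i\<in>I. \<exists>j\<in>I. i \<noteq> j \<and> R (v i) (v j)}
    \<le> card I * card I * (m * card B ^ (card I - 1))"
proof -
  define D where "D = {p \<in> I \<times> I. fst p \<noteq> snd p}"
  define X where "X p = {v \<in> PiE I (\<lambda>_. B). R (v (fst p)) (v (snd p))}" for p
  have fD: "finite D" using assms(1) by (simp add: D_def)
  have "{v \<in> PiE I (\<lambda>_. B). \<exists>i\<in>I. \<exists>j\<in>I. i \<noteq> j \<and> R (v i) (v j)} = (\<Union>p\<in>D. X p)"
    by (auto simp: D_def X_def) blast
  then have "card {v \<in> PiE I (\<lambda>_. B). \<exists>i\<in>I. \<exists>j\<in>I. i \<noteq> j \<and> R (v i) (v j)} \<le> (\<Sum>p\<in>D. card (X p))"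
    using card_UN_le[OF fD, of X] by simp
  also have "\<dots> \<le> (\<Sum>p\<in>D. m * card B ^ (card I - 1))"
    unfolding X_def using assms by (intro sum_mono card_PiE_pair_le) (auto simp: D_def)
  also have "\<dots> = card D * (m * card B ^ (card I - 1))" by simp
  also have "\<dots> \<le> card I * card I * (m * card B ^ (card I - 1))"
  proof (rule mult_right_mono)
    have "card D \<le> card (I \<times> I)" unfolding D_def using assms(1) by (intro card_mono) auto
    then show "card D \<le> card I * card I" by (simp add: card_cartesian_product)
  qed simp
  finally show ?thesis .
qed

text \<open>A polynomial in \<open>t\<close> loses against \<open>exp (- (\<kappa> * t))\<close>.
  The two bounds \<open>1 / 8\<close> control the samples with a deficient degree in some shift and
  the samples lying entirely in the matched part, whose density is below
  \<open>1 - \<eta>\<close>.\<close>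

lemma exists_sample_size:
  fixes \<kappa> \<eta> :: real
  assumes "0 < \<kappa>" "0 < \<eta>" "\<eta> < 1" and ev: "\<forall>\<^sub>F t in sequentially. Q t"
  shows "\<exists>t\<ge>N. Q t \<and> real k * (real (t choose d) * exp (- (\<kappa> * real (t - d)))) \<le> 1 / 8 \<and> (1 - \<eta>) ^ t \<le> 1 / 8"
proof -
  define c where "c = real k * exp (\<kappa> * d)"
  have "(\<lambda>t. c * (real t ^ d * exp (- (\<kappa> * real t)))) \<longlonglongrightarrow> c * 0"
    by (intro tendsto_mult tendsto_const power_times_exp_tendsto_0 assms)
  then have "\<forall>\<^sub>F t in sequentially. c * (real t ^ d * exp (- (\<kappa> * real t))) < 1 / 8"
    by (rule order_tendstoD) simp
  moreover have "(\<lambda>t. (1 - \<eta>) ^ t) \<longlonglongrightarrow> 0" using assms by (intro LIMSEQ_realpow_zero) auto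
  then have "\<forall>\<^sub>F t in sequentially. (1 - \<eta>) ^ t < 1 / 8" by (rule order_tendstoD) simp
  ultimately have "\<forall>\<^sub>F t in sequentially. Q t \<and> real k * (real (t choose d) * exp (- (\<kappa> * real (t - d)))) \<le> 1 / 8 \<and> (1 - \<eta>) ^ t \<le> 1 / 8"
    using ev eventually_ge_at_top[of d]
  proof eventually_elim
    case (elim t)
    have "(t choose d) \<le> t ^ d"
      using le_trans[OF _ binomial_fact_pow, of "t choose d" t d] by simp
    then have td: "real (t choose d) \<le> real t ^ d" by (metis of_nat_le_iff of_nat_power)
    have e: "exp (- (\<kappa> * real (t - d))) = exp (\<kappa> * d) * exp (- (\<kappa> * real t))"
      using elim by (simp add: of_nat_diff right_diff_distrib flip: exp_add)
    have "real k * (real (t choose d) * exp (- (\<kappa> * real (t - d)))) \<le> real k * (real t ^ d * exp (- (\<kappa> * real (t - d))))"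
      using td by (intro mult_left_mono mult_right_mono) auto
    also have "\<dots> = c * (real t ^ d * exp (- (\<kappa> * real t)))"
      by (simp add: e c_def)
    finally show ?case using elim(1,2,3) by linarith
  qed
  then obtain T where "\<And>t. t \<ge> T \<Longrightarrow> Q t \<and> real k * (real (t choose d) * exp (- (\<kappa> * real (t - d)))) \<le> 1 / 8 \<and> (1 - \<eta>) ^ t \<le> 1 / 8"
    unfolding eventually_sequentially by blast
  then show ?thesis by (intro exI[of _ "max N T"]) simp
qed


text \<open>The gap \<open>\<epsilon>\<close> between the density \<open>a\<close> and the threshold
  pays for the deviation of degrees in a sample. The numbers \<open>t\<close>, \<open>L\<close> and
  \<open>card Col\<close> are fixed before the hypergraph, so the box theorem meets a constant
  density \<open>\<delta>\<close>.\<close>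

lemma almost_perfect_matching:
  fixes a \<epsilon> \<eta> :: real
  assumes dk: "d < k" and \<epsilon>: "0 < \<epsilon>" "\<epsilon> \<le> 1" and \<eta>: "0 < \<eta>" "\<eta> < 1"
    and thr: "\<forall>\<^sub>F t in sequentially. real (fractional_threshold d k t) \<le> (a - \<epsilon>) * ((t - d) choose (k - d))"
  shows "\<exists>N. \<forall>(V :: 'v set) E. kgraph k V E \<longrightarrow> N \<le> card V \<longrightarrow> k dvd card V \<longrightarrow>
    (\<forall>S\<in>nsets V d. a * real (card V) ^ (k - d) \<le> fact (k - d) * degree E S) \<longrightarrow>
    (\<exists>M. matching E M \<and> (1 - \<eta>) * card V \<le> k * card M)"
proof -
  define r where "r = k - d"
  have r: "0 < r" and k: "0 < k" using dk by (auto simp: r_def)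
  define \<kappa> where "\<kappa> = \<epsilon>\<^sup>2 / (4 * real r ^ 2)"
  have \<kappa>: "0 < \<kappa>" using \<epsilon> r by (simp add: \<kappa>_def)
  obtain t where t: "t \<ge> k" "real (fractional_threshold d k t) \<le> (a - \<epsilon>) * ((t - d) choose r)"
    "real k * (real (t choose d) * exp (- (\<kappa> * real (t - d)))) \<le> 1 / 8" "(1 - \<eta>) ^ t \<le> 1 / 8"
    using exists_sample_size[OF \<kappa> \<eta> thr, of k k d] unfolding r_def by blast
  define L where "L = 2 * k * 2 ^ t + 1"
  \<comment> \<open>All that the augmentation needs to know about a sample: the induced hypergraph
    of each of its \<open>k\<close> shifts, the positions of its vertices in their blocks, and the
    indices of unmatched vertices. Equal positions within a side make distinct elements of the side
    lie in distinct blocks.\<close>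
  define Col where "Col = PiE {..<k} (\<lambda>_. Pow (nsets {..<t} k)) \<times> PiE {..<t} (\<lambda>_. {..<k}) \<times> Pow {..<t}"
  have fCol: "finite Col" unfolding Col_def by (simp add: finite_PiE finite_imp_finite_nsets)
  have ColNe: "Col \<noteq> {}" using k by (auto simp: Col_def PiE_eq_empty_iff)
  have cCol: "0 < card Col" using fCol ColNe by (simp add: card_gt_0_iff)
  \<comment> \<open>At least half of all samples will be good, and some pattern takes at least the
    share \<open>1 / card Col\<close> of these.\<close>
  define \<delta> where "\<delta> = 1 / (2 * real (card Col))"
  have \<delta>: "0 < \<delta>" using cCol by (simp add: \<delta>_def)
  have "0 < L" by (simp add: L_def)
  from complete_partite_box[OF \<delta> this, of t] obtain N0 where N0:
    "\<And>(B :: 'v set) F. finite B \<Longrightarrow> N0 \<le> card B \<Longrightarrow> F \<subseteq> PiE {..<t} (\<lambda>_. B) \<Longrightarrow>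
      \<delta> * real (card B) ^ t \<le> real (card F) \<Longrightarrow>
      (\<exists>A. (\<forall>i<t. A i \<subseteq> B \<and> card (A i) = L) \<and> PiE {..<t} A \<subseteq> F)" by metis
  \<comment> \<open>Two sampled vertices share a block in at most
    \<open>t * t * k * n ^ (t - 1)\<close> samples, which is then at most an eighth of all.\<close>
  define N1 where "N1 = max N0 (8 * t * t * k + 1)"
  show ?thesis
  proof (intro exI[of _ N1] allI impI)
    fix V :: "'v set" and E
    assume E: "kgraph k V E" and big: "N1 \<le> card V" and kdvd: "k dvd card V"
      and deg: "\<forall>S\<in>nsets V d. a * real (card V) ^ (k - d) \<le> fact (k - d) * degree E S"
    define n where "n = card V"
    have fV: "finite V" and EV: "E \<subseteq> nsets V k" using E by (auto simp: kgraph_def)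
    have n: "N0 \<le> n" "8 * t * t * k < n" using big by (auto simp: n_def N1_def)
    have Vne: "V \<noteq> {}" using n by (auto simp: n_def)
    have fE: "finite E" by (rule kgraph_finite_edges[OF E])
    obtain M where M: "matching E M" and Mmax: "card M = matching_number E"
      using exists_maximum_matching[OF fE] by blast
    have max: "card M' \<le> card M" if "matching E M'" for M'
      unfolding Mmax by (rule card_le_matching_number[OF fE that])
    have "(1 - \<eta>) * n \<le> k * card M"
    proof (rule ccontr)
      assume "\<not> ?thesis"
      then have few: "real (k * card M) < (1 - \<eta>) * n" by simp
      have UMV: "\<Union>M \<subseteq> V" and Mk: "\<forall>p\<in>M. card p = k" using M EV by (auto simp: matching_def nsets_def)
      have Mne: "{} \<notin> M" using Mk k by auto
      have partM: "partition_on (\<Union>M) M" using M Mne by (auto simp: partition_on_def matching_def)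
      have fUM: "finite (\<Union>M)" by (rule finite_subset[OF UMV fV])
      have cUM: "card (\<Union>M) = k * card M" using card_partition_on[OF fUM partM Mk] .
      have "card (V - \<Union>M) = card V - k * card M" using UMV fUM by (simp add: card_Diff_subset cUM)
      then have "k dvd card (V - \<Union>M)" using kdvd by simp
      then obtain P' where P': "partition_on (V - \<Union>M) P'" "\<forall>p\<in>P'. card p = k"
        using exists_uniform_partition[of "V - \<Union>M" k] fV k by blast
      define P where "P = P' \<union> M"
      have "partition_on ((V - \<Union>M) \<union> \<Union>M) P" unfolding P_def using P' partM by (intro partition_on_Un) auto
      moreover have "(V - \<Union>M) \<union> \<Union>M = V" using UMV by blast
      ultimately have P: "partition_on V P" by simp
      have cP: "\<And>p. p \<in> P \<Longrightarrow> card p = k" using P' Mk by (auto simp: P_def)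
      obtain blk lab s where "shifted_partition V P k blk lab s"
        using exists_shifted_partition[OF fV P cP k] by blast
      then interpret shifted_partition V P k blk lab s .
      let ?X = "PiE {..<t} (\<lambda>_. V)"
      have fX: "finite ?X" using fV by (simp add: finite_PiE)
      define Ep where "Ep l v = {e \<in> nsets {..<t} k. s l ` v ` e \<in> E}" for l and v :: "nat \<Rightarrow> 'v"
      define thresh where "thresh = (a - \<epsilon>) * ((t - d) choose r)"
      define Bad where "Bad = {v \<in> ?X. inj_on v {..<t} \<and>
        (\<exists>S\<in>nsets {..<t} d. degree {e \<in> nsets {..<t} k. v ` e \<in> E} S \<le> thresh)}"
      \<comment> \<open>Samples that become deficient after the shift \<open>s l\<close>. Since
        \<open>s l\<close> is injective on \<open>V\<close>, shifting embeds \<open>B1 l\<close>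
        into \<open>Bad\<close>.\<close>
      define B1 where "B1 l = {v \<in> ?X. inj_on v {..<t} \<and> (\<exists>S\<in>nsets {..<t} d. degree (Ep l v) S \<le> thresh)}" for l
      define B2 where "B2 = PiE {..<t} (\<lambda>_. \<Union>M)"
      have "real (card Bad) \<le> (t choose d) * (real n ^ t * exp (- (\<epsilon>\<^sup>2 * real (t - d) / (4 * real r ^ 2))))"
        unfolding Bad_def thresh_def n_def
        using deg sampled_min_degree[OF E Vne r_def r t(1) _ \<epsilon>] by (auto simp: r_def)
      also have "\<dots> = (t choose d) * (real n ^ t * exp (- (\<kappa> * real (t - d))))" by (simp add: \<kappa>_def)
      finally have cBad: "real (card Bad) \<le> (t choose d) * (real n ^ t * exp (- (\<kappa> * real (t - d))))" .
      have cB1: "card (B1 l) \<le> card Bad" if l: "l < k" for l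
      proof (rule card_inj_on_le[where f = "\<lambda>v. restrict (\<lambda>i. s l (v i)) {..<t}"])
        show "inj_on (\<lambda>v. restrict (\<lambda>i. s l (v i)) {..<t}) (B1 l)"
        proof (rule inj_onI)
          fix v w assume vw: "v \<in> B1 l" "w \<in> B1 l" "restrict (\<lambda>i. s l (v i)) {..<t} = restrict (\<lambda>i. s l (w i)) {..<t}"
          have "v i = w i" if "i \<in> {..<t}" for i
          proof (rule inj_onD[OF s_inj[of l]])
            show "s l (v i) = s l (w i)" using fun_cong[OF vw(3), of i] that by simp
          qed (use vw that in \<open>auto simp: B1_def\<close>)
          then show "v = w" using vw(1,2) by (intro PiE_ext[of v "{..<t}" "\<lambda>_. V" w]) (auto simp: B1_def)
        qed
        show "(\<lambda>v. restrict (\<lambda>i. s l (v i)) {..<t}) ` B1 l \<subseteq> Bad"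
        proof
          fix u assume "u \<in> (\<lambda>v. restrict (\<lambda>i. s l (v i)) {..<t}) ` B1 l"
          then obtain v where v: "v \<in> B1 l" and u: "u = restrict (\<lambda>i. s l (v i)) {..<t}" by blast
          have vV: "v i \<in> V" if "i < t" for i using v that by (auto simp: B1_def)
          have "u \<in> ?X" using vV s_in by (auto simp: u)
          moreover have "inj_on u {..<t}"
          proof (rule inj_onI)
            fix i j assume ij: "i \<in> {..<t}" "j \<in> {..<t}" "u i = u j"
            then have "v i = v j" using inj_onD[OF s_inj[of l], of "v i" "v j"] vV by (simp add: u)
            then show "i = j" using v ij by (auto simp: B1_def inj_on_def)
          qed
          moreover have "{e \<in> nsets {..<t} k. u ` e \<in> E} = Ep l v"
          proof -
            have "u ` e = s l ` v ` e" if "e \<in> nsets {..<t} k" for e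
            proof -
              have "e \<subseteq> {..<t}" using that by (auto simp: nsets_def)
              then have "u ` e = (\<lambda>i. s l (v i)) ` e" by (intro image_cong) (auto simp: u)
              then show ?thesis by (simp only: image_image)
            qed
            then show ?thesis by (auto simp: Ep_def)
          qed
          ultimately show "u \<in> Bad" using v by (simp add: Bad_def B1_def)
        qed
        show "finite Bad" using fX by (simp add: Bad_def)
      qed
      have "real (card (\<Union>l<k. B1 l)) \<le> real k * real (card Bad)"
      proof -
        have "card (\<Union>l<k. B1 l) \<le> (\<Sum>l<k. card (B1 l))" by (rule card_UN_le) simp
        also have "\<dots> \<le> (\<Sum>l<k. card Bad)" using cB1 by (intro sum_mono) simp
        finally show ?thesis by (simp flip: of_nat_mult)
      qed
      also have "\<dots> \<le> k * ((t choose d) * (real n ^ t * exp (- (\<kappa> * real (t - d)))))"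
        using cBad by (intro mult_left_mono) auto
      also have "\<dots> = (real k * (real (t choose d) * exp (- (\<kappa> * real (t - d))))) * real n ^ t" by simp
      also have "\<dots> \<le> 1 / 8 * real n ^ t" using t(3) by (intro mult_right_mono) auto
      finally have c1: "real (card (\<Union>l<k. B1 l)) \<le> 1 / 8 * real n ^ t" .
      have "real (card B2) = real (k * card M) ^ t" by (simp add: B2_def card_funcsetE cUM)
      also have "\<dots> \<le> ((1 - \<eta>) * n) ^ t" using few by (intro power_mono) auto
      also have "\<dots> = (1 - \<eta>) ^ t * real n ^ t" by (rule power_mult_distrib)
      also have "\<dots> \<le> 1 / 8 * real n ^ t" using t(4) by (intro mult_right_mono) auto
      finally have c2: "real (card B2) \<le> 1 / 8 * real n ^ t" .
      define B3 where "B3 = {v \<in> ?X. \<exists>i\<in>{..<t}. \<exists>j\<in>{..<t}. i \<noteq> j \<and> blk (v i) = blk (v j)}"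
      have B3I: "v \<in> B3" if "v \<in> ?X" "i < t" "j < t" "i \<noteq> j" "blk (v i) = blk (v j)" for v i j
        using that unfolding B3_def by blast
      have "card B3 \<le> t * t * (k * n ^ (t - 1))"
      proof -
        have "card {w \<in> V. blk u = blk w} \<le> k" if "u \<in> V" for u
        proof -
          have "{w \<in> V. blk u = blk w} \<subseteq> blk u" using blk(2) by auto
          moreover have "finite (blk u)" "card (blk u) = k"
            using cardP[OF blk(1)[OF that]] k by (auto intro: card_ge_0_finite)
          ultimately show ?thesis using card_mono by metis
        qed
        then show ?thesis
          using card_PiE_collision_le[of "{..<t}" V "\<lambda>u w. blk u = blk w" k] fV by (simp add: B3_def n_def)
      qed
      then have "8 * card B3 \<le> 8 * t * t * k * n ^ (t - 1)" by simp
      also have "\<dots> \<le> n * n ^ (t - 1)" using n(2) by (intro mult_right_mono) auto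
      also have "\<dots> = n ^ t" using t(1) k by (cases t) auto
      finally have c3: "real (card B3) \<le> 1 / 8 * real n ^ t"
        by (simp flip: of_nat_power of_nat_le_iff[where 'a = real])
      define Good where "Good = ?X - ((\<Union>l<k. B1 l) \<union> B2 \<union> B3)"
      have cGood: "1 / 2 * real n ^ t \<le> card Good"
      proof -
        have "card ((\<Union>l<k. B1 l) \<union> B2 \<union> B3) \<le> card (\<Union>l<k. B1 l) + card B2 + card B3"
          by (meson add_right_mono card_Un_le le_trans)
        then have "real (card ((\<Union>l<k. B1 l) \<union> B2 \<union> B3)) \<le> 3 / 8 * real n ^ t"
          using c1 c2 c3 by linarith
        moreover have "(\<Union>l<k. B1 l) \<union> B2 \<union> B3 \<subseteq> ?X"
          using PiE_mono[of "{..<t}" "\<lambda>_. \<Union>M" "\<lambda>_. V"] UMV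
          by (auto simp: B1_def B2_def B3_def)
        moreover from this have "card Good = card ?X - card ((\<Union>l<k. B1 l) \<union> B2 \<union> B3)"
          unfolding Good_def using fX by (intro card_Diff_subset) (auto intro: finite_subset)
        moreover have "card ?X = n ^ t" by (simp add: card_funcsetE n_def)
        moreover have "(0::real) \<le> real n ^ t" by simp
        moreover have "card ((\<Union>l<k. B1 l) \<union> B2 \<union> B3) \<le> card ?X" using calculation(2) fX by (rule card_mono[rotated])
        ultimately show ?thesis by (simp add: of_nat_diff)
      qed
      define colr where "colr v = (restrict (\<lambda>l. Ep l v) {..<k}, restrict (\<lambda>i. lab (v i)) {..<t}, {i \<in> {..<t}. v i \<notin> \<Union>M})" for v
      have "colr \<in> Good \<rightarrow> Col"
        using lab by (auto simp: colr_def Col_def Ep_def Good_def PiE_iff)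
      moreover have fGood: "finite Good" using fX by (simp add: Good_def)
      ultimately obtain y where y: "y \<in> Col" "card (colr -` {y} \<inter> Good) * card Col \<ge> card Good"
        using pigeonhole_card[of colr Good Col] fCol ColNe by blast
      define F where "F = colr -` {y} \<inter> Good"
      have cF: "\<delta> * real n ^ t \<le> card F"
      proof -
        have "real (card Good) \<le> real (card F) * real (card Col)" using y(2) by (simp add: F_def flip: of_nat_mult)
        then have "1 / 2 * real n ^ t \<le> real (card F) * real (card Col)" using cGood by linarith
        then show ?thesis using cCol by (simp add: \<delta>_def field_simps)
      qed
      have "F \<subseteq> ?X" by (auto simp: F_def Good_def)
      then have "\<exists>A. (\<forall>i<t. A i \<subseteq> V \<and> card (A i) = L) \<and> PiE {..<t} A \<subseteq> F"
        using N0[OF fV, of F] cF n(1) by (simp add: n_def)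
      then obtain A where A: "\<And>i. i < t \<Longrightarrow> A i \<subseteq> V" "\<And>i. i < t \<Longrightarrow> card (A i) = L"
        and AF: "PiE {..<t} A \<subseteq> F" by blast
      have Ane: "A i \<noteq> {}" if "i < t" for i using A(2)[OF that] by (auto simp: L_def)
      \<comment> \<open>A base point of the box. Replacing one or two of its coordinates stays in
        \<open>F\<close>, which transfers labels, avoidance of \<open>\<Union>M\<close> and
        distinctness of blocks from single samples to the sides \<open>A i\<close>.\<close>
      define v0 where "v0 = (\<lambda>i\<in>{..<t}. SOME x. x \<in> A i)"
      have v0: "v0 \<in> PiE {..<t} A" using Ane by (auto simp: v0_def some_in_eq)
      have upd: "v0(i := x) \<in> PiE {..<t} A" if "i < t" "x \<in> A i" for i x
        using v0 that by (auto simp: PiE_def extensional_def)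
      have upd2: "v0(i := x, j := z) \<in> PiE {..<t} A" if "i < t" "x \<in> A i" "j < t" "z \<in> A j" for i x j z
        using v0 that by (auto simp: PiE_def extensional_def)
      have good: "v \<in> Good" "colr v = colr v0" if "v \<in> PiE {..<t} A" for v
        using that v0 AF by (auto simp: F_def)
      have lab_eq: "lab (v i) = lab (v0 i)" and U_eq: "v i \<notin> \<Union>M \<longleftrightarrow> v0 i \<notin> \<Union>M" if "v \<in> PiE {..<t} A" "i < t" for v i
      proof -
        have "restrict (\<lambda>i. lab (v i)) {..<t} = restrict (\<lambda>i. lab (v0 i)) {..<t}"
          "{i \<in> {..<t}. v i \<notin> \<Union>M} = {i \<in> {..<t}. v0 i \<notin> \<Union>M}" using good(2)[OF that(1)] by (simp_all only: colr_def prod.inject)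
        then show "lab (v i) = lab (v0 i)" "v i \<notin> \<Union>M \<longleftrightarrow> v0 i \<notin> \<Union>M" using that(2) by (auto dest: fun_cong[of _ _ i])
      qed
      have Ep_eq: "Ep l v = Ep l v0" if "v \<in> PiE {..<t} A" "l < k" for v l
      proof -
        have "restrict (\<lambda>l. Ep l v) {..<k} = restrict (\<lambda>l. Ep l v0) {..<k}"
          using good(2)[OF that(1)] by (simp only: colr_def prod.inject)
        then show ?thesis using that(2) by (auto dest: fun_cong[of _ _ l])
      qed
      have "v0 \<notin> B2" "v0 \<in> ?X" using good(1)[OF v0] by (auto simp: Good_def)
      then obtain i0 where i0: "i0 < t" "v0 i0 \<notin> \<Union>M" unfolding B2_def by (auto simp: PiE_iff)
      have inj: "inj_on v0 {..<t}"
      proof (rule inj_onI, rule ccontr)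
        fix i j assume ij: "i \<in> {..<t}" "j \<in> {..<t}" "v0 i = v0 j" "i \<noteq> j"
        then have "v0 \<in> B3" using B3I[of v0 i j] \<open>v0 \<in> ?X\<close> by simp
        then show False using good(1)[OF v0] by (simp add: Good_def)
      qed
      have "\<exists>M'. matching E M' \<and> card M < card M'"
      proof (rule augment_in_box[OF EV M _ L_def A, where Es = "\<lambda>l. Ep l v0" and ?i0.0 = i0])
        show "M \<subseteq> P" by (simp add: P_def)
        show "lab x = lab z" if "i < t" "x \<in> A i" "z \<in> A i" for i x z
          using lab_eq[OF upd[OF that(1,2)] that(1)] lab_eq[OF upd[OF that(1,3)] that(1)] by simp
        show "blk x \<noteq> blk z" if "i < t" "j < t" "i \<noteq> j" "x \<in> A i" "z \<in> A j" for i j x z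
        proof
          assume "blk x = blk z"
          have "v0(i := x, j := z) \<in> Good" using good(1) upd2 that by blast
          moreover from this have "v0(i := x, j := z) \<in> ?X" by (simp add: Good_def)
          then have "v0(i := x, j := z) \<in> B3"
            using B3I[of "v0(i := x, j := z)" i j] that(1-3) \<open>blk x = blk z\<close> by simp
          ultimately show False by (simp add: Good_def)
        qed
        show "A i0 \<inter> \<Union>M = {}"
        proof -
          have "x \<notin> \<Union>M" if "x \<in> A i0" for x using U_eq[OF upd[OF i0(1) that] i0(1)] i0(2) by simp
          then show ?thesis by blast
        qed
        show "Ep l v0 \<subseteq> nsets {..<t} k" for l by (auto simp: Ep_def)
        show "s l ` v ` e \<in> E" if "l < k" "e \<in> Ep l v0" "v \<in> PiE {..<t} A" for l e v
          using that(2) Ep_eq[OF that(3,1)] by (auto simp: Ep_def)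
        show "real t / real k \<le> fractional_matching_number {..<t} (Ep l v0)" if l: "l < k" for l
        proof -
          have kg: "kgraph k {..<t} (Ep l v0)" by (auto simp: kgraph_def Ep_def)
          have "v0 \<notin> B1 l" using good(1)[OF v0] l by (auto simp: Good_def)
          then have "\<forall>S\<in>nsets {..<t} d. thresh < degree (Ep l v0) S"
            using inj \<open>v0 \<in> ?X\<close> by (auto simp: B1_def not_le)
          then have "\<forall>S\<in>nsets {..<t} d. fractional_threshold d k t \<le> degree (Ep l v0) S"
            using t(2) unfolding thresh_def by fastforce
          then have "fractional_threshold d k t \<le> min_degree d {..<t} (Ep l v0)"
            using min_degree_ge_iff[of "{..<t}" d] t(1) dk by simp
          then show ?thesis using fractional_threshold_spec[OF kg, of d] t(1) dk by simp
        qed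
      qed (use i0 in auto)
      then show False using max by (meson not_le)
    qed
    then show "\<exists>M. matching E M \<and> (1 - \<eta>) * card V \<le> k * card M" using M by (auto simp: n_def)
  qed
qed

section \<open>Absorption\<close>

text \<open>Stated for arbitrary vertex sets, so that matchings of disjoint sets can be glued;
  \<open>perfectly_matchable_iff_matching_number\<close> connects it with the thresholds.\<close>

definition perfectly_matchable :: "'v set set \<Rightarrow> 'v set \<Rightarrow> bool" where
  "perfectly_matchable E X \<longleftrightarrow> (\<exists>M\<subseteq>E. partition_on X M)"

definition absorbs :: "'v set set \<Rightarrow> 'v set \<Rightarrow> 'v set \<Rightarrow> bool" where
  "absorbs E A W \<longleftrightarrow> A \<inter> W = {} \<and> perfectly_matchable E A \<and> perfectly_matchable E (A \<union> W)"

lemma perfectly_matchable_Un: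
  assumes "perfectly_matchable E X" "perfectly_matchable E Y" "X \<inter> Y = {}"
  shows "perfectly_matchable E (X \<union> Y)"
  using assms partition_on_Un unfolding perfectly_matchable_def by (metis Un_least)

lemma perfectly_matchable_rows:
  assumes "inj_on g (I \<times> J)" "J \<noteq> {}" "\<And>i. i \<in> I \<Longrightarrow> g ` ({i} \<times> J) \<in> E"
  shows "perfectly_matchable E (g ` (I \<times> J))"
proof -
  let ?M = "(\<lambda>i. g ` ({i} \<times> J)) ` I"
  have "partition_on (g ` (I \<times> J)) ?M"
  proof (rule partition_onI)
    fix p q assume "p \<in> ?M" "q \<in> ?M" "p \<noteq> q"
    then obtain i j where ij: "i \<in> I" "j \<in> I" "p = g ` ({i} \<times> J)" "q = g ` ({j} \<times> J)" "i \<noteq> j" by blast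
    have "g ` ({i} \<times> J \<inter> {j} \<times> J) = g ` ({i} \<times> J) \<inter> g ` ({j} \<times> J)"
      using ij by (intro inj_on_image_Int[OF assms(1)]) auto
    moreover have "{i} \<times> J \<inter> {j} \<times> J = {}" using ij by auto
    ultimately show "disjnt p q" using ij by (simp add: disjnt_def)
  qed (use assms(2) in auto)
  moreover have "?M \<subseteq> E" using assms(3) by auto
  ultimately show ?thesis unfolding perfectly_matchable_def by blast
qed

text \<open>Each block of the leftover uses up one absorber. Removing it costs every other block at
  most one of its absorbers, while the number of blocks also drops by one, so the counting
  hypothesis survives. Absorbers that remain are matched by themselves.\<close>

lemma absorb_greedily:
  assumes "finite P" "partition_on R P" "finite \<A>" "pairwise disjnt \<A>" "\<And>A. A \<in> \<A> \<Longrightarrow> perfectly_matchable E A"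
    and "R \<inter> \<Union>\<A> = {}" "\<And>W. W \<in> P \<Longrightarrow> card P \<le> card {A \<in> \<A>. absorbs E A W}"
  shows "perfectly_matchable E (\<Union>\<A> \<union> R)"
  using assms
proof (induction P arbitrary: R \<A> rule: finite_induct)
  case empty
  then have R: "R = {}" by (simp add: partition_on_def)
  have "perfectly_matchable E (\<Union>\<A>)"
    using empty.prems(2,3,4)
  proof (induction \<A> rule: finite_induct)
    case empty
    then show ?case unfolding perfectly_matchable_def by (intro exI[of _ "{}"]) (simp add: partition_on_empty)
  next
    case (insert A \<A>)
    have "A \<inter> \<Union>\<A> = {}" using insert.prems(1) insert.hyps(2) by (auto simp: pairwise_insert disjnt_def)
    then show ?case using insert perfectly_matchable_Un[of E A "\<Union>\<A>"] by (auto simp: pairwise_insert)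
  qed
  then show ?case using R by simp
next
  case (insert W P)
  have W: "W \<subseteq> R" "partition_on (R - W) P" 
    using insert.prems(1) insert.hyps by (auto simp: partition_on_def pairwise_insert disjnt_def)
  have "card (insert W P) \<le> card {A \<in> \<A>. absorbs E A W}" using insert.prems(6) by simp
  then have "{A \<in> \<A>. absorbs E A W} \<noteq> {}" using insert.hyps by (metis card.empty card_insert_disjoint not_less_eq_eq zero_le)
  then obtain A where A: "A \<in> \<A>" "absorbs E A W" by blast
  have "perfectly_matchable E (\<Union>(\<A> - {A}) \<union> (R - W))"
  proof (rule insert.IH)
    show "card P \<le> card {A' \<in> \<A> - {A}. absorbs E A' W'}" if "W' \<in> P" for W'
    proof -
      have "card (insert W P) \<le> card {A' \<in> \<A>. absorbs E A' W'}" using insert.prems(6) that by simp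
      also have "\<dots> \<le> card (insert A {A' \<in> \<A> - {A}. absorbs E A' W'})"
        using insert.prems(2) by (intro card_mono) auto
      also have "\<dots> \<le> Suc (card {A' \<in> \<A> - {A}. absorbs E A' W'})" by (rule card_insert_le_m1) simp_all
      finally show ?thesis using insert.hyps by simp
    qed
    show "pairwise disjnt (\<A> - {A})" using insert.prems(3) by (rule pairwise_mono) auto
  qed (use insert.prems W in auto)
  moreover have "perfectly_matchable E (A \<union> W)" using A by (simp add: absorbs_def)
  moreover have "(\<Union>(\<A> - {A}) \<union> (R - W)) \<inter> (A \<union> W) = {}"
  proof -
    have "A' \<inter> A = {}" if "A' \<in> \<A> - {A}" for A'
      using insert.prems(3) that A by (auto simp: pairwise_def disjnt_def)
    moreover have "A \<inter> R = {}" "\<Union>\<A> \<inter> W = {}" using insert.prems(5) A W by auto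
    ultimately show ?thesis by auto
  qed
  moreover have "(\<Union>(\<A> - {A}) \<union> (R - W)) \<union> (A \<union> W) = \<Union>\<A> \<union> R" using A W by auto
  ultimately show ?case using perfectly_matchable_Un by metis
qed

section \<open>Counting the absorbers of a given \<open>k\<close>-set\<close>

lemma card_PiE_single:
  assumes "finite I" "i \<in> I" "finite B" "C \<subseteq> B"
  shows "card {v \<in> PiE I (\<lambda>_. B). v i \<in> C} = card C * card B ^ (card I - 1)"
proof -
  have "card {v \<in> PiE I (\<lambda>_. B). v i \<in> C} = card {y \<in> PiE {i} (\<lambda>_. B). y i \<in> C} * card B ^ (card I - card {i})"
    using assms by (intro card_PiE_cylinder) auto
  also have "{y \<in> PiE {i} (\<lambda>_. B). y i \<in> C} = PiE {i} (\<lambda>_. C)" 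
    by (rule set_eqI) (use assms(4) in \<open>simp add: PiE_iff, blast\<close>)
  also have "card (PiE {i} (\<lambda>_. C)) = card C" by (simp add: card_PiE)
  finally show ?thesis by simp
qed

text \<open>Two families that each contain a proportion \<open>1 / 2 + \<gamma>\<close> of all
  functions share a proportion \<open>2 * \<gamma>\<close>, by inclusion-exclusion. This is where
  absorption needs density above \<open>1 / 2\<close>.\<close>

lemma common_link_functions:
  fixes \<gamma> :: real
  assumes E: "kgraph k V E" and k: "0 < k" and uv: "u \<in> V" "v \<in> V"
    and deg: "\<And>v. v \<in> V \<Longrightarrow> (1 / 2 + \<gamma>) * real (card V) ^ (k - 1) \<le> fact (k - 1) * degree E {v}"
  defines "N \<equiv> \<lambda>v. {y \<in> PiE {..<k - 1} (\<lambda>_. V). insert v (y ` {..<k - 1}) \<in> E}"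
  shows "(1 / 2 + \<gamma>) * real (card V) ^ (k - 1) \<le> card (N u)"
    and "2 * \<gamma> * real (card V) ^ (k - 1) \<le> card (N u \<inter> N v)"
proof -
  have fV: "finite V" using E by (simp add: kgraph_def)
  have N: "(1 / 2 + \<gamma>) * real (card V) ^ (k - 1) \<le> card (N w)" if "w \<in> V" for w
  proof -
    have "fact (k - 1) * degree E {w} \<le> card (N w)"
      using link_functions_card_ge[OF E, of "{w}" 1 "{..<k - 1}"] that by (simp add: N_def nsets_def)
    then have "real (fact (k - 1) * degree E {w}) \<le> real (card (N w))" by (simp only: of_nat_le_iff)
    then show ?thesis using deg[OF that] by simp
  qed
  show "(1 / 2 + \<gamma>) * real (card V) ^ (k - 1) \<le> card (N u)" by (rule N[OF uv(1)])
  let ?X = "PiE {..<k - 1} (\<lambda>_. V)"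
  have fX: "finite ?X" using fV by (simp add: finite_PiE)
  have sub: "N u \<subseteq> ?X" "N v \<subseteq> ?X" by (auto simp: N_def)
  have fin: "finite (N u)" "finite (N v)" using finite_subset[OF sub(1) fX] finite_subset[OF sub(2) fX] by simp_all
  have "card (N u) + card (N v) = card (N u \<union> N v) + card (N u \<inter> N v)" by (rule card_Un_Int[OF fin])
  also have "card (N u \<union> N v) \<le> card ?X" using sub fX by (intro card_mono) auto
  finally have "card (N u) + card (N v) \<le> card V ^ (k - 1) + card (N u \<inter> N v)" by (simp add: card_funcsetE)
  then have "real (card (N u) + card (N v)) \<le> real (card V ^ (k - 1) + card (N u \<inter> N v))" by (simp only: of_nat_le_iff)
  then show "2 * \<gamma> * real (card V) ^ (k - 1) \<le> card (N u \<inter> N v)"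
    using N[OF uv(1)] N[OF uv(2)] by (simp add: distrib_right)
qed

text \<open>The columns \<open>j < k - 1\<close> of row \<open>i\<close> hold a set completing both \<open>x (i, k - 1)\<close> and \<open>w i\<close> to an edge, and the last
  column together with \<open>w (k - 1)\<close> is an edge. So the rows match the array alone, and exchanging the last
  column with \<open>w 0, \<dots>, w (k - 2)\<close> matches the array together with \<open>W\<close>.\<close>

lemma absorber_array:
  fixes k :: nat
  assumes k: "0 < k" and w: "bij_betw w {..<k} W"
    and x: "inj_on x ({..<k - 1} \<times> {..<k})" "x ` ({..<k - 1} \<times> {..<k}) \<inter> W = {}"
    and rows: "\<And>i. i < k - 1 \<Longrightarrow> insert (x (i, k - 1)) ((\<lambda>j. x (i, j)) ` {..<k - 1}) \<in> E"
    and rowsW: "\<And>i. i < k - 1 \<Longrightarrow> insert (w i) ((\<lambda>j. x (i, j)) ` {..<k - 1}) \<in> E"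
    and lastW: "insert (w (k - 1)) ((\<lambda>i. x (i, k - 1)) ` {..<k - 1}) \<in> E"
  shows "absorbs E (x ` ({..<k - 1} \<times> {..<k})) W"
  unfolding absorbs_def
proof (intro conjI)
  obtain l where l: "k = Suc l" using k by (cases k) auto
  have kl: "k - 1 = l" using l by simp
  note facts = x rows rowsW lastW
  note facts = facts[unfolded kl]
  have img: "g ` ({i} \<times> {..<k}) = insert (g (i, l)) ((\<lambda>j. g (i, j)) ` {..<l})" for g :: "nat \<times> nat \<Rightarrow> 'a" and i
    unfolding l by (auto simp: less_Suc_eq)
  show "x ` ({..<k - 1} \<times> {..<k}) \<inter> W = {}" by (rule x(2))
  show "perfectly_matchable E (x ` ({..<k - 1} \<times> {..<k}))"
  proof (rule perfectly_matchable_rows[OF x(1)])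
    show "{..<k} \<noteq> {}" using k by auto
    show "x ` ({i} \<times> {..<k}) \<in> E" if "i \<in> {..<k - 1}" for i
      using facts(3)[of i] that by (simp only: img kl lessThan_iff)
  qed
  \<comment> \<open>A square array whose rows are the edges of the second matching: in the rows
    \<open>i < l\<close> the last entry is exchanged for \<open>w i\<close>, and the new row
    \<open>l\<close> is the old last column laid flat, followed by \<open>w l\<close>.\<close>
  define g where "g = (\<lambda>(i, j). if i < l then if j < l then x (i, j) else w i
    else if j < l then x (j, l) else w l)"
  have xinj: "(i, j) = (i', j')" if "x (i, j) = x (i', j')" "i < l" "j < k" "i' < l" "j' < k" for i j i' j'
    using facts(1) that unfolding inj_on_def by simp
  have xw: "x (i, j) \<noteq> w i'" if "i < l" "j < k" "i' < k" for i j i'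
    using facts(2) that w unfolding bij_betw_def by fastforce
  have winj: "i = i'" if "w i = w i'" "i < k" "i' < k" for i i'
    using w that unfolding bij_betw_def inj_on_def by simp
  have "inj_on g ({..<k} \<times> {..<k})"
  proof (rule inj_onI)
    fix p q assume pq: "p \<in> {..<k} \<times> {..<k}" "q \<in> {..<k} \<times> {..<k}" "g p = g q"
    obtain i j i' j' where ij: "p = (i, j)" "q = (i', j')" "i < k" "j < k" "i' < k" "j' < k"
      using pq by (cases p, cases q) auto
    have lk: "l < k" "\<And>i. i < l \<Longrightarrow> i < k" "\<And>i. i < k \<Longrightarrow> \<not> i < l \<Longrightarrow> i = l" using l by auto
    \<comment> \<open>The array \<open>g\<close> has four regions. Coincidences inside a region are
      excluded by injectivity of \<open>x\<close> or \<open>w\<close>, those between entries of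
      \<open>x\<close> and of \<open>w\<close> by disjointness from \<open>W\<close>.\<close>
    show "p = q"
      using pq(3) ij lk(1) lk(2)[of i] lk(2)[of j] lk(2)[of i'] lk(2)[of j'] lk(3)[of i] lk(3)[of j] lk(3)[of i'] lk(3)[of j']
        xinj[of i j i' j'] xinj[of i j j' l] xinj[of j l i' j'] xinj[of j l j' l]
        xw[of i j i'] xw[of i j l] xw[of i' j' i] xw[of i' j' l] xw[of j l i'] xw[of j l l] xw[of j' l i] xw[of j' l l]
        winj[of i i'] winj[of i l] winj[of l i']
      by (auto simp: g_def split: if_splits)
  qed
  moreover have "g ` ({i} \<times> {..<k}) \<in> E" if "i \<in> {..<k}" for i
  proof (cases "i < l")
    case True
    then have "g ` ({i} \<times> {..<k}) = insert (w i) ((\<lambda>j. x (i, j)) ` {..<l})" unfolding img by (auto simp: g_def)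
    then show ?thesis using facts(4)[OF True] by simp
  next
    case False
    then have "g ` ({i} \<times> {..<k}) = insert (w l) ((\<lambda>j. x (j, l)) ` {..<l})" unfolding img by (auto simp: g_def)
    then show ?thesis using facts(5) by simp
  qed
  ultimately have "perfectly_matchable E (g ` ({..<k} \<times> {..<k}))"
    using k by (intro perfectly_matchable_rows) auto
  moreover have "g ` ({..<k} \<times> {..<k}) = x ` ({..<k - 1} \<times> {..<k}) \<union> W"
  proof
    have W: "w i \<in> W" if "i < k" for i using w that by (auto simp: bij_betw_def)
    show "g ` ({..<k} \<times> {..<k}) \<subseteq> x ` ({..<k - 1} \<times> {..<k}) \<union> W"
    proof
      fix y assume "y \<in> g ` ({..<k} \<times> {..<k})"
      then obtain i j where "i < k" "j < k" "y = g (i, j)" by auto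
      then show "y \<in> x ` ({..<k - 1} \<times> {..<k}) \<union> W"
        using W[of i] W[of l] l by (auto simp: g_def kl split: if_splits)
    qed
    show "x ` ({..<k - 1} \<times> {..<k}) \<union> W \<subseteq> g ` ({..<k} \<times> {..<k})"
    proof
      fix y assume "y \<in> x ` ({..<k - 1} \<times> {..<k}) \<union> W"
      then consider i j where "i < l" "j < l" "y = x (i, j)" | i where "i < l" "y = x (i, l)" | i where "i < k" "y = w i"
        using w l by (auto simp: kl bij_betw_def less_Suc_eq)
      then show "y \<in> g ` ({..<k} \<times> {..<k})"
      proof cases
        case (1 i j)
        then show ?thesis using l by (intro image_eqI[of _ _ "(i, j)"]) (auto simp: g_def)
      next
        case (2 i)
        then show ?thesis using l by (intro image_eqI[of _ _ "(l, i)"]) (auto simp: g_def)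
      next
        case (3 i)
        then show ?thesis using l by (intro image_eqI[of _ _ "(i, l)"]) (auto simp: g_def less_Suc_eq)
      qed
    qed
  qed
  ultimately show "perfectly_matchable E (x ` ({..<k - 1} \<times> {..<k}) \<union> W)" by simp
qed


text \<open>The last column is chosen from the link of \<open>w (k - 1)\<close>, a proportion at
  least \<open>1 / 2\<close>; each of the \<open>k - 1\<close> rows then has at least the proportion
  \<open>2 * \<gamma>\<close> of choices completing both its last entry and \<open>w i\<close>. Half
  of the resulting bound is given up for degenerate arrays.\<close>

lemma many_absorbers:
  fixes \<gamma> :: real and k :: nat
  assumes E: "kgraph k V E" and k: "2 \<le> k" and \<gamma>: "0 < \<gamma>" and W: "W \<in> nsets V k"
    and deg: "\<And>v. v \<in> V \<Longrightarrow> (1 / 2 + \<gamma>) * real (card V) ^ (k - 1) \<le> fact (k - 1) * degree E {v}"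
    and I: "I = {..<k - 1} \<times> {..<k}"
    and large: "4 * (card I * card I + card I * k) \<le> (2 * \<gamma>) ^ (k - 1) * card V"
  shows "(2 * \<gamma>) ^ (k - 1) / 4 * real (card V) ^ card I
    \<le> card {x \<in> PiE I (\<lambda>_. V). inj_on x I \<and> absorbs E (x ` I) W}"
proof -
  define n where "n = card V"
  define N where "N v = {y \<in> PiE {..<k - 1} (\<lambda>_. V). insert v (y ` {..<k - 1}) \<in> E}" for v
  have fV: "finite V" using E by (simp add: kgraph_def)
  have fI: "finite I" by (simp add: I)
  have WV: "W \<subseteq> V" "finite W" "card W = k" using W by (auto simp: nsets_def)
  obtain w where w: "bij_betw w {..<k} W"
    using WV ex_bij_betw_nat_finite[OF WV(2)] by (auto simp: atLeast0LessThan)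
  have wV: "w i \<in> V" if "i < k" for i using w that WV by (auto simp: bij_betw_def)
  have K: "card I = (k - 1) * k" "0 < card I" using k by (simp_all add: I)
  have N1: "(1 / 2 + \<gamma>) * real n ^ (k - 1) \<le> card (N u)" if "u \<in> V" for u
    using common_link_functions(1)[OF E _ that that deg] k by (simp add: N_def n_def)
  have N2: "2 * \<gamma> * real n ^ (k - 1) \<le> card (N u \<inter> N v)" if "u \<in> V" "v \<in> V" for u v
    using common_link_functions(2)[OF E _ that deg] k by (simp add: N_def n_def)
  have fN: "finite (N v)" for v using fV by (simp add: N_def finite_PiE)
  \<comment> \<open>\<open>u\<close> is the last column and the \<open>i\<close>-th component of the
    second entry is the rest of row \<open>i\<close>. The exponents add up because
    \<open>(k - 1) + (k - 1) * (k - 1) = card I\<close>.\<close>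
  define T where "T = (SIGMA u:N (w (k - 1)). PiE {..<k - 1} (\<lambda>i. N (w i) \<inter> N (u i)))"
  have cT: "1 / 2 * (2 * \<gamma>) ^ (k - 1) * real n ^ card I \<le> card T"
  proof -
    have "1 / 2 * (2 * \<gamma>) ^ (k - 1) * real n ^ card I = 1 / 2 * real n ^ (k - 1) * (2 * \<gamma> * real n ^ (k - 1)) ^ (k - 1)"
    proof -
      obtain l where "k = Suc l" using k by (cases k) auto
      then show ?thesis by (simp add: K power_mult_distrib power_add mult.commute flip: power_mult)
    qed
    also have "\<dots> \<le> card (N (w (k - 1))) * (2 * \<gamma> * real n ^ (k - 1)) ^ (k - 1)"
    proof (rule mult_right_mono)
      have "1 / 2 * real n ^ (k - 1) \<le> (1 / 2 + \<gamma>) * real n ^ (k - 1)" using \<gamma> by (intro mult_right_mono) auto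
      then show "1 / 2 * real n ^ (k - 1) \<le> card (N (w (k - 1)))" using N1[of "w (k - 1)"] wV[of "k - 1"] k by linarith
    qed (use \<gamma> in simp)
    also have "\<dots> = (\<Sum>u\<in>N (w (k - 1)). (2 * \<gamma> * real n ^ (k - 1)) ^ (k - 1))" by simp
    also have "\<dots> \<le> (\<Sum>u\<in>N (w (k - 1)). real (card (PiE {..<k - 1} (\<lambda>i. N (w i) \<inter> N (u i)))))"
    proof (rule sum_mono)
      fix u assume "u \<in> N (w (k - 1))"
      then have uV: "u i \<in> V" if "i < k - 1" for i using that by (auto simp: N_def)
      have "(2 * \<gamma> * real n ^ (k - 1)) ^ (k - 1) = (\<Prod>i<k - 1. 2 * \<gamma> * real n ^ (k - 1))" by simp
      also have "\<dots> \<le> (\<Prod>i<k - 1. real (card (N (w i) \<inter> N (u i))))"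
        using N2 wV uV \<gamma> by (intro prod_mono) auto
      finally show "(2 * \<gamma> * real n ^ (k - 1)) ^ (k - 1) \<le> real (card (PiE {..<k - 1} (\<lambda>i. N (w i) \<inter> N (u i))))"
        by (simp add: card_PiE)
    qed
    also have "\<dots> = card T" unfolding T_def using fN by (subst card_SigmaI) (auto simp: finite_PiE)
    finally show ?thesis .
  qed
  define Y where "Y = {x \<in> PiE I (\<lambda>_. V).
      (\<forall>i<k - 1. insert (x (i, k - 1)) ((\<lambda>j. x (i, j)) ` {..<k - 1}) \<in> E \<and>
        insert (w i) ((\<lambda>j. x (i, j)) ` {..<k - 1}) \<in> E) \<and>
      insert (w (k - 1)) ((\<lambda>i. x (i, k - 1)) ` {..<k - 1}) \<in> E}"
  define \<Phi> where "\<Phi> = (\<lambda>(u :: nat \<Rightarrow> 'a, U :: nat \<Rightarrow> nat \<Rightarrow> 'a). \<lambda>p\<in>I. if snd p < k - 1 then U (fst p) (snd p) else u (fst p))"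
  have \<Phi>1: "\<Phi> (u, U) (i, j) = U i j" if "i < k - 1" "j < k - 1" for u U i j
  proof -
    have "j < k" using that by linarith
    then show ?thesis using that by (simp add: \<Phi>_def I)
  qed
  have \<Phi>2: "\<Phi> (u, U) (i, k - 1) = u i" if "i < k - 1" for u U i
    using that by (simp add: \<Phi>_def I)
  have fY: "finite Y" using fV fI by (simp add: Y_def finite_PiE)
  have "card T \<le> card Y"
  proof (rule card_inj_on_le[OF _ _ fY])
    show "inj_on \<Phi> T"
    proof (rule inj_onI)
      fix p q assume pq: "p \<in> T" "q \<in> T" "\<Phi> p = \<Phi> q"
      obtain u U u' U' where uU: "p = (u, U)" "q = (u', U')" by (cases p, cases q) auto
      have "u i = u' i" if "i < k - 1" for i using \<Phi>2[OF that] pq(3) uU by metis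
      moreover have "u \<in> PiE {..<k - 1} (\<lambda>_. V)" "u' \<in> PiE {..<k - 1} (\<lambda>_. V)"
        using pq(1,2) uU by (auto simp: T_def N_def)
      ultimately have "u = u'" by (intro PiE_ext[of u "{..<k - 1}" "\<lambda>_. V" u']) auto
      have Ui: "U i \<in> PiE {..<k - 1} (\<lambda>_. V)" "U' i \<in> PiE {..<k - 1} (\<lambda>_. V)" if "i < k - 1" for i
        using pq(1,2) uU that by (auto simp: T_def N_def PiE_iff)
      have "U i = U' i" if "i < k - 1" for i
      proof (rule PiE_ext[OF Ui[OF that]])
        fix j assume "j \<in> {..<k - 1}"
        then show "U i j = U' i j" using \<Phi>1[OF that, of j] pq(3) uU by (metis lessThan_iff)
      qed
      moreover have "U \<in> extensional {..<k - 1}" "U' \<in> extensional {..<k - 1}"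
        using pq(1,2) uU by (auto simp: T_def PiE_iff)
      ultimately have "U = U'" by (intro extensionalityI[of U "{..<k - 1}" U']) auto
      then show "p = q" using \<open>u = u'\<close> uU by simp
    qed
    show "\<Phi> ` T \<subseteq> Y"
    proof
      fix x assume "x \<in> \<Phi> ` T"
      then obtain u U where uU: "(u, U) \<in> T" "x = \<Phi> (u, U)" by auto
      have u: "u \<in> N (w (k - 1))" and U: "\<And>i. i < k - 1 \<Longrightarrow> U i \<in> N (w i) \<and> U i \<in> N (u i)"
        using uU(1) by (auto simp: T_def PiE_iff)
      have xU: "(\<lambda>j. x (i, j)) ` {..<k - 1} = U i ` {..<k - 1}" if "i < k - 1" for i
        using \<Phi>1[OF that] uU(2) by (intro image_cong) auto
      have xu: "(\<lambda>i. x (i, k - 1)) ` {..<k - 1} = u ` {..<k - 1}"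
        using \<Phi>2 uU(2) by (intro image_cong) auto
      have "U i j \<in> V" "u i \<in> V" if "i < k - 1" "j < k - 1" for i j
        using u U[OF that(1)] that by (auto simp: N_def PiE_iff)
      then have "x \<in> PiE I (\<lambda>_. V)"
        using uU(2) k by (auto simp: \<Phi>_def I)
      then show "x \<in> Y"
        using u U xU xu \<Phi>2 uU(2) by (simp add: Y_def N_def)
    qed
  qed
  then have cY: "1 / 2 * (2 * \<gamma>) ^ (k - 1) * real n ^ card I \<le> card Y" using cT by linarith
  define Coll where "Coll = {x \<in> PiE I (\<lambda>_. V). \<exists>p\<in>I. \<exists>q\<in>I. p \<noteq> q \<and> x p = x q}"
  \<comment> \<open>Arrays with a repeated entry or an entry in \<open>W\<close>. Either condition
    costs a factor of order \<open>n\<close>, and \<open>large\<close> makes \<open>n\<close> big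
    enough to keep them below half of the bound for \<open>Y\<close>.\<close>
  define Bad where "Bad = Coll \<union> (\<Union>p\<in>I. {x \<in> PiE I (\<lambda>_. V). x p \<in> W})"
  have b1: "card Coll \<le> (card I * card I) * n ^ (card I - 1)"
  proof -
    have "card {v \<in> V. u = v} \<le> 1" for u
      using card_mono[of "{u}" "{v \<in> V. u = v}"] by auto
    then show ?thesis
      using card_PiE_collision_le[OF fI fV, of "(=)" 1] by (simp add: Coll_def n_def)
  qed
  have "card (\<Union>p\<in>I. {x \<in> PiE I (\<lambda>_. V). x p \<in> W}) \<le> (\<Sum>p\<in>I. card {x \<in> PiE I (\<lambda>_. V). x p \<in> W})"
    by (rule card_UN_le[OF fI])
  also have "\<dots> = (\<Sum>p\<in>I. k * n ^ (card I - 1))"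
    using card_PiE_single[OF fI _ fV WV(1)] WV(3) by (intro sum.cong) (auto simp: n_def)
  finally have b2: "card (\<Union>p\<in>I. {x \<in> PiE I (\<lambda>_. V). x p \<in> W}) \<le> (card I * k) * n ^ (card I - 1)" by simp
  have "card Bad \<le> (card I * card I + card I * k) * n ^ (card I - 1)"
    using card_Un_le[of Coll "\<Union>p\<in>I. {x \<in> PiE I (\<lambda>_. V). x p \<in> W}"] b1 b2
    unfolding Bad_def add_mult_distrib by linarith
  then have "real (card Bad) \<le> real ((card I * card I + card I * k) * n ^ (card I - 1))" by (simp only: of_nat_le_iff)
  also have "\<dots> = real (card I * card I + card I * k) * real n ^ (card I - 1)" by simp
  also have "\<dots> \<le> ((2 * \<gamma>) ^ (k - 1) * real n / 4) * real n ^ (card I - 1)"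
    using large by (intro mult_right_mono) (auto simp: n_def)
  also have "\<dots> = (2 * \<gamma>) ^ (k - 1) / 4 * (real n * real n ^ (card I - 1))" by simp
  also have "real n * real n ^ (card I - 1) = real n ^ card I" using K by (metis power_eq_if less_irrefl)
  finally have cBad: "real (card Bad) \<le> (2 * \<gamma>) ^ (k - 1) / 4 * real n ^ card I" .
  have fBad: "finite Bad" unfolding Bad_def Coll_def using fI fV by (auto simp: finite_PiE)
  have "Y - Bad \<subseteq> {x \<in> PiE I (\<lambda>_. V). inj_on x I \<and> absorbs E (x ` I) W}"
  proof
    fix x assume x: "x \<in> Y - Bad"
    then have xV: "x \<in> PiE I (\<lambda>_. V)" by (simp add: Y_def)
    have inj: "inj_on x I"
    proof (rule inj_onI, rule ccontr)
      fix p q assume "p \<in> I" "q \<in> I" "x p = x q" "p \<noteq> q"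
      then have "x \<in> Bad" using xV unfolding Bad_def Coll_def by blast
      then show False using x by simp
    qed
    have "x p \<notin> W" if "p \<in> I" for p using x xV that unfolding Bad_def by blast
    then have disj: "x ` I \<inter> W = {}" by blast
    have "absorbs E (x ` ({..<k - 1} \<times> {..<k})) W"
      by (rule absorber_array[OF _ w inj[unfolded I] disj[unfolded I]]) (use x k in \<open>auto simp: Y_def\<close>)
    then show "x \<in> {x \<in> PiE I (\<lambda>_. V). inj_on x I \<and> absorbs E (x ` I) W}" using xV inj by (simp add: I)
  qed
  then have "card (Y - Bad) \<le> card {x \<in> PiE I (\<lambda>_. V). inj_on x I \<and> absorbs E (x ` I) W}"
    using fV fI by (intro card_mono) (auto simp: finite_PiE)
  moreover have "card Y - card Bad \<le> card (Y - Bad)" by (rule diff_card_le_card_Diff[OF fBad])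
  ultimately have "real (card Y) - real (card Bad) \<le> card {x \<in> PiE I (\<lambda>_. V). inj_on x I \<and> absorbs E (x ` I) W}"
    by linarith
  then show ?thesis using cY cBad by (simp add: n_def)
qed

section \<open>Random selection of disjoint absorbers\<close>

text \<open>Replacing one sample changes the proportion of hits by at most \<open>1 / m\<close>, so
  a deviation of \<open>\<alpha> / 2\<close> has the exponent
  \<open>(\<alpha> / 2)\<^sup>2 * m / 4\<close>.\<close>

lemma few_samples_deviate:
  fixes \<alpha> :: real
  assumes X: "finite X" "X \<noteq> {}" and m: "0 < m" and \<alpha>: "0 < \<alpha>" "\<alpha> \<le> 1"
    and R: "R \<subseteq> X" "\<alpha> * card X \<le> card R"
  shows "real (card {h \<in> PiE {..<m} (\<lambda>_. X). card {j \<in> {..<m}. h j \<in> R} \<le> \<alpha> / 2 * m})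
    \<le> card X ^ m * exp (- (\<alpha>\<^sup>2 * m / 16))"
proof -
  define f where "f h = card {j \<in> {..<m}. h j \<in> R} / real m" for h
  have fle: "f h \<le> f h' + 1 / m" if "\<And>j. j \<noteq> i \<Longrightarrow> h j = h' j" for h h' i
  proof -
    have "{j \<in> {..<m}. h j \<in> R} \<subseteq> insert i {j \<in> {..<m}. h' j \<in> R}"
    proof
      fix j assume "j \<in> {j \<in> {..<m}. h j \<in> R}"
      then show "j \<in> insert i {j \<in> {..<m}. h' j \<in> R}" using that[of j] by (cases "j = i") auto
    qed
    then have "card {j \<in> {..<m}. h j \<in> R} \<le> card (insert i {j \<in> {..<m}. h' j \<in> R})" by (intro card_mono) auto
    also have "\<dots> \<le> Suc (card {j \<in> {..<m}. h' j \<in> R})" by (rule card_insert_le_m1) simp_all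
    finally have "real (card {j \<in> {..<m}. h j \<in> R}) \<le> card {j \<in> {..<m}. h' j \<in> R} + 1" by simp
    then show ?thesis using m by (simp add: f_def field_simps)
  qed
  have diff: "\<bar>f (h(i := x)) - f h\<bar> \<le> 1 / m" for h i x
    using fle[of i "h(i := x)" h] fle[of i h "h(i := x)"] by simp
  let ?\<Omega> = "PiE {..<m} (\<lambda>_. X)"
  have f\<Omega>: "finite ?\<Omega>" using X by (simp add: finite_PiE)
  have "\<alpha> * real (card X ^ card {..<m}) * m = m * (\<alpha> * card X * real (card X) ^ (m - 1))"
  proof -
    obtain l where "m = Suc l" using m by (cases m) auto
    then show ?thesis by (simp add: mult_ac)
  qed
  also have "\<dots> \<le> m * (card R * real (card X) ^ (m - 1))"
    using R(2) by (intro mult_left_mono mult_right_mono) auto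
  also have "\<dots> = (\<Sum>j<m. real (card {h \<in> ?\<Omega>. h j \<in> R}))"
    using card_PiE_single[of "{..<m}" _ X R] X R by simp
  also have "\<dots> = (\<Sum>h\<in>?\<Omega>. real (card {j \<in> {..<m}. h j \<in> R}))"
    by (rule sum_real_card_swap) (use f\<Omega> in auto)
  also have "\<dots> = (\<Sum>h\<in>?\<Omega>. f h) * m" using m by (simp add: f_def sum_divide_distrib[symmetric])
  finally have mean: "\<alpha> * real (card X ^ card {..<m}) \<le> (\<Sum>h\<in>?\<Omega>. f h)" using m by simp
  have "real (card {h \<in> ?\<Omega>. f h \<le> \<alpha> - \<alpha> / 2}) \<le> real (card X ^ card {..<m}) * exp (- ((\<alpha> / 2)\<^sup>2 / (4 * card {..<m} * (1 / m)\<^sup>2)))"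
    by (rule bounded_difference_tail) (use X m \<alpha> diff mean in auto)
  also have "(\<alpha> / 2)\<^sup>2 / (4 * card {..<m} * (1 / m)\<^sup>2) = \<alpha>\<^sup>2 * m / 16"
    using m by (simp add: power2_eq_square)
  also have "{h \<in> ?\<Omega>. f h \<le> \<alpha> - \<alpha> / 2} = {h \<in> ?\<Omega>. card {j \<in> {..<m}. h j \<in> R} \<le> \<alpha> / 2 * m}"
    using m by (simp add: f_def pos_divide_le_eq)
  finally show ?thesis by simp
qed

text \<open>Deletion method. Among \<open>m\<close> independent samples every \<open>R W\<close>
  receives more than \<open>\<alpha> / 2 * m\<close> hits outside a quarter of the outcomes, and
  fewer than \<open>\<alpha> / 4 * m\<close> pairs intersect outside another quarter. Some outcome
  satisfies both, and dropping one sample of each intersecting pair leaves enough hits.\<close>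

lemma disjoint_selection:
  fixes \<alpha> b :: real and R :: "'w \<Rightarrow> ('i \<Rightarrow> 'v) set"
  assumes I: "finite I" "I \<noteq> {}" and V: "finite V" "V \<noteq> {}" and \<alpha>: "0 < \<alpha>" "\<alpha> \<le> 1"
    and m: "0 < m" "16 * card I * card I * m \<le> \<alpha> * card V"
    and \<W>: "finite \<W>" "4 * card \<W> * exp (- (\<alpha>\<^sup>2 * m / 16)) \<le> 1"
    and R: "\<And>W. W \<in> \<W> \<Longrightarrow> R W \<subseteq> PiE I (\<lambda>_. V)" "\<And>W. W \<in> \<W> \<Longrightarrow> \<alpha> * real (card V) ^ card I \<le> card (R W)"
  shows "\<exists>J\<subseteq>PiE I (\<lambda>_. V). card J \<le> m \<and> (\<forall>x\<in>J. \<forall>y\<in>J. x \<noteq> y \<longrightarrow> x ` I \<inter> y ` I = {}) \<and>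
    (\<forall>W\<in>\<W>. \<alpha> / 4 * m \<le> card (J \<inter> R W))"
proof -
  define n where "n = card V"
  define K where "K = card I"
  have K: "0 < K" using I by (simp add: K_def card_gt_0_iff)
  define X where "X = PiE I (\<lambda>_. V)"
  have X: "finite X" "X \<noteq> {}" "card X = n ^ K"
    using I V by (auto simp: X_def n_def K_def finite_PiE card_funcsetE PiE_eq_empty_iff)
  have n: "0 < n" using V by (simp add: n_def card_gt_0_iff)
  then have cX: "0 < card X" using X by simp
  let ?\<Omega> = "PiE {..<m} (\<lambda>_. X)"
  have f\<Omega>: "finite ?\<Omega>" using X by (simp add: finite_PiE)
  have c\<Omega>: "card ?\<Omega> = card X ^ m" by (simp add: card_funcsetE)
  define \<Omega>1 where "\<Omega>1 W = {h \<in> ?\<Omega>. card {j \<in> {..<m}. h j \<in> R W} \<le> \<alpha> / 2 * m}" for W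
  have c1: "real (card (\<Omega>1 W)) \<le> card X ^ m * exp (- (\<alpha>\<^sup>2 * m / 16))" if "W \<in> \<W>" for W
    unfolding \<Omega>1_def using R[OF that] X m \<alpha> by (intro few_samples_deviate) (auto simp: X_def[symmetric] n_def K_def)
  have "card (\<Union>W\<in>\<W>. \<Omega>1 W) \<le> (\<Sum>W\<in>\<W>. card (\<Omega>1 W))" by (rule card_UN_le[OF \<W>(1)])
  then have "real (card (\<Union>W\<in>\<W>. \<Omega>1 W)) \<le> (\<Sum>W\<in>\<W>. real (card (\<Omega>1 W)))"
    unfolding of_nat_sum[symmetric] of_nat_le_iff .
  also have "\<dots> \<le> (\<Sum>W\<in>\<W>. card X ^ m * exp (- (\<alpha>\<^sup>2 * m / 16)))" by (rule sum_mono) (rule c1)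
  also have "\<dots> = 1 / 4 * real (card X ^ m) * (4 * card \<W> * exp (- (\<alpha>\<^sup>2 * m / 16)))" by simp
  also have "\<dots> \<le> 1 / 4 * real (card X ^ m) * 1" using \<W>(2) by (intro mult_left_mono) auto
  finally have c1: "real (card (\<Union>W\<in>\<W>. \<Omega>1 W)) \<le> 1 / 4 * real (card X ^ m)" by simp
  define Pr where "Pr = {(i, j). i < j \<and> j < m}"
  have fPr: "finite Pr" unfolding Pr_def by (rule finite_subset[of _ "{..<m} \<times> {..<m}"]) auto
  have cPr: "card Pr \<le> m * m"
  proof -
    have "card Pr \<le> card ({..<m} \<times> {..<m})" by (rule card_mono) (auto simp: Pr_def)
    then show ?thesis by (simp add: card_cartesian_product)
  qed
  define conf where "conf h = card {(i, j) \<in> Pr. h i ` I \<inter> h j ` I \<noteq> {}}" for h :: "nat \<Rightarrow> 'i \<Rightarrow> 'v"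
  have meet: "card {w \<in> X. u ` I \<inter> w ` I \<noteq> {}} \<le> K * K * n ^ (K - 1)" if "u \<in> X" for u
  proof -
    have uV: "u ` I \<subseteq> V" using that by (auto simp: X_def)
    have "u ` I \<inter> w ` I \<noteq> {} \<longleftrightarrow> (\<exists>p\<in>I. w p \<in> u ` I)" for w :: "'i \<Rightarrow> 'v"
      unfolding disjoint_iff by (metis (no_types, lifting) imageE imageI)
    then have "{w \<in> X. u ` I \<inter> w ` I \<noteq> {}} = (\<Union>p\<in>I. {w \<in> X. w p \<in> u ` I})" by auto
    then have "card {w \<in> X. u ` I \<inter> w ` I \<noteq> {}} \<le> (\<Sum>p\<in>I. card {w \<in> X. w p \<in> u ` I})"
      using card_UN_le[OF I(1), of "\<lambda>p. {w \<in> X. w p \<in> u ` I}"] by simp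
    also have "\<dots> = (\<Sum>p\<in>I. card (u ` I) * n ^ (K - 1))"
      using card_PiE_single[OF I(1) _ V(1) uV] by (simp add: X_def n_def K_def)
    also have "\<dots> \<le> (\<Sum>p\<in>I. K * n ^ (K - 1))"
      using card_image_le[OF I(1), of u] by (intro sum_mono mult_right_mono) (auto simp: K_def)
    finally show ?thesis by (simp add: K_def mult.assoc)
  qed
  have "(\<Sum>h\<in>?\<Omega>. conf h) = (\<Sum>h\<in>?\<Omega>. card {p \<in> Pr. h (fst p) ` I \<inter> h (snd p) ` I \<noteq> {}})"
    unfolding conf_def by (simp add: case_prod_unfold)
  also have "\<dots> = (\<Sum>p\<in>Pr. card {h \<in> ?\<Omega>. h (fst p) ` I \<inter> h (snd p) ` I \<noteq> {}})"
    by (rule sum_card_swap[OF f\<Omega> fPr])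
  also have "\<dots> \<le> (\<Sum>p\<in>Pr. K * K * n ^ (K - 1) * card X ^ (m - 1))"
  proof (rule sum_mono)
    fix p assume "p \<in> Pr"
    then have "fst p \<in> {..<m}" "snd p \<in> {..<m}" "fst p \<noteq> snd p" by (auto simp: Pr_def)
    from card_PiE_pair_le[OF _ this X(1), of "\<lambda>u w. u ` I \<inter> w ` I \<noteq> {}", OF _ meet]
    show "card {h \<in> ?\<Omega>. h (fst p) ` I \<inter> h (snd p) ` I \<noteq> {}} \<le> K * K * n ^ (K - 1) * card X ^ (m - 1)" by simp
  qed
  also have "\<dots> = card Pr * (K * K * n ^ (K - 1) * card X ^ (m - 1))" by simp
  also have "\<dots> \<le> (m * m) * (K * K * n ^ (K - 1) * card X ^ (m - 1))" using cPr by (rule mult_right_mono) simp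
  finally have sumconf: "(\<Sum>h\<in>?\<Omega>. conf h) \<le> (m * m) * (K * K * n ^ (K - 1) * card X ^ (m - 1))" .
  \<comment> \<open>Markov's inequality: the mean of \<open>conf\<close> is at most
    \<open>m * m * K * K / n\<close>, which by the assumption on \<open>m\<close> is at most
    \<open>\<alpha> * m / 16\<close>.\<close>
  define \<Omega>2 where "\<Omega>2 = {h \<in> ?\<Omega>. \<alpha> / 4 * m \<le> conf h}"
  have "real (card \<Omega>2) * (\<alpha> / 4 * m) = (\<Sum>h\<in>\<Omega>2. \<alpha> / 4 * m)" by simp
  also have "\<dots> \<le> (\<Sum>h\<in>\<Omega>2. real (conf h))" by (rule sum_mono) (simp add: \<Omega>2_def)
  also have "\<dots> \<le> (\<Sum>h\<in>?\<Omega>. real (conf h))" using f\<Omega> by (intro sum_mono2) (auto simp: \<Omega>2_def)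
  also have "\<dots> \<le> real ((m * m) * (K * K * n ^ (K - 1) * card X ^ (m - 1)))"
    using sumconf unfolding of_nat_sum[symmetric] of_nat_le_iff .
  also have "\<dots> = real m * (real (K * K * m) * (real n ^ (K - 1) * real (card X) ^ (m - 1)))" by simp
  also have "\<dots> \<le> real m * (\<alpha> * n / 16 * (real n ^ (K - 1) * real (card X) ^ (m - 1)))"
    using m(2) by (intro mult_left_mono mult_right_mono) (auto simp: K_def n_def mult_ac)
  also have "\<dots> = real m * \<alpha> / 16 * ((real n * real n ^ (K - 1)) * real (card X) ^ (m - 1))" by simp
  also have "real n * real n ^ (K - 1) = real (card X)" 
    using power_minus_mult[OF K, of "real n"] X(3) by (simp add: mult.commute)
  also have "real (card X) * real (card X) ^ (m - 1) = real (card X) ^ m" 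
    using power_minus_mult[OF m(1), of "real (card X)"] by (simp add: mult.commute)
  finally have "real (card \<Omega>2) * (\<alpha> / 4 * m) \<le> (1 / 4 * real (card X) ^ m) * (\<alpha> / 4 * m)" by (simp add: mult_ac)
  then have c2: "real (card \<Omega>2) \<le> 1 / 4 * real (card X) ^ m"
    using \<alpha> m(1) by (subst (asm) mult_le_cancel_right_pos) auto
  have "\<not> ?\<Omega> \<subseteq> (\<Union>W\<in>\<W>. \<Omega>1 W) \<union> \<Omega>2"
  proof
    assume "?\<Omega> \<subseteq> (\<Union>W\<in>\<W>. \<Omega>1 W) \<union> \<Omega>2"
    moreover have "(\<Union>W\<in>\<W>. \<Omega>1 W) \<union> \<Omega>2 \<subseteq> ?\<Omega>" by (auto simp: \<Omega>1_def \<Omega>2_def)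
    ultimately have "?\<Omega> = (\<Union>W\<in>\<W>. \<Omega>1 W) \<union> \<Omega>2" by (rule subset_antisym)
    then have "card X ^ m \<le> card ((\<Union>W\<in>\<W>. \<Omega>1 W) \<union> \<Omega>2)" using c\<Omega> by simp
    also have "\<dots> \<le> card (\<Union>W\<in>\<W>. \<Omega>1 W) + card \<Omega>2" by (rule card_Un_le)
    finally have "real (card X ^ m) \<le> real (card (\<Union>W\<in>\<W>. \<Omega>1 W)) + real (card \<Omega>2)"
      unfolding of_nat_add[symmetric] of_nat_le_iff .
    moreover have "0 < real (card X) ^ m" using cX by simp
    ultimately show False using c1 c2 unfolding of_nat_power by linarith
  qed
  then obtain h where h: "h \<in> ?\<Omega>" "\<And>W. W \<in> \<W> \<Longrightarrow> h \<notin> \<Omega>1 W" "h \<notin> \<Omega>2" by blast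
  have hit: "\<alpha> / 2 * m < card {j \<in> {..<m}. h j \<in> R W}" if "W \<in> \<W>" for W
    using h(1) h(2)[OF that] by (simp add: \<Omega>1_def)
  have conf: "conf h < \<alpha> / 4 * m" using h(1,3) by (simp add: \<Omega>2_def)
  \<comment> \<open>Keeps an index if its sample is disjoint from all earlier ones. Every deleted
    index is the second member of a conflicting pair, so at most \<open>conf h\<close> are
    deleted.\<close>
  define J0 where "J0 = {j \<in> {..<m}. \<forall>i<j. h i ` I \<inter> h j ` I = {}}"
  have disj: "h i ` I \<inter> h j ` I = {}" if "i \<in> J0" "j \<in> J0" "i \<noteq> j" for i j
    using that by (cases "i < j") (auto simp: J0_def not_less_iff_gr_or_eq)
  have inj: "inj_on h J0"
  proof (rule inj_onI, rule ccontr)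
    fix i j assume "i \<in> J0" "j \<in> J0" "h i = h j" "i \<noteq> j"
    then show False using disj[of i j] I(2) by simp
  qed
  have "{..<m} - J0 \<subseteq> snd ` {(i, j) \<in> Pr. h i ` I \<inter> h j ` I \<noteq> {}}"
    by (force simp: J0_def Pr_def)
  moreover have "finite {(i, j) \<in> Pr. h i ` I \<inter> h j ` I \<noteq> {}}" using fPr by (rule finite_subset[rotated]) auto
  ultimately have del: "card ({..<m} - J0) \<le> conf h"
    unfolding conf_def by (rule surj_card_le[rotated])
  show ?thesis
  proof (intro exI[of _ "h ` J0"] conjI ballI impI)
    show "h ` J0 \<subseteq> PiE I (\<lambda>_. V)" using h(1) by (auto simp: J0_def X_def)
    have "card (h ` J0) \<le> card J0" by (rule card_image_le) (simp add: J0_def)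
    also have "\<dots> \<le> card {..<m}" by (rule card_mono) (auto simp: J0_def)
    finally show "card (h ` J0) \<le> m" by simp
    show "x ` I \<inter> y ` I = {}" if "x \<in> h ` J0" "y \<in> h ` J0" "x \<noteq> y" for x y
      using that disj by blast
    fix W assume W: "W \<in> \<W>"
    have "{j \<in> {..<m}. h j \<in> R W} \<subseteq> {j \<in> J0. h j \<in> R W} \<union> ({..<m} - J0)" by blast
    then have "card {j \<in> {..<m}. h j \<in> R W} \<le> card ({j \<in> J0. h j \<in> R W} \<union> ({..<m} - J0))"
      by (intro card_mono) (auto simp: J0_def)
    also have "\<dots> \<le> card {j \<in> J0. h j \<in> R W} + card ({..<m} - J0)" by (rule card_Un_le)
    finally have "card {j \<in> {..<m}. h j \<in> R W} \<le> card {j \<in> J0. h j \<in> R W} + conf h" using del by linarith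
    then have "real (card {j \<in> {..<m}. h j \<in> R W}) \<le> real (card {j \<in> J0. h j \<in> R W}) + real (conf h)"
      unfolding of_nat_add[symmetric] of_nat_le_iff .
    then have "\<alpha> / 4 * m \<le> card {j \<in> J0. h j \<in> R W}" using hit[OF W] conf by linarith
    also have "card {j \<in> J0. h j \<in> R W} = card (h ` {j \<in> J0. h j \<in> R W})"
      using inj by (intro card_image[symmetric]) (auto intro: inj_on_subset)
    also have "h ` {j \<in> J0. h j \<in> R W} = h ` J0 \<inter> R W" by blast
    finally show "\<alpha> / 4 * m \<le> card (h ` J0 \<inter> R W)" .
  qed
qed

text \<open>\<open>\<beta>\<close> limits the size of the family, so that its removal hardly changes
  degrees, and \<open>\<zeta>\<close> measures how much it can absorb. That \<open>\<zeta>\<close>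
  is independent of the hypergraph allows the almost perfect matching to be required afterwards with
  an error below \<open>\<zeta>\<close>.\<close>

lemma absorbing_family:
  fixes \<beta> \<gamma> :: real and k :: nat
  assumes k: "2 \<le> k" and \<gamma>: "0 < \<gamma>" "\<gamma> \<le> 1 / 2" and \<beta>: "0 < \<beta>"
  shows "\<exists>\<zeta>::real. 0 < \<zeta> \<and> (\<exists>N. \<forall>(V :: 'v set) E. kgraph k V E \<longrightarrow> N \<le> card V \<longrightarrow>
    (\<forall>v\<in>V. (1 / 2 + \<gamma>) * real (card V) ^ (k - 1) \<le> fact (k - 1) * degree E {v}) \<longrightarrow>
    (\<exists>\<A>. finite \<A> \<and> pairwise disjnt \<A> \<and> (\<forall>A\<in>\<A>. A \<subseteq> V \<and> card A = k * (k - 1) \<and> perfectly_matchable E A) \<and>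
      card \<A> \<le> \<beta> * card V \<and> (\<forall>W\<in>nsets V k. \<zeta> * card V \<le> card {A \<in> \<A>. absorbs E A W})))"
proof -
  define I where "I = {..<k - 1} \<times> {..<k}"
  define \<alpha> where "\<alpha> = (2 * \<gamma>) ^ (k - 1) / 4"
  define K where "K = real (card I)"
  have "(0, 0) \<in> I" using k by (simp add: I_def)
  then have "I \<noteq> {}" by blast
  then have I: "finite I" "I \<noteq> {}" "card I = k * (k - 1)" by (simp_all add: I_def)
  have K: "0 < K" using I k by (simp add: K_def)
  have "(2 * \<gamma>) ^ (k - 1) \<le> 1" using \<gamma> by (intro power_le_one) auto
  then have \<alpha>: "0 < \<alpha>" "\<alpha> \<le> 1" using \<gamma> by (simp_all add: \<alpha>_def)
  \<comment> \<open>The number of samples is about \<open>b * n\<close>: the first bound respects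
    \<open>\<beta>\<close>, the second is the conflict condition of
    \<open>disjoint_selection\<close>.\<close>
  define b where "b = min \<beta> (\<alpha> / (16 * K * K))"
  have b: "0 < b" "b \<le> \<beta>" "b \<le> \<alpha> / (16 * K * K)" using \<alpha> \<beta> K by (auto simp: b_def)
  \<comment> \<open>Rounding \<open>b * n\<close> down leaves \<open>m\<close> at least
    \<open>b * n / 2\<close>, so the exponent \<open>\<alpha>\<^sup>2 * m / 16\<close> is at least
    \<open>\<kappa> * n\<close>; it has to beat the \<open>n ^ k\<close> sets \<open>W\<close>. The
    same halving turns \<open>\<alpha> / 4 * m\<close> into the witness
    \<open>\<alpha> * b / 8\<close>.\<close>
  define \<kappa> where "\<kappa> = \<alpha>\<^sup>2 * b / 32"
  have \<kappa>: "0 < \<kappa>" using \<alpha> b by (simp add: \<kappa>_def)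
  have "\<forall>\<^sub>F n in sequentially. real n ^ k * exp (- (\<kappa> * real n)) < 1 / 4"
    using order_tendstoD(2)[OF power_times_exp_tendsto_0[OF \<kappa>, of k], of "1 / 4"] by simp
  then obtain N0 where N0: "\<And>n. N0 \<le> n \<Longrightarrow> real n ^ k * exp (- (\<kappa> * real n)) < 1 / 4"
    unfolding eventually_sequentially by blast
  define N1 where "N1 = Max {N0, nat \<lceil>2 / b\<rceil>, nat \<lceil>real (card I * card I + card I * k) / \<alpha>\<rceil>, 1}"
  show ?thesis
  proof (intro exI[of _ "\<alpha> * b / 8"] exI[of _ N1] conjI allI impI)
    show "0 < \<alpha> * b / 8" using \<alpha> b by simp
    fix V :: "'v set" and E
    assume E: "kgraph k V E" and big: "N1 \<le> card V"
      and deg: "\<forall>v\<in>V. (1 / 2 + \<gamma>) * real (card V) ^ (k - 1) \<le> fact (k - 1) * degree E {v}"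
    define n where "n = card V"
    have n: "N0 \<le> n" "2 / b \<le> n" "real (card I * card I + card I * k) / \<alpha> \<le> n" "0 < n"
      using big by (auto simp: N1_def n_def)
    have V: "finite V" "V \<noteq> {}" using E n by (auto simp: kgraph_def n_def)
    define m where "m = nat \<lfloor>b * n\<rfloor>"
    have bn: "2 \<le> b * n" using n(2) b by (simp add: field_simps)
    have m: "b * n / 2 \<le> m" "m \<le> b * n" "0 < m"
      using bn by (simp_all add: m_def) linarith+
    define R where "R W = {x \<in> PiE I (\<lambda>_. V). inj_on x I \<and> absorbs E (x ` I) W}" for W
    have "\<exists>J\<subseteq>PiE I (\<lambda>_. V). card J \<le> m \<and> (\<forall>x\<in>J. \<forall>y\<in>J. x \<noteq> y \<longrightarrow> x ` I \<inter> y ` I = {}) \<and>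
      (\<forall>W\<in>nsets V k. \<alpha> / 4 * m \<le> card (J \<inter> R W))"
    proof (rule disjoint_selection[OF I(1,2) V \<alpha> m(3)])
      show "finite (nsets V k)" using V by (simp add: finite_imp_finite_nsets)
      show "R W \<subseteq> PiE I (\<lambda>_. V)" for W by (auto simp: R_def)
      have "real (16 * card I * card I * m) = 16 * K * K * m" by (simp add: K_def)
      also have "\<dots> \<le> 16 * K * K * (\<alpha> / (16 * K * K) * n)"
        using m(2) mult_right_mono[OF b(3), of "real n"] K by (intro mult_left_mono) auto
      also have "\<dots> = \<alpha> * n" using K by simp
      finally show "real (16 * card I * card I * m) \<le> \<alpha> * card V" by (simp add: n_def)
      show "4 * card (nsets V k) * exp (- (\<alpha>\<^sup>2 * m / 16)) \<le> 1"
      proof -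
        have "(n choose k) \<le> n ^ k" using le_trans[OF _ binomial_fact_pow, of "n choose k" n k] by simp
        then have "real (n choose k) \<le> real n ^ k" unfolding of_nat_power[symmetric] of_nat_le_iff .
        moreover have "exp (- (\<alpha>\<^sup>2 * m / 16)) \<le> exp (- (\<kappa> * n))"
          using mult_left_mono[OF m(1), of "\<alpha>\<^sup>2 / 16"] by (simp add: \<kappa>_def)
        ultimately have "real (n choose k) * exp (- (\<alpha>\<^sup>2 * m / 16)) \<le> real n ^ k * exp (- (\<kappa> * n))"
          by (intro mult_mono) auto
        then have "real (n choose k) * exp (- (\<alpha>\<^sup>2 * m / 16)) < 1 / 4" using N0[OF n(1)] by linarith
        then show ?thesis by (simp add: card_nsets n_def)
      qed
      fix W assume W: "W \<in> nsets V k"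
      show "\<alpha> * real (card V) ^ card I \<le> card (R W)"
        unfolding R_def \<alpha>_def
      proof (rule many_absorbers[OF E k \<gamma>(1) W _ I_def])
        show "real (4 * (card I * card I + card I * k)) \<le> (2 * \<gamma>) ^ (k - 1) * card V"
          using n(3) \<alpha>(1) by (simp add: \<alpha>_def n_def field_simps)
      qed (use deg in auto)
    qed
    then obtain J where J: "J \<subseteq> PiE I (\<lambda>_. V)" "card J \<le> m"
      "\<And>x y. x \<in> J \<Longrightarrow> y \<in> J \<Longrightarrow> x \<noteq> y \<Longrightarrow> x ` I \<inter> y ` I = {}"
      "\<And>W. W \<in> nsets V k \<Longrightarrow> \<alpha> / 4 * m \<le> card (J \<inter> R W)" by metis
    \<comment> \<open>Discards the samples that are not matchable arrays. Samples in some
      \<open>R W\<close> survive, since absorbing includes being matchable.\<close>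
    define J' where "J' = {x \<in> J. inj_on x I \<and> perfectly_matchable E (x ` I)}"
    define \<A> where "\<A> = (\<lambda>x. x ` I) ` J'"
    have fJ: "finite J" using J(1) I V by (meson finite_PiE finite_subset)
    have fJ': "finite J'" "card J' \<le> card J" using fJ by (auto simp: J'_def intro: card_mono)
    have injJ: "inj_on (\<lambda>x. x ` I) J"
    proof (rule inj_onI, rule ccontr)
      fix x y assume "x \<in> J" "y \<in> J" "x ` I = y ` I" "x \<noteq> y"
      then show False using J(3)[of x y] I(2) by simp
    qed
    show "\<exists>\<A>. finite \<A> \<and> pairwise disjnt \<A> \<and> (\<forall>A\<in>\<A>. A \<subseteq> V \<and> card A = k * (k - 1) \<and> perfectly_matchable E A) \<and>
      card \<A> \<le> \<beta> * card V \<and> (\<forall>W\<in>nsets V k. \<alpha> * b / 8 * card V \<le> card {A \<in> \<A>. absorbs E A W})"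
    proof (intro exI[of _ \<A>] conjI ballI)
      show "finite \<A>" using fJ' by (simp add: \<A>_def)
      show "pairwise disjnt \<A>"
      proof (rule pairwiseI)
        fix A B assume "A \<in> \<A>" "B \<in> \<A>" "A \<noteq> B"
        then obtain x y where "x \<in> J" "y \<in> J" "A = x ` I" "B = y ` I" "x \<noteq> y" by (auto simp: \<A>_def J'_def)
        then show "disjnt A B" using J(3) by (simp add: disjnt_def)
      qed
      have "card \<A> \<le> m" using card_image_le[OF fJ'(1), of "\<lambda>x. x ` I"] fJ'(2) J(2) by (simp add: \<A>_def)
      then have "real (card \<A>) \<le> b * n" using m(2) by linarith
      also have "\<dots> \<le> \<beta> * n" using b(2) by (intro mult_right_mono) auto
      finally show "card \<A> \<le> \<beta> * card V" by (simp add: n_def)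
      show "A \<subseteq> V" if "A \<in> \<A>" for A using that J(1) by (auto simp: \<A>_def J'_def)
      show "card A = k * (k - 1)" if "A \<in> \<A>" for A
        using that by (auto simp: \<A>_def J'_def card_image I(3))
      show "perfectly_matchable E A" if "A \<in> \<A>" for A using that by (auto simp: \<A>_def J'_def)
      fix W assume W: "W \<in> nsets V k"
      have "\<alpha> * b / 8 * card V = \<alpha> / 4 * (b * n / 2)" by (simp add: n_def)
      also have "\<dots> \<le> \<alpha> / 4 * m" using m(1) \<alpha> by (intro mult_left_mono) auto
      also have "\<dots> \<le> card (J \<inter> R W)" by (rule J(4)[OF W])
      also have "card (J \<inter> R W) \<le> card {A \<in> \<A>. absorbs E A W}"
      proof (rule card_inj_on_le[where f = "\<lambda>x. x ` I"])
        show "inj_on (\<lambda>x. x ` I) (J \<inter> R W)" using injJ by (rule inj_on_subset) auto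
        show "(\<lambda>x. x ` I) ` (J \<inter> R W) \<subseteq> {A \<in> \<A>. absorbs E A W}"
          by (auto simp: \<A>_def J'_def R_def absorbs_def)
        show "finite {A \<in> \<A>. absorbs E A W}" using fJ' by (simp add: \<A>_def)
      qed
      finally show "\<alpha> * b / 8 * card V \<le> card {A \<in> \<A>. absorbs E A W}" by simp
    qed
  qed
qed

section \<open>Lower bounds for the threshold\<close>

lemma perfectly_matchable_iff_matching_number:
  assumes E: "kgraph k V E" and k: "0 < k"
  shows "real (card V) / real k \<le> real (matching_number E) \<longleftrightarrow> perfectly_matchable E V"
proof
  have fV: "finite V" and EV: "E \<subseteq> nsets V k" using E by (auto simp: kgraph_def)
  have fE: "finite E" by (rule kgraph_finite_edges[OF E])
  {
    assume "perfectly_matchable E V"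
    then obtain M where M: "M \<subseteq> E" "partition_on V M" by (auto simp: perfectly_matchable_def)
    then have "card V = k * card M" using EV by (intro card_partition_on[OF fV]) (auto simp: nsets_def)
    moreover have "card M \<le> matching_number E"
      using M by (intro card_le_matching_number[OF fE]) (auto simp: matching_def partition_on_def)
    ultimately show "real (card V) / real k \<le> real (matching_number E)" using k by simp
  }
  assume "real (card V) / real k \<le> real (matching_number E)"
  then have le: "card V \<le> k * matching_number E"
    using k by (simp add: pos_divide_le_eq mult.commute flip: of_nat_mult)
  obtain M where M: "matching E M" "card M = matching_number E" using exists_maximum_matching[OF fE] by blast
  have Mk: "\<forall>p\<in>M. card p = k" and MV: "\<Union>M \<subseteq> V" using M(1) EV by (auto simp: matching_def nsets_def)
  have part: "partition_on (\<Union>M) M" using M(1) Mk k by (auto simp: partition_on_def matching_def)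
  have "card (\<Union>M) = k * card M" by (rule card_partition_on[OF finite_subset[OF MV fV] part Mk])
  then have "\<Union>M = V" using le M(2) MV fV by (intro card_seteq) auto
  then show "perfectly_matchable E V" using part M(1) by (auto simp: perfectly_matchable_def matching_def)
qed

lemma card_le_fractional_matching_number:
  assumes "finite E" "matching E M"
  shows "real (card M) \<le> fractional_matching_number V E"
proof -
  define w where "w e = (if e \<in> M then 1 else 0 :: real)" for e :: "'a set"
  have ME: "M \<subseteq> E" "pairwise disjnt M" using assms by (auto simp: matching_def)
  have fM: "finite M" using ME(1) assms(1) by (rule finite_subset)
  have "(\<Sum>e | e \<in> E \<and> v \<in> e. w e) \<le> 1" for v
  proof -
    have "(\<Sum>e | e \<in> E \<and> v \<in> e. w e) = card ({e. e \<in> E \<and> v \<in> e} \<inter> M)"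
      using assms(1) by (simp add: w_def sum.If_cases)
    moreover have "card ({e. e \<in> E \<and> v \<in> e} \<inter> M) \<le> Suc 0"
    proof (subst card_le_Suc0_iff_eq)
      show "\<forall>a\<in>{e. e \<in> E \<and> v \<in> e} \<inter> M. \<forall>b\<in>{e. e \<in> E \<and> v \<in> e} \<inter> M. a = b"
        using ME(2) by (auto simp: pairwise_def disjnt_def)
    qed (use fM in simp)
    ultimately show ?thesis by simp
  qed
  then have "fractional_matching V E w" by (simp add: fractional_matching_def w_def)
  moreover have "(\<Sum>e\<in>E. w e) = card M" using assms(1) ME(1) by (simp add: w_def sum.If_cases Int_absorb1)
  moreover have "bdd_above ((\<lambda>w. \<Sum>e\<in>E. w e) ` {w. fractional_matching V E w})"
  proof (rule bdd_aboveI2)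
    fix w assume "w \<in> {w. fractional_matching V E w}"
    then have "(\<Sum>e\<in>E. w e) \<le> (\<Sum>e\<in>E. 1)" by (intro sum_mono) (simp add: fractional_matching_def)
    then show "(\<Sum>e\<in>E. w e) \<le> card E" by simp
  qed
  ultimately show ?thesis unfolding fractional_matching_number_def
    by (metis (mono_tags, lifting) cSup_upper image_eqI mem_Collect_eq)
qed

lemma matching_threshold_spec:
  fixes V :: "nat set"
  assumes "kgraph k V E" "d \<le> card V" "matching_threshold d k (card V) \<le> min_degree d V E"
  shows "real (card V) / real k \<le> real (matching_number E)"
proof -
  let ?P = "\<lambda>m. \<forall>(W :: nat set) F. kgraph k W F \<longrightarrow> card W = card V \<longrightarrow> min_degree d W F \<ge> m \<longrightarrow>
        real (matching_number F) \<ge> real (card V) / real k"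
  have "?P (2 ^ card V + 1)"
    using min_degree_le assms(2) by (metis Suc_eq_plus1 not_less_eq_eq)
  then have "?P (matching_threshold d k (card V))"
    unfolding matching_threshold_def by (rule LeastI)
  then show ?thesis using assms by blast
qed

lemma fractional_threshold_le_matching_threshold:
  assumes "d \<le> n" "0 < k"
  shows "fractional_threshold d k n \<le> matching_threshold d k n"
  unfolding fractional_threshold_def
proof (rule Least_le, intro allI impI)
  fix V :: "nat set" and E
  assume E: "kgraph k V E" and n: "card V = n" and deg: "matching_threshold d k n \<le> min_degree d V E"
  have "real n / real k \<le> real (matching_number E)"
    using matching_threshold_spec[OF E] deg n assms(1) by simp
  then have "perfectly_matchable E V" using perfectly_matchable_iff_matching_number[OF E assms(2)] n by simp
  then obtain M where M: "M \<subseteq> E" "partition_on V M" by (auto simp: perfectly_matchable_def)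
  have "card V = k * card M"
    using M E by (intro card_partition_on) (auto simp: kgraph_def nsets_def)
  moreover have "matching E M" using M by (auto simp: matching_def partition_on_def)
  then have "real (card M) \<le> fractional_matching_number V E"
    by (rule card_le_fractional_matching_number[OF kgraph_finite_edges[OF E]])
  ultimately show "real n / real k \<le> fractional_matching_number V E" using n assms(2) by auto
qed

section \<open>The parity obstruction\<close>

text \<open>An elementary symmetric polynomial in signs of small total. Singling out one factor
  writes \<open>r\<close> times the sum as a sum over \<open>(r - 1)\<close>-sets \<open>T\<close>
  of the product over \<open>T\<close> times the sum of \<open>g\<close> outside \<open>T\<close>;
  the latter differs from the full sum by at most \<open>card T\<close>. So cancellation saves a
  factor of order \<open>card V\<close>.\<close>

lemma signed_sum_nsets_le:
  fixes g :: "'v \<Rightarrow> real"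
  assumes V: "finite V" and r: "0 < r" and g: "\<And>x. \<bar>g x\<bar> \<le> 1"
  shows "\<bar>\<Sum>R\<in>nsets V r. \<Prod>x\<in>R. g x\<bar> \<le> (card V choose (r - 1)) * (\<bar>\<Sum>x\<in>V. g x\<bar> + r)"
proof -
  have fin: "finite (nsets V s)" for s using V by (rule finite_imp_finite_nsets)
  have finR: "finite R" if "R \<in> nsets V s" for R s using that by (simp add: nsets_def)
  have "r * (\<Sum>R\<in>nsets V r. \<Prod>x\<in>R. g x) = (\<Sum>R\<in>nsets V r. \<Sum>x\<in>R. \<Prod>y\<in>R. g y)"
    unfolding sum_distrib_left by (rule sum.cong) (auto simp: nsets_def)
  also have "\<dots> = (\<Sum>R\<in>nsets V r. \<Sum>x\<in>R. (\<Prod>y\<in>R - {x}. g y) * g x)"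
    using finR by (intro sum.cong refl) (simp add: prod.remove mult.commute)
  also have "\<dots> = (\<Sum>(R, x)\<in>(SIGMA R:nsets V r. R). (\<Prod>y\<in>R - {x}. g y) * g x)"
    using fin finR by (intro sum.Sigma) auto
  also have "\<dots> = (\<Sum>(T, x)\<in>(SIGMA T:nsets V (r - 1). V - T). (\<Prod>y\<in>T. g y) * g x)"
    by (rule sum.reindex_bij_witness[where j = "\<lambda>(R, x). (R - {x}, x)" and i = "\<lambda>(T, x). (insert x T, x)"])
      (use r in \<open>auto simp: nsets_def insert_absorb\<close>)
  also have "\<dots> = (\<Sum>T\<in>nsets V (r - 1). \<Sum>x\<in>V - T. (\<Prod>y\<in>T. g y) * g x)"
    using fin V by (intro sum.Sigma[symmetric]) auto
  finally have "real r * \<bar>\<Sum>R\<in>nsets V r. \<Prod>x\<in>R. g x\<bar> = \<bar>\<Sum>T\<in>nsets V (r - 1). \<Sum>x\<in>V - T. (\<Prod>y\<in>T. g y) * g x\<bar>"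
    by (metis abs_mult abs_of_nat)
  also have "\<dots> \<le> (\<Sum>T\<in>nsets V (r - 1). \<bar>\<Sum>x\<in>V - T. (\<Prod>y\<in>T. g y) * g x\<bar>)" by (rule sum_abs)
  also have "\<dots> \<le> (\<Sum>T\<in>nsets V (r - 1). \<bar>\<Sum>x\<in>V. g x\<bar> + r)"
  proof (rule sum_mono)
    fix T assume T: "T \<in> nsets V (r - 1)"
    then have T': "finite T" "T \<subseteq> V" "card T = r - 1" by (auto simp: nsets_def)
    have "\<bar>\<Prod>y\<in>T. g y\<bar> \<le> 1" unfolding abs_prod by (rule prod_le_1) (use g in auto)
    have "\<bar>\<Sum>x\<in>T. g x\<bar> \<le> (\<Sum>x\<in>T. 1)" by (rule order_trans[OF sum_abs]) (rule sum_mono, rule g)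
    also have "\<dots> \<le> r" using T' by simp
    finally have "\<bar>\<Sum>x\<in>V - T. g x\<bar> \<le> \<bar>\<Sum>x\<in>V. g x\<bar> + r"
      using sum_diff[OF V T'(2), of g] by linarith
    have "\<bar>\<Sum>x\<in>V - T. (\<Prod>y\<in>T. g y) * g x\<bar> = \<bar>\<Prod>y\<in>T. g y\<bar> * \<bar>\<Sum>x\<in>V - T. g x\<bar>"
      by (simp add: sum_distrib_left[symmetric] abs_mult)
    also have "\<dots> \<le> 1 * (\<bar>\<Sum>x\<in>V. g x\<bar> + r)"
      using \<open>\<bar>\<Prod>y\<in>T. g y\<bar> \<le> 1\<close> \<open>\<bar>\<Sum>x\<in>V - T. g x\<bar> \<le> \<bar>\<Sum>x\<in>V. g x\<bar> + r\<close> by (intro mult_mono) auto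
    finally show "\<bar>\<Sum>x\<in>V - T. (\<Prod>y\<in>T. g y) * g x\<bar> \<le> \<bar>\<Sum>x\<in>V. g x\<bar> + r" by simp
  qed
  also have "\<dots> = (card V choose (r - 1)) * (\<bar>\<Sum>x\<in>V. g x\<bar> + r)" by (simp add: card_nsets)
  finally have "real r * \<bar>\<Sum>R\<in>nsets V r. \<Prod>x\<in>R. g x\<bar> \<le> (card V choose (r - 1)) * (\<bar>\<Sum>x\<in>V. g x\<bar> + r)" .
  moreover have "1 * \<bar>\<Sum>R\<in>nsets V r. \<Prod>x\<in>R. g x\<bar> \<le> real r * \<bar>\<Sum>R\<in>nsets V r. \<Prod>x\<in>R. g x\<bar>"
    using r by (intro mult_right_mono) auto
  ultimately show ?thesis by simp
qed

text \<open>With sign \<open>- 1\<close> on \<open>A\<close> and \<open>1\<close> elsewhere, twice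
  the indicator of even parity is 1 plus a product of signs. Summed over the sets completing
  \<open>S\<close>, the constant part gives half of all completions, and the signed part is of lower
  order since \<open>A\<close> is nearly half of \<open>V\<close>.\<close>

lemma parity_graph_degree:
  fixes V A :: "'v set"
  assumes V: "finite V" and A: "A \<subseteq> V" and bal: "\<bar>real (card V) - 2 * card A\<bar> \<le> 2"
    and S: "S \<in> nsets V d" and r: "r = k - d" "0 < r"
  defines "E \<equiv> {e \<in> nsets V k. even (card (e \<inter> A))}"
  shows "real ((card V - d) choose r) - ((card V - d) choose (r - 1)) * (2 + d + r) \<le> 2 * degree E S"
proof -
  define g where "g x = (if x \<in> A then - 1 else 1 :: real)" for x
  define U where "U = V - S"
  have S': "S \<subseteq> V" "finite S" "card S = d" using S by (auto simp: nsets_def)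
  have U: "finite U" "card U = card V - d" using V S' by (auto simp: U_def card_Diff_subset)
  have prod_g: "(\<Prod>x\<in>R. g x) = (- 1) ^ card (R \<inter> A)" if "finite R" for R
    using that by (simp add: g_def prod.If_cases)
  have sumV: "(\<Sum>x\<in>V. g x) = real (card V) - 2 * card A"
  proof -
    have "(\<Sum>x\<in>V. g x) = real (card (V - A)) - card A"
      using V A by (simp add: g_def sum.If_cases Int_absorb1 Diff_eq[symmetric])
    moreover have "real (card (V - A)) = real (card V) - card A"
      using V A by (simp add: card_Diff_subset finite_subset card_mono of_nat_diff)
    ultimately show ?thesis by simp
  qed
  have "\<bar>\<Sum>x\<in>S. g x\<bar> \<le> (\<Sum>x\<in>S. 1)" by (rule order_trans[OF sum_abs], rule sum_mono) (simp add: g_def)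
  then have sumU: "\<bar>\<Sum>x\<in>U. g x\<bar> \<le> 2 + d"
    using sum_diff[OF V S'(1), of g] sumV bal S'(3) by (simp add: U_def)
  have "card {R \<in> nsets U r. even (card (S \<inter> A) + card (R \<inter> A))} \<le> degree E S"
    unfolding degree_def
  proof (rule card_inj_on_le[where f = "\<lambda>R. S \<union> R"])
    show "inj_on ((\<union>) S) {R \<in> nsets U r. even (card (S \<inter> A) + card (R \<inter> A))}"
      by (rule inj_onI) (auto simp: nsets_def U_def)
    show "(\<union>) S ` {R \<in> nsets U r. even (card (S \<inter> A) + card (R \<inter> A))} \<subseteq> {e \<in> E. S \<subseteq> e}"
    proof safe
      fix R assume R: "R \<in> nsets U r" "even (card (S \<inter> A) + card (R \<inter> A))"
      have R': "R \<subseteq> V" "finite R" "card R = r" "S \<inter> R = {}" using R(1) by (auto simp: nsets_def U_def)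
      have "card (S \<union> R) = k" using R' S' r by (simp add: card_Un_disjoint)
      moreover have "card ((S \<union> R) \<inter> A) = card (S \<inter> A) + card (R \<inter> A)"
        using R'(2,4) S'(2) by (subst Int_Un_distrib2, intro card_Un_disjoint) auto
      ultimately show "S \<union> R \<in> E" using R R' S' by (simp add: E_def nsets_def)
    qed
    show "finite {e \<in> E. S \<subseteq> e}" using V by (simp add: E_def finite_imp_finite_nsets)
  qed
  then have "2 * real (card {R \<in> nsets U r. even (card (S \<inter> A) + card (R \<inter> A))}) \<le> 2 * degree E S" by simp
  moreover have "2 * real (card {R \<in> nsets U r. even (card (S \<inter> A) + card (R \<inter> A))})
     = (\<Sum>R\<in>nsets U r. 1 + (- 1) ^ card (S \<inter> A) * (\<Prod>x\<in>R. g x))"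
  proof -
    have "2 * real (card {R \<in> nsets U r. even (card (S \<inter> A) + card (R \<inter> A))})
      = (\<Sum>R\<in>nsets U r. if even (card (S \<inter> A) + card (R \<inter> A)) then 2 else 0)"
      using U(1) by (simp add: sum.If_cases finite_imp_finite_nsets Int_def)
    also have "\<dots> = (\<Sum>R\<in>nsets U r. 1 + (- 1) ^ card (S \<inter> A) * (\<Prod>x\<in>R. g x))"
      by (rule sum.cong) (auto simp: prod_g nsets_def uminus_power_if)
    finally show ?thesis .
  qed
  moreover have "\<dots> = real ((card V - d) choose r) + (- 1) ^ card (S \<inter> A) * (\<Sum>R\<in>nsets U r. \<Prod>x\<in>R. g x)"
    by (simp add: sum.distrib card_nsets U(2) sum_distrib_left)
  moreover have "\<bar>(- 1) ^ card (S \<inter> A) * (\<Sum>R\<in>nsets U r. \<Prod>x\<in>R. g x)\<bar> \<le> ((card V - d) choose (r - 1)) * (2 + d + r)"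
  proof -
    have "\<bar>(- 1) ^ card (S \<inter> A) * (\<Sum>R\<in>nsets U r. \<Prod>x\<in>R. g x)\<bar> = \<bar>\<Sum>R\<in>nsets U r. \<Prod>x\<in>R. g x\<bar>"
      by (simp add: abs_mult)
    also have "\<dots> \<le> (card U choose (r - 1)) * (\<bar>\<Sum>x\<in>U. g x\<bar> + r)"
      by (rule signed_sum_nsets_le[OF U(1) r(2)]) (simp add: g_def)
    also have "\<dots> \<le> real (card U choose (r - 1)) * real (2 + d + r)"
      using sumU by (intro mult_left_mono) auto
    finally show ?thesis unfolding U(2) of_nat_mult .
  qed
  ultimately show ?thesis by linarith
qed

lemma parity_graph_not_matchable:
  assumes V: "finite V" and A: "A \<subseteq> V" "odd (card A)"
  shows "\<not> perfectly_matchable {e \<in> nsets V k. even (card (e \<inter> A))} V"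
proof
  assume "perfectly_matchable {e \<in> nsets V k. even (card (e \<inter> A))} V"
  then obtain M where M: "M \<subseteq> {e \<in> nsets V k. even (card (e \<inter> A))}" "partition_on V M"
    by (auto simp: perfectly_matchable_def)
  have fM: "finite M" using M(2) V by (rule finite_elements[rotated])
  have "A = (\<Union>e\<in>M. e \<inter> A)" using M(2) A(1) by (auto simp: partition_on_def)
  then have "card A = card (\<Union>e\<in>M. e \<inter> A)" by simp
  also have "\<dots> = (\<Sum>e\<in>M. card (e \<inter> A))"
  proof (rule card_UN_disjoint[OF fM])
    show "\<forall>e\<in>M. finite (e \<inter> A)" using A V by (meson finite_Int finite_subset)
    show "\<forall>e\<in>M. \<forall>e'\<in>M. e \<noteq> e' \<longrightarrow> (e \<inter> A) \<inter> (e' \<inter> A) = {}"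
      using M(2) unfolding partition_on_def pairwise_def disjnt_def by blast
  qed
  finally have "card A = (\<Sum>e\<in>M. card (e \<inter> A))" .
  moreover have "even (\<Sum>e\<in>M. card (e \<inter> A))" using M(1) by (intro dvd_sum) auto
  ultimately show False using A(2) by simp
qed

text \<open>Shows that \<open>N choose (r - 1)\<close> is of lower order than
  \<open>N choose r\<close>.\<close>

lemma binomial_ratio:
  assumes "0 < r"
  shows "(N - (r - 1)) * (N choose (r - 1)) = r * (N choose r)"
  using binomial_absorb_comp[of N "r - 1"] times_binomial_minus1_eq[OF assms, of N] by simp

lemma matching_threshold_parity:
  fixes \<epsilon> :: real
  assumes dk: "d < k" and \<epsilon>: "0 < \<epsilon>"
  shows "\<forall>\<^sub>F n in sequentially. (1 / 2 - \<epsilon>) * ((n - d) choose (k - d)) \<le> matching_threshold d k n"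
proof -
  define r where "r = k - d"
  have r: "0 < r" using dk by (simp add: r_def)
  \<comment> \<open>The quotient by \<open>2 * \<epsilon>\<close> pushes the error term of
    \<open>parity_graph_degree\<close> below \<open>2 * \<epsilon>\<close> times the main binomial
    coefficient, through \<open>binomial_ratio\<close>.\<close>
  define N where "N = k + d + 2 + nat \<lceil>r * (2 + d + r) / (2 * \<epsilon>)\<rceil> + r"
  have "(1 / 2 - \<epsilon>) * ((n - d) choose r) \<le> matching_threshold d k n" if n: "N \<le> n" for n
  proof -
    define V where "V = {..<n}"
    \<comment> \<open>An odd size at distance at most 1 from \<open>n / 2\<close>, hence the balance
      bound 2.\<close>
    define a where "a = (if odd (n div 2) then n div 2 else n div 2 + 1)"
    have n2: "2 \<le> n" using n by (simp add: N_def)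
    have "odd a" by (simp add: a_def)
    moreover have "a \<le> n" "n \<le> 2 * a + 2" "2 * a \<le> n + 2" using n2 by (auto simp: a_def)
    ultimately have a: "odd a" "a \<le> n" "\<bar>real n - 2 * real a\<bar> \<le> 2" by auto
    define A where "A = {..<a}"
    define E where "E = {e \<in> nsets V k. even (card (e \<inter> A))}"
    have V: "finite V" "card V = n" and A: "A \<subseteq> V" "card A = a" using a by (auto simp: V_def A_def)
    have kg: "kgraph k V E" using V by (auto simp: kgraph_def E_def)
    have dn: "d \<le> card V" using V n by (simp add: N_def)
    define C where "C = real ((n - d) choose r)"
    have small: "((n - d) choose (r - 1)) * (2 + d + r) \<le> 2 * \<epsilon> * C"
    proof -
      have pos: "0 < (n - d) - (r - 1)" using n r by (simp add: N_def)
      have "real r * (2 + d + r) / (2 * \<epsilon>) \<le> real ((n - d) - (r - 1))"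
      proof -
        have "nat \<lceil>real (r * (2 + d + r)) / (2 * \<epsilon>)\<rceil> \<le> (n - d) - (r - 1)" using n unfolding N_def by linarith
        then show ?thesis unfolding nat_ceiling_le_eq of_nat_mult .
      qed
      then have "real r * (2 + d + r) \<le> 2 * \<epsilon> * real ((n - d) - (r - 1))"
        using \<epsilon> by (simp add: pos_divide_le_eq mult.commute)
      then have "real r * (2 + d + r) * ((n - d) choose (r - 1)) \<le> 2 * \<epsilon> * real ((n - d) - (r - 1)) * ((n - d) choose (r - 1))"
        by (rule mult_right_mono) simp
      also have "\<dots> = 2 * \<epsilon> * real (((n - d) - (r - 1)) * ((n - d) choose (r - 1)))" by simp
      also have "\<dots> = 2 * \<epsilon> * (real r * C)" unfolding binomial_ratio[OF r] by (simp add: C_def)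
      finally have "real r * (((n - d) choose (r - 1)) * (2 + d + r)) \<le> real r * (2 * \<epsilon> * C)"
        by (simp add: algebra_simps)
      then show ?thesis using r by simp
    qed
    have "(1 / 2 - \<epsilon>) * C \<le> degree E S" if "S \<in> nsets V d" for S
      using parity_graph_degree[OF V(1) A(1) _ that r_def r] a(3) small V A
      unfolding E_def C_def by (simp add: left_diff_distrib)
    then have "nat \<lceil>(1 / 2 - \<epsilon>) * C\<rceil> \<le> min_degree d V E"
      using min_degree_ge_iff[OF V(1) dn] by (simp add: nat_le_iff ceiling_le_iff)
    moreover have "\<not> matching_threshold d k n \<le> min_degree d V E"
    proof
      assume "matching_threshold d k n \<le> min_degree d V E"
      then have "real n / real k \<le> real (matching_number E)" using matching_threshold_spec[OF kg dn] V by simp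
      then have "perfectly_matchable E V"
        using perfectly_matchable_iff_matching_number[OF kg] V dk by simp
      then show False using parity_graph_not_matchable[OF V(1) A(1)] A a by (simp add: E_def)
    qed
    ultimately have "nat \<lceil>(1 / 2 - \<epsilon>) * C\<rceil> \<le> matching_threshold d k n" by linarith
    then show ?thesis by (simp add: C_def nat_le_iff ceiling_le_iff)
  qed
  then show ?thesis unfolding eventually_sequentially r_def by blast
qed

section \<open>Upper bound for the threshold\<close>

lemma binomial_ge_power:
  fixes \<tau> :: real
  assumes "0 < \<tau>"
  shows "\<forall>\<^sub>F n in sequentially. (1 - \<tau>) * real n ^ r \<le> fact r * ((n - j) choose r)"
proof -
  have "(\<lambda>n. (1 - real (j + r) / real n) ^ r) \<longlonglongrightarrow> (1 - 0) ^ r"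
    by (intro tendsto_intros lim_const_over_n)
  then have "\<forall>\<^sub>F n in sequentially. 1 - \<tau> < (1 - real (j + r) / real n) ^ r"
    by (rule order_tendstoD(1)) (use assms in simp)
  then show ?thesis using eventually_gt_at_top[of "j + r"]
  proof eventually_elim
    case (elim n)
    have n: "real n > 0" using elim by simp
    have "(1 - \<tau>) * real n ^ r \<le> (1 - real (j + r) / real n) ^ r * real n ^ r"
      using elim by (intro mult_right_mono) auto
    also have "\<dots> = (real n - real (j + r)) ^ r"
      using n by (simp add: power_mult_distrib[symmetric] left_diff_distrib)
    also have "\<dots> = (\<Prod>i = 0..<r. real n - real (j + r))" by simp
    also have "\<dots> \<le> (\<Prod>i = 0..<r. real (n - j) - real i)"
      using elim by (intro prod_mono) (auto simp: of_nat_diff)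
    also have "\<dots> = fact r * ((n - j) choose r)"
      by (simp add: binomial_gbinomial gbinomial_mult_fact)
    finally show ?case .
  qed
qed

text \<open>Double counting of pairs \<open>S\<close>, \<open>e\<close> with \<open>v\<close> in
  \<open>S\<close> and \<open>S\<close> inside \<open>e\<close>. It passes the relative density of
  \<open>d\<close>-degrees on to vertex degrees, which are what absorption uses.\<close>

lemma degree_vertex_ge:
  fixes x :: real
  assumes E: "kgraph k V E" and d: "1 \<le> d" "d \<le> k" and n: "k \<le> card V" and v: "v \<in> V"
    and deg: "\<And>S. S \<in> nsets V d \<Longrightarrow> x * ((card V - d) choose (k - d)) \<le> degree E S"
  shows "x * ((card V - 1) choose (k - 1)) \<le> degree E {v}"
proof -
  define n where "n = card V"
  have fV: "finite V" and EV: "E \<subseteq> nsets V k" using E by (auto simp: kgraph_def)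
  have fE: "finite E" by (rule kgraph_finite_edges[OF E])
  let ?NS = "{S \<in> nsets V d. v \<in> S}"
  have fNS: "finite ?NS" using fV by (simp add: finite_imp_finite_nsets)
  have cNS: "card ?NS = (n - 1) choose (d - 1)" using card_nsets_containing[OF fV v, of d] d by (simp add: n_def)
  have "((n - 1) choose (d - 1)) * (x * ((n - d) choose (k - d))) = (\<Sum>S\<in>?NS. x * ((n - d) choose (k - d)))"
    by (simp add: cNS)
  also have "\<dots> \<le> (\<Sum>S\<in>?NS. real (degree E S))" using deg by (intro sum_mono) (simp add: n_def)
  also have "\<dots> = (\<Sum>S\<in>?NS. real (card {e \<in> E. S \<subseteq> e}))" by (simp add: degree_def)
  also have "\<dots> = (\<Sum>e\<in>E. real (card {S \<in> ?NS. S \<subseteq> e}))" by (rule sum_real_card_swap[OF fNS fE])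
  also have "\<dots> = (\<Sum>e\<in>E. if v \<in> e then real ((k - 1) choose (d - 1)) else 0)"
  proof (rule sum.cong[OF refl])
    fix e assume "e \<in> E"
    then have e: "e \<subseteq> V" "finite e" "card e = k" using EV by (auto simp: nsets_def)
    have "{S \<in> ?NS. S \<subseteq> e} = {S \<in> nsets e d. v \<in> S}" using e by (auto simp: nsets_def)
    moreover have "card {S \<in> nsets e d. v \<in> S} = 0" if "v \<notin> e"
    proof -
      have "{S \<in> nsets e d. v \<in> S} = {}" using that by (auto simp: nsets_def)
      then show ?thesis by (simp only: card.empty)
    qed
    ultimately show "real (card {S \<in> ?NS. S \<subseteq> e}) = (if v \<in> e then real ((k - 1) choose (d - 1)) else 0)"
      using card_nsets_containing[OF e(2), of v d] d e(3) by (cases "v \<in> e") simp_all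
  qed
  also have "\<dots> = degree E {v} * real ((k - 1) choose (d - 1))"
    using fE by (simp add: sum.If_cases degree_def Int_def)
  finally have le: "((n - 1) choose (d - 1)) * (x * ((n - d) choose (k - d))) \<le> degree E {v} * real ((k - 1) choose (d - 1))" .
  have "((n - 1) choose (k - 1)) * ((k - 1) choose (d - 1)) = ((n - 1) choose (d - 1)) * ((n - d) choose (k - d))"
    using choose_mult[of "d - 1" "k - 1" "n - 1"] d n by (simp add: n_def)
  then have "real ((n - 1) choose (k - 1)) * real ((k - 1) choose (d - 1)) = real ((n - 1) choose (d - 1)) * real ((n - d) choose (k - d))"
    unfolding of_nat_mult[symmetric] of_nat_eq_iff .
  then have "(x * ((n - 1) choose (k - 1))) * real ((k - 1) choose (d - 1)) = ((n - 1) choose (d - 1)) * (x * ((n - d) choose (k - d)))"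
    by (simp only: mult_ac)
  also note le
  finally have "(x * ((n - 1) choose (k - 1))) * real ((k - 1) choose (d - 1)) \<le> degree E {v} * real ((k - 1) choose (d - 1))" .
  moreover have "0 < real ((k - 1) choose (d - 1))" using d by (simp add: zero_less_binomial_iff)
  ultimately show ?thesis by (simp add: n_def)
qed

text \<open>An edge lost to a deleted vertex \<open>u\<close> contains \<open>S\<close> and
  \<open>u\<close>, which leaves \<open>k - d - 1\<close> free vertices. This is the price of
  setting the absorbing family aside.\<close>

lemma degree_delete_vertices:
  assumes E: "kgraph k V E" and U: "U \<subseteq> V" and S: "S \<in> nsets V d" and d: "d < k" and SU: "S \<inter> U = {}"
  shows "degree E S \<le> degree {e \<in> E. e \<inter> U = {}} S + card U * card V ^ (k - d - 1)"
proof -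
  have fV: "finite V" and EV: "E \<subseteq> nsets V k" using E by (auto simp: kgraph_def)
  have fE: "finite E" by (rule kgraph_finite_edges[OF E])
  have S': "S \<subseteq> V" "finite S" "card S = d" using S by (auto simp: nsets_def)
  have fU: "finite U" using U fV by (rule finite_subset)
  have "{e \<in> E. S \<subseteq> e} \<subseteq> {e \<in> {e \<in> E. e \<inter> U = {}}. S \<subseteq> e} \<union> (\<Union>u\<in>U. {e \<in> E. insert u S \<subseteq> e})" by blast
  then have "degree E S \<le> card ({e \<in> {e \<in> E. e \<inter> U = {}}. S \<subseteq> e} \<union> (\<Union>u\<in>U. {e \<in> E. insert u S \<subseteq> e}))"
    unfolding degree_def using fE fU by (intro card_mono) auto
  also have "\<dots> \<le> degree {e \<in> E. e \<inter> U = {}} S + card (\<Union>u\<in>U. {e \<in> E. insert u S \<subseteq> e})"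
    unfolding degree_def by (rule card_Un_le)
  also have "card (\<Union>u\<in>U. {e \<in> E. insert u S \<subseteq> e}) \<le> (\<Sum>u\<in>U. card {e \<in> E. insert u S \<subseteq> e})"
    by (rule card_UN_le[OF fU])
  also have "\<dots> \<le> (\<Sum>u\<in>U. card V ^ (k - d - 1))"
  proof (rule sum_mono)
    fix u assume u: "u \<in> U"
    then have uS: "u \<notin> S" using SU by blast
    have "card {e \<in> E. insert u S \<subseteq> e} \<le> card (nsets V (k - d - 1))"
    proof (rule card_inj_on_le[where f = "\<lambda>e. e - insert u S"])
      show "inj_on (\<lambda>e. e - insert u S) {e \<in> E. insert u S \<subseteq> e}" by (rule inj_onI) blast
      show "(\<lambda>e. e - insert u S) ` {e \<in> E. insert u S \<subseteq> e} \<subseteq> nsets V (k - d - 1)"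
      proof safe
        fix e assume e: "e \<in> E" "insert u S \<subseteq> e"
        then have e': "e \<subseteq> V" "finite e" "card e = k" using EV by (auto simp: nsets_def)
        have "card (e - insert u S) = k - d - 1"
          using e(2) e' S' uS by (subst card_Diff_subset) auto
        then show "e - insert u S \<in> nsets V (k - d - 1)" using e' by (auto simp: nsets_def)
      qed
    qed (use fV in \<open>simp add: finite_imp_finite_nsets\<close>)
    also have "\<dots> \<le> card V ^ (k - d - 1)"
      using le_trans[OF _ binomial_fact_pow, of "card V choose (k - d - 1)"] by (simp add: card_nsets)
    finally show "card {e \<in> E. insert u S \<subseteq> e} \<le> card V ^ (k - d - 1)" .
  qed
  also have "\<dots> = card U * card V ^ (k - d - 1)" by simp
  finally show ?thesis by simp
qed

text \<open>The surplus over \<open>a\<close> is spent in stages: from \<open>\<epsilon>\<close> to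
  \<open>\<epsilon> / 2\<close> for replacing binomial coefficients by powers, to
  \<open>\<epsilon> / 4\<close> for removing the absorbing family, and to
  \<open>\<epsilon> / 8\<close> for sampling, where the fractional threshold is met.\<close>

lemma perfect_matching_of_min_degree:
  fixes a \<epsilon> :: real
  assumes d: "1 \<le> d" "d < k" and \<epsilon>: "0 < \<epsilon>" "\<epsilon> \<le> 1" and a: "1 / 2 \<le> a"
    and thr: "\<forall>\<^sub>F t in sequentially. real (fractional_threshold d k t) \<le> (a + \<epsilon> / 8) * ((t - d) choose (k - d))"
  shows "\<exists>N. \<forall>(V :: 'v set) E. kgraph k V E \<longrightarrow> N \<le> card V \<longrightarrow> k dvd card V \<longrightarrow>
    (\<forall>S\<in>nsets V d. (a + \<epsilon>) * ((card V - d) choose (k - d)) \<le> degree E S) \<longrightarrow> perfectly_matchable E V"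
proof -
  define r where "r = k - d"
  have r: "0 < r" and k: "2 \<le> k" using d by (auto simp: r_def)
  define K where "K = k * (k - 1)"
  have K: "0 < K" using k by (simp add: K_def)
  \<comment> \<open>The family covers at most \<open>K * \<beta> * n\<close> vertices, so its
    removal lowers the normalised degree by at most
    \<open>fact r * K * \<beta> = \<epsilon> / 4\<close> times \<open>n ^ r\<close>.\<close>
  define \<beta> where "\<beta> = \<epsilon> / (4 * fact r * real K)"
  have \<beta>: "0 < \<beta>" using \<epsilon> K by (simp add: \<beta>_def)
  have K\<beta>: "fact r * (real K * \<beta>) = \<epsilon> / 4" "real K * \<beta> \<le> 1 / 2"
  proof -
    show e: "fact r * (real K * \<beta>) = \<epsilon> / 4" using K by (simp add: \<beta>_def)
    have "1 * (real K * \<beta>) \<le> fact r * (real K * \<beta>)" using \<beta> by (intro mult_right_mono) auto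
    then show "real K * \<beta> \<le> 1 / 2" using e \<epsilon> by simp
  qed
  have "0 < \<epsilon> / 2" "\<epsilon> / 2 \<le> 1 / 2" using \<epsilon> by auto
  from absorbing_family[OF k this \<beta>] obtain \<zeta> :: real and N1 where \<zeta>: "0 < \<zeta>" and
    absorb: "\<forall>(V :: 'v set) E. kgraph k V E \<longrightarrow> N1 \<le> card V \<longrightarrow>
    (\<forall>v\<in>V. (1 / 2 + \<epsilon> / 2) * real (card V) ^ (k - 1) \<le> fact (k - 1) * degree E {v}) \<longrightarrow>
    (\<exists>\<A>. finite \<A> \<and> pairwise disjnt \<A> \<and> (\<forall>A\<in>\<A>. A \<subseteq> V \<and> card A = k * (k - 1) \<and> perfectly_matchable E A) \<and>
      card \<A> \<le> \<beta> * card V \<and> (\<forall>W\<in>nsets V k. \<zeta> * card V \<le> card {A \<in> \<A>. absorbs E A W}))"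
    by (elim exE conjE)
  \<comment> \<open>The almost perfect matching may leave only as much as the family, already
    chosen, can absorb.\<close>
  define \<eta> where "\<eta> = min (1 / 2) \<zeta>"
  have \<eta>: "0 < \<eta>" "\<eta> < 1" "\<eta> \<le> \<zeta>" using \<zeta> by (auto simp: \<eta>_def)
  have e8: "0 < \<epsilon> / 8" "\<epsilon> / 8 \<le> 1" using \<epsilon> by auto
  have "\<forall>\<^sub>F t in sequentially. real (fractional_threshold d k t) \<le> ((a + \<epsilon> / 4) - \<epsilon> / 8) * ((t - d) choose (k - d))"
  proof -
    have "(a + \<epsilon> / 4) - \<epsilon> / 8 = a + \<epsilon> / 8" by simp
    then show ?thesis using thr by (simp only:)
  qed
  from almost_perfect_matching[OF d(2) e8 \<eta>(1,2) this] obtain N2 where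
    almost: "\<And>(V :: 'v set) E. kgraph k V E \<Longrightarrow> N2 \<le> card V \<Longrightarrow> k dvd card V \<Longrightarrow>
      (\<forall>S\<in>nsets V d. (a + \<epsilon> / 4) * real (card V) ^ (k - d) \<le> fact (k - d) * degree E S) \<Longrightarrow>
      (\<exists>M. matching E M \<and> (1 - \<eta>) * card V \<le> k * card M)" by metis
  \<comment> \<open>Solves
    \<open>(a + \<epsilon>) * (1 - \<tau>) = a + \<epsilon> / 2\<close>.\<close>
  define \<tau> where "\<tau> = \<epsilon> / (2 * (a + \<epsilon>))"
  have \<tau>: "0 < \<tau>" "(a + \<epsilon>) * (1 - \<tau>) = a + \<epsilon> / 2" using \<epsilon> a by (simp_all add: \<tau>_def field_simps)
  obtain N3 where N3: "\<And>n. N3 \<le> n \<Longrightarrow> (1 - \<tau>) * real n ^ r \<le> fact r * real ((n - d) choose r)"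
    using binomial_ge_power[OF \<tau>(1), of r d] unfolding eventually_sequentially of_nat_mult of_nat_fact by blast
  obtain N4 where N4: "\<And>n. N4 \<le> n \<Longrightarrow> (1 - \<tau>) * real n ^ (k - 1) \<le> fact (k - 1) * real ((n - 1) choose (k - 1))"
    using binomial_ge_power[OF \<tau>(1), of "k - 1" 1] unfolding eventually_sequentially of_nat_mult of_nat_fact by blast
  \<comment> \<open>The factor 2 is there because the absorbing family may take up to half of the
    vertices before \<open>almost\<close> is applied.\<close>
  define N where "N = Max {N1, 2 * N2, N3, N4, k}"
  show ?thesis
  proof (intro exI[of _ N] allI impI)
    fix V :: "'v set" and E
    assume E: "kgraph k V E" and big: "N \<le> card V" and kdvd: "k dvd card V"
      and deg: "\<forall>S\<in>nsets V d. (a + \<epsilon>) * ((card V - d) choose (k - d)) \<le> degree E S"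
    define n where "n = card V"
    have n: "N1 \<le> n" "2 * N2 \<le> n" "N3 \<le> n" "N4 \<le> n" "k \<le> n" using big by (auto simp: N_def n_def)
    have fV: "finite V" and EV: "E \<subseteq> nsets V k" using E by (auto simp: kgraph_def)
    have scale: "(a + \<epsilon> / 2) * real n ^ s \<le> fact s * y"
      if "(1 - \<tau>) * real n ^ s \<le> fact s * x" "(a + \<epsilon>) * x \<le> y" for s :: nat and x y :: real
    proof -
      have "(a + \<epsilon> / 2) * real n ^ s = (a + \<epsilon>) * ((1 - \<tau>) * real n ^ s)" unfolding \<tau>(2)[symmetric] by simp
      also have "\<dots> \<le> (a + \<epsilon>) * (fact s * x)" using that(1) a \<epsilon> by (intro mult_left_mono) auto
      also have "\<dots> = fact s * ((a + \<epsilon>) * x)" by simp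
      also have "\<dots> \<le> fact s * y" using that(2) by (intro mult_left_mono) auto
      finally show ?thesis .
    qed
    have "(1 / 2 + \<epsilon> / 2) * real n ^ (k - 1) \<le> fact (k - 1) * degree E {v}" if v: "v \<in> V" for v
    proof -
      have "(a + \<epsilon>) * ((n - 1) choose (k - 1)) \<le> degree E {v}"
        using degree_vertex_ge[OF E d(1) _ _ v, of "a + \<epsilon>"] d(2) deg n(5) by (simp add: n_def)
      from scale[OF N4[OF n(4)] this] have "(a + \<epsilon> / 2) * real n ^ (k - 1) \<le> fact (k - 1) * degree E {v}" by simp
      moreover have "(1 / 2 + \<epsilon> / 2) * real n ^ (k - 1) \<le> (a + \<epsilon> / 2) * real n ^ (k - 1)"
        using a by (intro mult_right_mono) auto
      ultimately show ?thesis by linarith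
    qed
    then have vdeg: "\<forall>v\<in>V. (1 / 2 + \<epsilon> / 2) * real (card V) ^ (k - 1) \<le> fact (k - 1) * degree E {v}"
      by (simp add: n_def)
    have "N1 \<le> card V" using n(1) by (simp add: n_def)
    from absorb[THEN spec, THEN spec, THEN mp, OF E, THEN mp, OF this, THEN mp, OF vdeg, folded n_def K_def]
    obtain \<A> where \<A>0: "finite \<A>" "pairwise disjnt \<A>"
      "\<forall>A\<in>\<A>. A \<subseteq> V \<and> card A = K \<and> perfectly_matchable E A" "card \<A> \<le> \<beta> * n"
      "\<forall>W\<in>nsets V k. \<zeta> * n \<le> card {A \<in> \<A>. absorbs E A W}"
      by (elim exE conjE)
    have \<A>: "\<And>A. A \<in> \<A> \<Longrightarrow> A \<subseteq> V" "\<And>A. A \<in> \<A> \<Longrightarrow> card A = K"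
      "\<And>A. A \<in> \<A> \<Longrightarrow> perfectly_matchable E A"
      "\<And>W. W \<in> nsets V k \<Longrightarrow> \<zeta> * n \<le> card {A \<in> \<A>. absorbs E A W}"
      using \<A>0(3,5) by blast+
    define U where "U = \<Union>\<A>"
    have U: "U \<subseteq> V" using \<A>(1) by (auto simp: U_def)
    have fU: "finite U" using U fV by (rule finite_subset)
    have "card U = sum card \<A>"
      unfolding U_def using \<A>0(2) \<A>(1) fV by (intro card_Union_disjoint) (auto intro: finite_subset)
    then have cU: "card U = K * card \<A>" using \<A>(2) by simp
    then have cU': "real (card U) \<le> real K * \<beta> * n" using \<A>0(4) K by (simp add: mult.assoc)
    define V' where "V' = V - U"
    define E' where "E' = {e \<in> E. e \<inter> U = {}}"
    have fV': "finite V'" using fV by (simp add: V'_def)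
    have cV': "card V' = n - card U" "card U \<le> n" "card V' \<le> n"
      using U fU fV by (auto simp: V'_def n_def card_Diff_subset card_mono)
    have E': "kgraph k V' E'"
      using EV fV' by (auto simp: kgraph_def E'_def V'_def nsets_def)
    have "k dvd card U" by (simp add: cU K_def)
    then have kdvd': "k dvd card V'" using kdvd cV'(1,2) by (simp add: n_def)
    have "real (card U) \<le> n / 2"
      using cU' mult_right_mono[OF K\<beta>(2), of "real n"] by simp
    then have big': "N2 \<le> card V'" using n(2) cV' by linarith
    have "\<exists>M. matching E' M \<and> (1 - \<eta>) * card V' \<le> k * card M"
    proof (rule almost[OF E' big' kdvd'], intro ballI)
      fix S assume S: "S \<in> nsets V' d"
      then have SV: "S \<in> nsets V d" "S \<inter> U = {}" by (auto simp: nsets_def V'_def)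
      have "(a + \<epsilon>) * ((n - d) choose r) \<le> degree E S" using deg SV(1) by (simp add: n_def r_def)
      from scale[OF N3[OF n(3)] this] have 1: "(a + \<epsilon> / 2) * real n ^ r \<le> fact r * degree E S" by simp
      have "real (degree E S) \<le> real (degree E' S + card U * n ^ (r - 1))"
        using degree_delete_vertices[OF E U SV(1) d(2) SV(2)] unfolding E'_def n_def r_def of_nat_le_iff .
      also have "\<dots> = degree E' S + card U * real n ^ (r - 1)" by simp
      also have "\<dots> \<le> degree E' S + (real K * \<beta> * n) * real n ^ (r - 1)"
        using cU' by (intro add_left_mono mult_right_mono) auto
      also have "(real K * \<beta> * n) * real n ^ (r - 1) = real K * \<beta> * real n ^ r"
        using power_minus_mult[OF r, of "real n"] by (simp add: mult_ac)
      finally have "fact r * real (degree E S) \<le> fact r * (degree E' S + real K * \<beta> * real n ^ r)"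
        by (intro mult_left_mono) auto
      also have "\<dots> = fact r * degree E' S + (fact r * (real K * \<beta>)) * real n ^ r" by (simp add: distrib_left)
      also have "\<dots> = fact r * degree E' S + \<epsilon> / 4 * real n ^ r" by (simp only: K\<beta>(1))
      finally have "(a + \<epsilon> / 4) * real n ^ r \<le> fact r * degree E' S" using 1 by (simp add: distrib_right)
      moreover have "(a + \<epsilon> / 4) * real (card V') ^ r \<le> (a + \<epsilon> / 4) * real n ^ r"
        using cV'(3) a \<epsilon> by (intro mult_left_mono power_mono) auto
      ultimately show "(a + \<epsilon> / 4) * real (card V') ^ (k - d) \<le> real (fact (k - d) * degree E' S)"
        by (simp add: r_def)
    qed
    then obtain M where M: "matching E' M" "(1 - \<eta>) * card V' \<le> k * card M" by blast
    have Mk: "\<forall>p\<in>M. card p = k" and MV: "\<Union>M \<subseteq> V'"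
      using M(1) E' by (auto simp: matching_def kgraph_def nsets_def)
    have partM: "partition_on (\<Union>M) M" using M(1) Mk k by (auto simp: partition_on_def matching_def)
    have "M \<subseteq> E" using M(1) by (auto simp: matching_def E'_def)
    then have pmM: "perfectly_matchable E (\<Union>M)" using partM by (auto simp: perfectly_matchable_def)
    have fM: "finite (\<Union>M)" using MV fV' by (rule finite_subset)
    have cM: "card (\<Union>M) = k * card M" by (rule card_partition_on[OF fM partM Mk])
    define R where "R = V' - \<Union>M"
    have cR: "card R = card V' - k * card M" "k * card M \<le> card V'"
      using MV fM fV' cM by (auto simp: R_def card_Diff_subset card_mono simp flip: cM)
    have "k dvd card R" using kdvd' cR by simp
    then obtain P where P: "partition_on R P" "\<forall>p\<in>P. card p = k"
      using exists_uniform_partition[of R k] fV' k by (auto simp: R_def)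
    have fR: "finite R" using fV' by (simp add: R_def)
    have "real (card P) \<le> real (k * card P)" using k by (intro of_nat_mono) simp
    also have "\<dots> = card R" using card_partition_on[OF fR P] by simp
    also have "\<dots> \<le> \<eta> * card V'"
    proof -
      have "real (card R) = real (card V') - real (k * card M)" using cR by (simp add: of_nat_diff)
      then show ?thesis using M(2) by (simp add: left_diff_distrib)
    qed
    also have "\<dots> \<le> \<zeta> * n" using \<eta> cV'(3) by (intro mult_mono) auto
    finally have cP: "real (card P) \<le> \<zeta> * n" .
    have "perfectly_matchable E (\<Union>\<A> \<union> R)"
    proof (rule absorb_greedily[OF _ P(1) \<A>0(1,2) \<A>(3)])
      show "finite P" by (rule finite_elements[OF fR P(1)])
      show "R \<inter> \<Union>\<A> = {}" by (auto simp: R_def V'_def U_def)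
      fix W assume W: "W \<in> P"
      then have "W \<subseteq> R" using P(1) by (auto simp: partition_on_def)
      then have "W \<in> nsets V k"
        using W P(2) fR by (auto simp: nsets_def R_def V'_def intro: finite_subset)
      then show "card P \<le> card {A \<in> \<A>. absorbs E A W}" using \<A>(4)[of W] cP by linarith
    qed
    then have "perfectly_matchable E ((\<Union>\<A> \<union> R) \<union> \<Union>M)"
      by (rule perfectly_matchable_Un[OF _ pmM]) (use MV in \<open>auto simp: R_def V'_def U_def\<close>)
    moreover have "(\<Union>\<A> \<union> R) \<union> \<Union>M = V" using MV U by (auto simp: R_def V'_def U_def)
    ultimately show "perfectly_matchable E V" by simp
  qed
qed

lemma matching_threshold_le:
  fixes a \<epsilon> :: real
  assumes d: "1 \<le> d" "d < k" and \<epsilon>: "0 < \<epsilon>" "\<epsilon> \<le> 1" and a: "1 / 2 \<le> a"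
    and thr: "\<forall>\<^sub>F t in sequentially. real (fractional_threshold d k t) \<le> (a + \<epsilon> / 8) * ((t - d) choose (k - d))"
  shows "\<forall>\<^sub>F n in sequentially. k dvd n \<longrightarrow> matching_threshold d k n \<le> (a + \<epsilon>) * ((n - d) choose (k - d)) + 1"
proof -
  obtain N where N: "\<And>(V :: nat set) E. kgraph k V E \<Longrightarrow> N \<le> card V \<Longrightarrow> k dvd card V \<Longrightarrow>
    (\<forall>S\<in>nsets V d. (a + \<epsilon>) * ((card V - d) choose (k - d)) \<le> degree E S) \<Longrightarrow> perfectly_matchable E V"
    using perfect_matching_of_min_degree[OF d \<epsilon> a thr, where 'v = nat] by metis
  have "matching_threshold d k n \<le> (a + \<epsilon>) * ((n - d) choose (k - d)) + 1"
    if n: "max N d \<le> n" "k dvd n" for n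
  proof -
    \<comment> \<open>The threshold is a natural number, so the degree bound is rounded up; this is
      the origin of the summand 1.\<close>
    define m where "m = nat \<lceil>(a + \<epsilon>) * ((n - d) choose (k - d))\<rceil>"
    have "matching_threshold d k n \<le> m"
      unfolding matching_threshold_def
    proof (rule Least_le, intro allI impI)
      fix V :: "nat set" and E
      assume E: "kgraph k V E" and c: "card V = n" and deg: "m \<le> min_degree d V E"
      have "finite V" using E by (simp add: kgraph_def)
      then have "\<forall>S\<in>nsets V d. m \<le> degree E S" using deg min_degree_ge_iff[of V d] n c by simp
      then have "\<forall>S\<in>nsets V d. (a + \<epsilon>) * ((card V - d) choose (k - d)) \<le> degree E S"
        unfolding m_def c nat_ceiling_le_eq .
      then have "perfectly_matchable E V" using N[OF E] n c by simp
      then show "real n / real k \<le> real (matching_number E)"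
        using perfectly_matchable_iff_matching_number[OF E] d c by simp
    qed
    moreover have "real m \<le> (a + \<epsilon>) * ((n - d) choose (k - d)) + 1"
      using a \<epsilon> by (simp add: m_def)
    ultimately show ?thesis by linarith
  qed
  then show ?thesis unfolding eventually_sequentially by (intro exI[of _ "max N d"]) blast
qed

lemma binomial_at_top:
  assumes "0 < r"
  shows "\<forall>\<^sub>F n in sequentially. x \<le> real ((n - d) choose r)"
proof -
  have "\<forall>\<^sub>F n in sequentially. (1 - 1 / 2) * real n ^ r \<le> fact r * ((n - d) choose r)"
    by (rule binomial_ge_power) simp
  moreover have "\<forall>\<^sub>F n in sequentially. nat \<lceil>2 * fact r * x\<rceil> + 1 \<le> n" by (rule eventually_ge_at_top)
  ultimately show ?thesis
  proof eventually_elim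
    case (elim n)
    have "2 * fact r * x \<le> real n" using elim(2) by linarith
    also have "real n \<le> real n ^ r" using elim(2) assms by (intro self_le_power) auto
    also have "\<dots> \<le> 2 * fact r * ((n - d) choose r)" using elim(1) by simp
    finally show ?case by simp
  qed
qed

theorem theorem1p1:
  fixes d k :: nat and c :: real
  assumes "1 \<le> d" and "d \<le> k - 1"
    and "c > 0"
    and "asymp_equiv (\<lambda>n. real (fractional_threshold d k n)) at_top
           (\<lambda>n. c * real ((n - d) choose (k - d)))"
  shows "asymp_equiv (\<lambda>n. real (matching_threshold d k n)) (inf at_top (principal {n. k dvd n}))
           (\<lambda>n. max c (1 / 2) * real ((n - d) choose (k - d)))"
proof -
  have dk: "d < k" using assms(1,2) by linarith
  define C where "C n = real ((n - d) choose (k - d))" for n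
  define a where "a = max c (1 / 2)"
  have a: "1 / 2 \<le> a" "c \<le> a" by (auto simp: a_def)
  have frac: "\<forall>\<^sub>F n in sequentially. \<bar>real (fractional_threshold d k n) - c * C n\<bar> \<le> \<epsilon> * C n"
    if "0 < \<epsilon>" for \<epsilon> :: real
  proof -
    have "(\<lambda>n. real (fractional_threshold d k n) - c * C n) \<in> o(\<lambda>n. c * C n)"
      using asymp_equiv_imp_diff_smallo[OF assms(4)] by (simp add: C_def)
    from landau_o.smallD[OF this, of "\<epsilon> / c"] show ?thesis
      using assms(3) that by (simp add: abs_mult C_def)
  qed
  have bound: "\<forall>\<^sub>F n in sequentially. k dvd n \<longrightarrow> \<bar>real (matching_threshold d k n) - a * C n\<bar> \<le> 2 * \<epsilon> * C n"
    if \<epsilon>: "0 < \<epsilon>" "\<epsilon> \<le> 1" for \<epsilon> :: real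
  proof -
    have "\<forall>\<^sub>F t in sequentially. real (fractional_threshold d k t) \<le> (a + \<epsilon> / 8) * ((t - d) choose (k - d))"
    proof (rule eventually_mono[OF frac[of "\<epsilon> / 8"]])
      fix t assume "\<bar>real (fractional_threshold d k t) - c * C t\<bar> \<le> \<epsilon> / 8 * C t"
      moreover have "c * C t \<le> a * C t" using a by (intro mult_right_mono) (auto simp: C_def)
      ultimately show "real (fractional_threshold d k t) \<le> (a + \<epsilon> / 8) * ((t - d) choose (k - d))"
        unfolding C_def[symmetric] distrib_right by linarith
    qed (use \<epsilon> in simp)
    from matching_threshold_le[OF assms(1) dk \<epsilon> a(1) this]
    have upper: "\<forall>\<^sub>F n in sequentially. k dvd n \<longrightarrow> matching_threshold d k n \<le> (a + \<epsilon>) * C n + 1"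
      by (simp add: C_def)
    have lower: "\<forall>\<^sub>F n in sequentially. (1 / 2 - \<epsilon>) * C n \<le> matching_threshold d k n"
      using matching_threshold_parity[OF dk \<epsilon>(1)] by (simp add: C_def)
    \<comment> \<open>Makes the rounding summand 1 in \<open>upper\<close> at most
      \<open>\<epsilon> * C n\<close>, which explains the factor 2 in \<open>bound\<close>.\<close>
    have "\<forall>\<^sub>F n in sequentially. 1 / \<epsilon> \<le> C n"
      unfolding C_def by (rule binomial_at_top) (use dk in simp)
    then show ?thesis
      using upper lower frac[OF \<epsilon>(1)] eventually_ge_at_top[of d]
    proof eventually_elim
      case (elim n)
      have "1 \<le> \<epsilon> * C n" using elim(1) \<epsilon>(1) by (simp add: pos_divide_le_eq mult.commute)
      moreover have "real (fractional_threshold d k n) \<le> matching_threshold d k n"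
        using fractional_threshold_le_matching_threshold[OF elim(5), of k] dk by simp
      then have "(c - \<epsilon>) * C n \<le> matching_threshold d k n" using elim(4) by (simp add: left_diff_distrib)
      \<comment> \<open>The maximum equals one of its arguments: \<open>c\<close> is covered by the
        fractional threshold, \<open>1 / 2\<close> by the parity construction.\<close>
      then have "(a - \<epsilon>) * C n \<le> matching_threshold d k n" using elim(3) by (simp add: a_def max_def)
      ultimately show ?case using elim(2) by (auto simp: left_diff_distrib distrib_right abs_le_iff)
    qed
  qed
  have "(\<lambda>n. real (matching_threshold d k n) - a * C n) \<in> o[inf at_top (principal {n. k dvd n})](\<lambda>n. a * C n)"
  proof (rule landau_o.smallI)
    fix e :: real assume e: "0 < e"
    \<comment> \<open>The error \<open>2 * \<epsilon> * C n\<close> must be at most \<open>e\<close>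
      relative to \<open>a * C n\<close>, while \<open>bound\<close> asks for
      \<open>\<epsilon> \<le> 1\<close>.\<close>
    define \<epsilon> where "\<epsilon> = min 1 (e * a / 2)"
    have \<epsilon>: "0 < \<epsilon>" "\<epsilon> \<le> 1" "2 * \<epsilon> \<le> e * a" using e a(1) by (auto simp: \<epsilon>_def)
    show "\<forall>\<^sub>F n in inf at_top (principal {n. k dvd n}). norm (real (matching_threshold d k n) - a * C n) \<le> e * norm (a * C n)"
      unfolding eventually_inf_principal
    proof (rule eventually_mono[OF bound[OF \<epsilon>(1,2)]], intro impI)
      fix n assume h: "k dvd n \<longrightarrow> \<bar>real (matching_threshold d k n) - a * C n\<bar> \<le> 2 * \<epsilon> * C n" "n \<in> {n. k dvd n}"
      have C0: "0 \<le> C n" by (simp add: C_def)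
      have "2 * \<epsilon> * C n \<le> e * a * C n" using \<epsilon>(3) C0 by (rule mult_right_mono)
      then show "norm (real (matching_threshold d k n) - a * C n) \<le> e * norm (a * C n)"
        using h a(1) C0 by (simp add: abs_mult)
    qed
  qed
  then show ?thesis unfolding a_def C_def by (rule smallo_imp_asymp_equiv)
qed

end
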